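(* Let $f\not\equiv0$ be a meromorphic function on $\mathbb{C}$. Then for every $\gamma>1$, there exist a subset $E_1\subset(1,\infty)$ of finite logarithmic measure and a constant $A_\gamma$ depending only on $\gamma$, such that for every complex number $x$ with modulus $r\notin E_1\cup[0,1]$, $$\left|\frac{(\mathcal{D}_{\mathrm{W}}f)(x)}{f(x)}\right|\le2\exp\left(A_\gamma\left\{\frac{T(\gamma r,f)}{\sqrt r}+\frac{n(\gamma r)}{\sqrt r}(\ln r)^\gamma\ln^+[n(\gamma r)]\right\}\right).$$ In particular, if $f$ is of finite order $\sigma$, then for every positive integer $k$ and every $\varepsilon>0$, there exists a subset $E\subset(1,\infty)$ of finite logarithmic measure such that for every complex number $x$ with modulus $r\notin E\cup[0,1]$, $$\left|\frac{(\mathcal{D}_{\mathrm{W}}^kf)(x)}{f(x)}\right|\le e^{kr^{\sigma-\frac12+\varepsilon}}.$$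
   Context: The Wilson operator $\mathcal{D}_{\mathrm{W}}$: for $x\ne0$ and $z$ with $z^2=x$, $$(\mathcal{D}_{\mathrm{W}}f)(x):=\frac{f((z+\frac i2)^2)-f((z-\frac i2)^2)}{2iz},$$ which does not depend on the choice of $z$; at $x=0$ the value is the limit as $x\to0$, which is $f'(-\frac14)$ if $f$ is differentiable at $-\frac14$. If $f$ is meromorphic on $\mathbb{C}$, so is $\mathcal{D}_{\mathrm{W}}f$; $\mathcal{D}_{\mathrm{W}}^k$ is the $k$-fold iterate. $n(r):=n(r,f)+n(r,\frac1f)$ is the number of poles plus the number of zeros of $f$ in $|x|\le r$, counted with multiplicity. $T(r,f)$ is the Nevanlinna characteristic; the order of $f$ is $\limsup_{r\to\infty}\frac{\ln^+T(r,f)}{\ln r}$. A set $E\subset(1,\infty)$ has finite logarithmic measure if $\int_E\frac{dr}r<\infty$. *)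

theory Defs
  imports "HOL-Complex_Analysis.Complex_Analysis"
begin

section \<open>The Wilson operator\<close>

text \<open>
  A meromorphic function on the plane is represented by a function \<open>f\<close> with
  \<open>f nicely_meromorphic_on UNIV\<close>: no removable singularities are left, and the
  value at a pole is set to 0 by convention.

  \<open>wilson_quotient\<close> is the Wilson divided difference, computed with the principal root
  \<open>z = csqrt x\<close>; lemma \<open>wilson_quotient_eq\<close> shows that the choice of root is irrelevant.
  At \<open>x = 0\<close> its value carries no meaning.
\<close>

definition wilson_quotient :: "(complex \<Rightarrow> complex) \<Rightarrow> complex \<Rightarrow> complex" where
  "wilson_quotient f x =
     (f ((csqrt x + \<i> / 2)\<^sup>2) - f ((csqrt x - \<i> / 2)\<^sup>2)) / (2 * \<i> * csqrt x)"

text \<open>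
  \<open>wilson_op f\<close> is the meromorphic function given by the divided difference, again with the
  value 0 at its poles. For meromorphic \<open>f\<close>, passing from \<open>wilson_quotient\<close> to its
  \<open>remove_sings\<close> supplies the limit at \<open>x = 0\<close> and the correct values at the isolated points
  where \<open>f\<close> has poles at \<open>(z \<plusminus> \<i>/2)\<^sup>2\<close>; elsewhere nothing changes
  (lemmas \<open>wilson_op_eq\<close>, \<open>wilson_op_0\<close>, \<open>wilson_op_nicely_meromorphic\<close>).
\<close>

definition wilson_op :: "(complex \<Rightarrow> complex) \<Rightarrow> complex \<Rightarrow> complex" where
  "wilson_op f = remove_sings (wilson_quotient f)"

text \<open>
  The quotient of two meromorphic functions as a meromorphic function, so that a cancelled
  zero or pole of the denominator does not produce \<open>x / 0 = 0\<close>.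
\<close>

definition mero_quotient :: "(complex \<Rightarrow> complex) \<Rightarrow> (complex \<Rightarrow> complex) \<Rightarrow> complex \<Rightarrow> complex"
  where "mero_quotient g f = remove_sings (\<lambda>x. g x / f x)"


section \<open>Nevanlinna theory\<close>

definition ln_plus :: "real \<Rightarrow> real" where
  "ln_plus t = ln (max 1 t)"

text \<open>Number of poles in the closed disc of radius \<open>r\<close>, with multiplicity.\<close>

definition pole_count :: "real \<Rightarrow> (complex \<Rightarrow> complex) \<Rightarrow> nat" where
  "pole_count r f = (\<Sum>p | norm p \<le> r \<and> is_pole f p. nat (- zorder f p))"

text \<open>Since \<open>inverse 0 = 0\<close>, the poles of \<open>\<lambda>z. inverse (f z)\<close> are exactly the zeros of \<open>f\<close>.\<close>

definition zero_pole_count :: "real \<Rightarrow> (complex \<Rightarrow> complex) \<Rightarrow> nat" where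
  "zero_pole_count r f = pole_count r f + pole_count r (\<lambda>z. inverse (f z))"

definition proximity_fun :: "real \<Rightarrow> (complex \<Rightarrow> complex) \<Rightarrow> real" where
  "proximity_fun r f =
     1 / (2 * pi) * integral {0..2 * pi} (\<lambda>\<theta>. ln_plus (norm (f (of_real r * cis \<theta>))))"

definition integrated_count :: "real \<Rightarrow> (complex \<Rightarrow> complex) \<Rightarrow> real" where
  "integrated_count r f =
     integral {0..r} (\<lambda>t. (real (pole_count t f) - real (pole_count 0 f)) / t)
       + real (pole_count 0 f) * ln r"

definition nevanlinna_char :: "real \<Rightarrow> (complex \<Rightarrow> complex) \<Rightarrow> real" where
  "nevanlinna_char r f = proximity_fun r f + integrated_count r f"

definition nevanlinna_order :: "(complex \<Rightarrow> complex) \<Rightarrow> ereal" where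
  "nevanlinna_order f = Limsup at_top (\<lambda>r::real. ereal (ln_plus (nevanlinna_char r f) / ln r))"

definition finite_log_measure :: "real set \<Rightarrow> bool" where
  "finite_log_measure E \<longleftrightarrow>
     E \<in> sets lebesgue \<and> (\<integral>\<^sup>+r\<in>E. ennreal (1 / r) \<partial>lebesgue) < \<infinity>"


section \<open>Basic properties of the Wilson operator\<close>

lemma wilson_quotient_eq:
  assumes "z\<^sup>2 = x"
  shows "wilson_quotient f x = (f ((z + \<i> / 2)\<^sup>2) - f ((z - \<i> / 2)\<^sup>2)) / (2 * \<i> * z)"
proof -
  have "(csqrt x)\<^sup>2 = z\<^sup>2" using assms by simp
  then consider "csqrt x = z" | "csqrt x = - z" unfolding power2_eq_iff by blast
  then show ?thesis
  proof cases
    case 2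
    have *: "(- z + \<i> / 2)\<^sup>2 = (z - \<i> / 2)\<^sup>2" "(- z - \<i> / 2)\<^sup>2 = (z + \<i> / 2)\<^sup>2"
      by (simp_all add: power2_eq_square algebra_simps)
    show ?thesis unfolding wilson_quotient_def 2 *
      by (cases "z = 0") (simp_all add: field_simps)
  qed (simp add: wilson_quotient_def)
qed

lemma local_sqrt:
  fixes x :: complex
  assumes "x \<noteq> 0"
  obtains s where "s analytic_on {x}" "\<And>y. (s y)\<^sup>2 = y" "s x = csqrt x"
proof
  let ?s = "\<lambda>y. csqrt x * csqrt (y / x)"
  show "?s analytic_on {x}" using assms by (intro analytic_intros) auto
  show "(?s y)\<^sup>2 = y" for y using assms by (simp add: power_mult_distrib)
  show "?s x = csqrt x" using assms by simp
qed

lemma wilson_quotient_analytic: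
  assumes "x \<noteq> 0" "z\<^sup>2 = x" "f analytic_on {(z + \<i> / 2)\<^sup>2, (z - \<i> / 2)\<^sup>2}"
  shows "wilson_quotient f analytic_on {x}"
proof -
  obtain s where s: "s analytic_on {x}" "\<And>y. (s y)\<^sup>2 = y" "s x = csqrt x"
    using local_sqrt[OF assms(1)] by metis
  have eq: "wilson_quotient f =
      (\<lambda>y. (f ((s y + \<i> / 2)\<^sup>2) - f ((s y - \<i> / 2)\<^sup>2)) / (2 * \<i> * s y))"
    using wilson_quotient_eq[OF s(2)] by auto
  have "(s x)\<^sup>2 = z\<^sup>2" using s(2)[of x] assms(2) by simp
  then consider "s x = z" | "s x = - z" unfolding power2_eq_iff by blast
  then have an: "f analytic_on {(s x + \<i> / 2)\<^sup>2}" "f analytic_on {(s x - \<i> / 2)\<^sup>2}"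
  proof (atomize (full), cases)
    case 2
    have *: "(- z + \<i> / 2)\<^sup>2 = (z - \<i> / 2)\<^sup>2" "(- z - \<i> / 2)\<^sup>2 = (z + \<i> / 2)\<^sup>2"
      by (simp_all add: power2_eq_square algebra_simps)
    show "f analytic_on {(s x + \<i> / 2)\<^sup>2} \<and> f analytic_on {(s x - \<i> / 2)\<^sup>2}"
      unfolding 2 * using assms(3) by (auto intro: analytic_on_subset)
  qed (use assms(3) in \<open>auto intro: analytic_on_subset\<close>)
  have "(\<lambda>y. f ((s y + \<i> / 2)\<^sup>2)) analytic_on {x}" "(\<lambda>y. f ((s y - \<i> / 2)\<^sup>2)) analytic_on {x}"
    by (rule analytic_on_compose_gen[OF _ an(1), unfolded o_def]
             analytic_on_compose_gen[OF _ an(2), unfolded o_def];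
        use s(1) in \<open>auto intro!: analytic_intros\<close>)+
  then show ?thesis unfolding eq using s assms(1)
    by (intro analytic_intros) auto
qed

lemma wilson_op_eq:
  assumes "x \<noteq> 0" "z\<^sup>2 = x" "f analytic_on {(z + \<i> / 2)\<^sup>2, (z - \<i> / 2)\<^sup>2}"
  shows "wilson_op f x = (f ((z + \<i> / 2)\<^sup>2) - f ((z - \<i> / 2)\<^sup>2)) / (2 * \<i> * z)"
  using wilson_quotient_analytic[OF assms] wilson_quotient_eq[OF assms(2)]
  by (simp add: wilson_op_def)

lemma filterlim_csqrt_0: "filterlim csqrt (at 0) (at 0)"
proof -
  have "((\<lambda>x::complex. sqrt (norm x)) \<longlongrightarrow> sqrt (norm (0::complex))) (at 0)"
    by (rule tendsto_real_sqrt[OF tendsto_norm[OF tendsto_ident_at]])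
  then have "((\<lambda>x. norm (csqrt x)) \<longlongrightarrow> 0) (at 0)"
    by (simp only: norm_csqrt norm_zero real_sqrt_zero)
  then have "(csqrt \<longlongrightarrow> 0) (at 0)"
    by (rule tendsto_norm_zero_cancel)
  moreover have "eventually (\<lambda>x. csqrt x \<noteq> 0) (at 0)"
    unfolding eventually_at_filter by (rule always_eventually) simp
  ultimately show ?thesis by (rule filterlim_atI)
qed

lemma wilson_op_0:
  assumes "f field_differentiable at (- 1 / 4)"
  shows "wilson_op f 0 = deriv f (- 1 / 4)"
proof -
  let ?d = "deriv f (- 1 / 4)"
  let ?g = "\<lambda>z. f ((z + \<i> / 2)\<^sup>2) - f ((z - \<i> / 2)\<^sup>2)"
  have sq: "(0 + \<i> / 2)\<^sup>2 = - 1 / 4" "(0 - \<i> / 2)\<^sup>2 = - 1 / 4"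
    by (simp_all add: power2_eq_square)
  have f: "(f has_field_derivative ?d) (at (- 1 / 4))"
    using assms by (simp add: field_differentiable_derivI)
  have p: "((\<lambda>z. (z + \<i> / 2)\<^sup>2) has_field_derivative \<i>) (at 0)"
          "((\<lambda>z. (z - \<i> / 2)\<^sup>2) has_field_derivative - \<i>) (at 0)"
    by (auto intro!: derivative_eq_intros)
  have "((\<lambda>z. f ((z + \<i> / 2)\<^sup>2)) has_field_derivative ?d * \<i>) (at 0)"
       "((\<lambda>z. f ((z - \<i> / 2)\<^sup>2)) has_field_derivative ?d * - \<i>) (at 0)"
    using DERIV_chain2[where f = f, OF _ p(1)] DERIV_chain2[where f = f, OF _ p(2)] f
    unfolding sq by auto
  then have "(?g has_field_derivative ?d * \<i> - ?d * - \<i>) (at 0)"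
    by (rule DERIV_diff)
  then have "(\<lambda>z. ?g z / z) \<midarrow>0\<rightarrow> 2 * \<i> * ?d"
    unfolding DERIV_def by (simp add: power2_eq_square mult_ac)
  then have "(\<lambda>z. ?g z / z / (2 * \<i>)) \<midarrow>0\<rightarrow> 2 * \<i> * ?d / (2 * \<i>)"
    by (intro tendsto_intros) auto
  then have "(\<lambda>z. ?g z / (2 * \<i> * z)) \<midarrow>0\<rightarrow> ?d"
    by (simp add: mult_ac)
  from filterlim_compose[OF this filterlim_csqrt_0]
  show ?thesis unfolding wilson_op_def
    by (intro remove_sings_eqI) (simp add: wilson_quotient_def[abs_def])
qed

lemma wilson_quotient_meromorphic:
  assumes "f meromorphic_on UNIV"
  shows "wilson_quotient f meromorphic_on UNIV"
proof -
  let ?G = "\<lambda>z. (f ((z + \<i> / 2)\<^sup>2) - f ((z - \<i> / 2)\<^sup>2)) / (2 * \<i> * z)"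
  have "(\<lambda>z. f ((z + \<i> / 2)\<^sup>2)) meromorphic_on UNIV" "(\<lambda>z. f ((z - \<i> / 2)\<^sup>2)) meromorphic_on UNIV"
    by (rule meromorphic_on_compose[OF assms]; auto intro!: analytic_intros)+
  then have G: "?G meromorphic_on UNIV"
    by (intro meromorphic_intros)
  have eq: "wilson_quotient f = (\<lambda>x. ?G (csqrt x))"
    by (simp add: wilson_quotient_def[abs_def])
  have nz: "wilson_quotient f meromorphic_on {x}" if x: "x \<noteq> 0" for x
  proof -
    obtain s where s: "s analytic_on {x}" "\<And>y. (s y)\<^sup>2 = y" using local_sqrt[OF x] by metis
    have "(\<lambda>y. ?G (s y)) meromorphic_on {x}"
      by (rule meromorphic_on_compose[OF G s(1)]) auto
    also have "(\<lambda>y. ?G (s y)) = wilson_quotient f"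
      using wilson_quotient_eq[OF s(2)] by auto
    finally show ?thesis .
  qed
  have G0: "isolated_singularity_at ?G 0" "not_essential ?G 0"
    using G by (auto simp: meromorphic_on_altdef)
  have "isolated_singularity_at (wilson_quotient f) 0"
  proof -
    obtain r where r: "r > 0" "?G analytic_on ball 0 r - {0}"
      using G0(1) by (auto simp: isolated_singularity_at_def)
    have "wilson_quotient f analytic_on {x}" if x: "x \<in> ball 0 (r\<^sup>2) - {0}" for x
    proof -
      obtain s where s: "s analytic_on {x}" "\<And>y. (s y)\<^sup>2 = y"
        using local_sqrt[of x] x by auto
      have "(norm (s x))\<^sup>2 < r\<^sup>2"
        using x s(2)[of x] by (simp flip: norm_power)
      then have "norm (s x) < r" using r(1) by (simp add: power_less_imp_less_base)
      moreover have "s x \<noteq> 0" using s(2)[of x] x by auto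
      ultimately have "?G analytic_on {s x}"
        using r(2) by (intro analytic_on_subset[OF r(2)]) auto
      then have "(?G \<circ> s) analytic_on {x}"
        using s(1) by (intro analytic_on_compose) auto
      also have "?G \<circ> s = wilson_quotient f"
        using wilson_quotient_eq[OF s(2)] by auto
      finally show ?thesis .
    qed
    then have "wilson_quotient f analytic_on ball 0 (r\<^sup>2) - {0}"
      by (subst analytic_on_analytic_at) blast
    then show ?thesis using r(1) unfolding isolated_singularity_at_def
      by (intro exI[of _ "r\<^sup>2"]) auto
  qed
  moreover have "not_essential (wilson_quotient f) 0"
  proof -
    consider c where "?G \<midarrow>0\<rightarrow> c" | "is_pole ?G 0"
      using G0(2) by (auto simp: not_essential_def)
    then show ?thesis unfolding not_essential_def is_pole_def eq
      by cases (use filterlim_compose[OF _ filterlim_csqrt_0] in \<open>auto simp: is_pole_def\<close>)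
  qed
  ultimately have "wilson_quotient f meromorphic_on {0}"
    by (simp add: meromorphic_at_iff)
  with nz have "wilson_quotient f meromorphic_on {x}" for x by (cases "x = 0") auto
  then show ?thesis unfolding meromorphic_on_meromorphic_at[of _ UNIV] by blast
qed

lemma wilson_op_nicely_meromorphic:
  assumes "f nicely_meromorphic_on UNIV"
  shows "wilson_op f nicely_meromorphic_on UNIV"
  using assms unfolding wilson_op_def nicely_meromorphic_on_def[of f]
  by (intro remove_sings_nicely_meromorphic wilson_quotient_meromorphic) auto

end

(*
  On a disc of radius R = gamma r a meromorphic f is a product of Blaschke factors over its zeros and
  poles times exp G. Schwarz' formula bounds G' by the mean of |ln |f|| on the circle, which Jensen's
  formula bounds by T(R, f); the Blaschke factors contribute |h| / |x - p| and |h| / |w - p| when x is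
  moved to w = x + h. With x = z^2 and w = (z + i beta)^2 the displacement h has size sqrt r, whence the
  factor 1 / sqrt r. Since w - p splits into (z + i beta - s)(z + i beta + s) with s^2 = p, the terms
  1 / |w - p| are controlled by one-dimensional distances between r and finitely many numbers attached
  to p, and Markov's inequality on geometric blocks of radii yields the exceptional set.

  Iterates need no growth estimate for the Wilson transform itself: D^k f (z^2) is a combination of the
  values f ((z + i m / 2)^2), |m| <= k, with coefficients of size |z|^(-k), so the same shift estimate
  applies to each of them.
*)
theory Submission
  imports Defs "HOL-Real_Asymp.Real_Asymp"
begin

section \<open>Schwarz formula on a circle\<close>

text \<open>The constant may depend on \<gamma> only, but Jensen's formula leaves a constant
  depending on \<open>f\<close>, and ln+ n vanishes for n <= 1. Both leftovers are o(1) after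
  division by sqrt r; they get an allowance of 1/4 ln r, and radii too small for this join the
  exceptional set. The allowance costs |x|^(1/4), which the denominator 2iz of the Wilson quotient,
  of size |x|^(1/2), repays. The surplus yields the 2 of the first estimate and, for finite order,
  the constant needed when \<sigma> - 1/2 + \<epsilon> is negative and the right side tends to 1.

  The exceptional set sees |x| only, so the distance to a nearby zero or pole must be bounded below
  by differences of reals in which x enters through |x| alone. The kernel 1/|t - u| is not
  integrable; a cutoff \<delta> makes it so at the price of a logarithm. Block j may contain bad
  radii of measure about q^j / j^\<eta>: \<eta> > 1 makes the logarithmic measures summable, \<eta>
  < \<gamma> leaves room for ln j. With q = sqrt \<gamma> the points that matter for block j satisfy
  |p| <= q^(j+2) <= \<gamma> r, so n(\<gamma> r) counts them.\<close>

lemma has_integral_circle_iff: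
  "((\<lambda>z. f z / z) has_contour_integral (\<i> * I)) (circlepath 0 R) \<longleftrightarrow>
     ((\<lambda>t. f (of_real R * cis t)) has_integral I) {0..2 * pi}" if "R > 0"
proof -
  have "((\<lambda>z. f z / z) has_contour_integral (\<i> * I)) (circlepath 0 R) \<longleftrightarrow>
     ((\<lambda>t. \<i> * f (of_real R * cis t)) has_integral \<i> * I) {0..2 * pi}"
    unfolding circlepath_def using that
    by (subst has_contour_integral_part_circlepath_iff) (auto simp: mult_ac)
  also have "\<dots> \<longleftrightarrow> ((\<lambda>t. f (of_real R * cis t)) has_integral I) {0..2 * pi}"
    using has_integral_mult_right[of "\<lambda>t. f (of_real R * cis t)" I "{0..2*pi}" \<i>]
          has_integral_mult_right[of "\<lambda>t. \<i> * f (of_real R * cis t)" "\<i> * I" "{0..2*pi}" "-\<i>"]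
    by (auto simp flip: mult.assoc)
  finally show ?thesis .
qed

text \<open>The only candidate for a zero is the reflected point R^2 / cnj p, which lies outside the
  closed disc because |p| < R.\<close>

lemma reflected_denom_nonzero:
  assumes "norm p < R" "norm y \<le> R"
  shows "(of_real R)\<^sup>2 - cnj p * y \<noteq> 0"
proof
  assume "(of_real R)\<^sup>2 - cnj p * y = 0"
  then have "of_real (R\<^sup>2) = cnj p * y" by simp
  then have "R\<^sup>2 = norm (cnj p * y)"
    by (metis norm_of_real abs_power2)
  also have "\<dots> \<le> norm p * R"
    using assms by (simp add: norm_mult mult_left_mono)
  also have "\<dots> < R * R"
    using assms by (intro mult_strict_right_mono) (auto intro: le_less_trans[OF norm_ge_zero])
  finally show False by (simp add: power2_eq_square)
qed

text \<open>
  Cauchy's formula gives the integral with \<open>G\<close> in place of \<open>Re G\<close>; the conjugate part integrates to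
  zero because \<open>cnj z = R\<^sup>2 / z\<close> on the circle turns its conjugate into a holomorphic integrand.
\<close>

lemma Schwarz_derivative_formula:
  assumes G: "G holomorphic_on ball 0 R'" and R: "0 < R" "R < R'" and x: "norm x < R"
  shows "((\<lambda>t. of_real (Re (G (of_real R * cis t))) *
            (of_real R * cis t / (of_real R * cis t - x)\<^sup>2)) has_integral (of_real pi * deriv G x))
         {0..2 * pi}"
proof -
  define k where "k = (\<lambda>z. z / (z - x)\<^sup>2)"
  have hol: "G holomorphic_on cball 0 R"
    using G by (rule holomorphic_on_subset) (use R in auto)
  have "((\<lambda>u. G u / (u - x) ^ Suc 1) has_contour_integral 2 * pi * \<i> / fact 1 * (deriv ^^ 1) G x)
          (circlepath 0 R)"
    by (rule Cauchy_has_contour_integral_higher_derivative_circlepath)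
       (use hol x in \<open>auto intro: holomorphic_on_imp_continuous_on holomorphic_on_subset\<close>)
  then have "((\<lambda>u. G u * k u / u) has_contour_integral 2 * pi * \<i> / fact 1 * (deriv ^^ 1) G x)
      (circlepath 0 R)"
    by (rule has_contour_integral_eq)
       (use R in \<open>auto simp: k_def power2_eq_square path_image_circlepath\<close>)
  then have "((\<lambda>u. G u * k u / u) has_contour_integral \<i> * (2 * pi * deriv G x)) (circlepath 0 R)"
    by (simp add: mult_ac)
  then have 1: "((\<lambda>t. G (of_real R * cis t) * k (of_real R * cis t)) has_integral
      2 * pi * deriv G x) {0..2 * pi}"
    using has_integral_circle_iff[OF R(1), of "\<lambda>z. G z * k z"] by simp
  \<comment> \<open>Conjugating \<open>k\<close> and substituting R^2 / z for cnj z gives the second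
    factor of \<open>H\<close>. Division by z leaves an integrand whose only possible singularity is
    the reflected point of x, outside the closed disc.\<close>
  define H where "H = (\<lambda>z::complex. G z * (R\<^sup>2 * z / (R\<^sup>2 - cnj x * z)\<^sup>2))"
  have nz: "R\<^sup>2 - cnj x * z \<noteq> 0" if "norm z \<le> R" for z :: complex
    using reflected_denom_nonzero[OF x that] by simp
  have "((\<lambda>z. G z * (R\<^sup>2 / (R\<^sup>2 - cnj x * z)\<^sup>2)) has_contour_integral 0) (circlepath 0 R)"
  proof (rule Cauchy_theorem_convex_simple)
    show "(\<lambda>z. G z * (R\<^sup>2 / (R\<^sup>2 - cnj x * z)\<^sup>2)) holomorphic_on cball 0 R"
      using nz by (intro holomorphic_intros hol) auto
  qed (use R in auto)
  then have "((\<lambda>u. H u / u) has_contour_integral 0) (circlepath 0 R)"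
    by (rule has_contour_integral_eq)
       (use R in \<open>auto simp: H_def path_image_circlepath\<close>)
  then have "((\<lambda>t. H (of_real R * cis t)) has_integral 0) {0..2 * pi}"
    using has_integral_circle_iff[OF R(1), of H 0] by simp
  from has_integral_linear[OF this bounded_linear_cnj]
  have "((\<lambda>t. cnj (H (of_real R * cis t))) has_integral 0) {0..2 * pi}"
    by (simp add: o_def)
  moreover have "cnj (H z) = cnj (G z) * k z" if "norm z = R" for z
  proof -
    have z: "z \<noteq> 0" "cnj z = R\<^sup>2 / z"
      using that R complex_norm_square[of z] by (auto simp: field_simps)
    have "cnj (H z) = cnj (G z) * (R\<^sup>2 * cnj z / (R\<^sup>2 - x * cnj z)\<^sup>2)"
      by (simp add: H_def)
    also have "R\<^sup>2 - x * cnj z = R\<^sup>2 * (z - x) / z"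
      using z by (simp add: field_simps)
    also have "R\<^sup>2 * cnj z / (R\<^sup>2 * (z - x) / z)\<^sup>2 = k z"
    proof -
      have "c * (c / z) / (c * d / z)\<^sup>2 = z / d\<^sup>2" if "c \<noteq> 0" for c d :: complex
        using z(1) that by (cases "d = 0") (simp_all add: field_simps power2_eq_square)
      from this[of "R\<^sup>2" "z - x"] show ?thesis
        unfolding z(2) k_def using R by simp
    qed
    finally show ?thesis .
  qed
  ultimately have 2: "((\<lambda>t. cnj (G (of_real R * cis t)) * k (of_real R * cis t)) has_integral 0) {0..2 * pi}"
    using R by (simp add: norm_mult)
  have eq: "(1/2) * (a * c + cnj a * c) = of_real (Re a) * c" for a c :: complex
    by (simp add: complex_eq_iff field_simps)
  have "((\<lambda>t. (1/2) * (G (of_real R * cis t) * k (of_real R * cis t) +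
      cnj (G (of_real R * cis t)) * k (of_real R * cis t))) has_integral
      (1/2) * (2 * pi * deriv G x + 0)) {0..2 * pi}"
    by (intro has_integral_mult_right has_integral_add 1 2)
  then have "((\<lambda>t. of_real (Re (G (of_real R * cis t))) * k (of_real R * cis t)) has_integral
      (1/2) * (2 * pi * deriv G x + 0)) {0..2 * pi}"
    by (simp only: eq)
  then show ?thesis
    by (simp add: k_def)
qed

lemma continuous_on_circle:
  assumes "continuous_on (cball 0 R) G" "0 \<le> R"
  shows "continuous_on {0..2*pi} (\<lambda>t. G (of_real R * cis t))"
  by (rule continuous_on_compose2[OF assms(1)])
     (use assms(2) in \<open>auto intro!: continuous_intros simp: norm_mult\<close>)

text \<open>The kernel has modulus at most R / (R - \<rho>)^2 on the circle. Only
  \<open>Re G\<close> enters, and in the application it equals ln |f| there.\<close>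

lemma Schwarz_derivative_bound:
  assumes G: "G holomorphic_on ball 0 R'" and R: "R < R'" and x: "norm x \<le> \<rho>" "\<rho> < R"
  shows "norm (deriv G x) \<le>
           R / (pi * (R - \<rho>)\<^sup>2) * integral {0..2*pi} (\<lambda>t. \<bar>Re (G (of_real R * cis t))\<bar>)"
proof -
  have R0: "R > 0" using x norm_ge_zero[of x] by linarith
  have "continuous_on (cball 0 R) (\<lambda>z. \<bar>Re (G z)\<bar>)"
    by (intro continuous_intros holomorphic_on_imp_continuous_on holomorphic_on_subset[OF G])
       (use R in auto)
  from continuous_on_circle[OF this] have int: "(\<lambda>t. \<bar>Re (G (of_real R * cis t))\<bar>) integrable_on {0..2*pi}"
    using R0 by (intro integrable_continuous_interval) auto
  have "norm (of_real pi * deriv G x) \<le>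
     integral {0..2*pi} (\<lambda>t. \<bar>Re (G (of_real R * cis t))\<bar> * (R / (R - \<rho>)\<^sup>2))"
    unfolding integral_unique[OF Schwarz_derivative_formula[OF G R0 R le_less_trans[OF x]], symmetric]
  proof (rule integral_norm_bound_integral)
    show "(\<lambda>t. \<bar>Re (G (of_real R * cis t))\<bar> * (R / (R - \<rho>)\<^sup>2)) integrable_on {0..2*pi}"
      by (intro integrable_on_mult_left int)
    fix t :: real
    have "R - \<rho> \<le> norm (of_real R * cis t - x)"
      using norm_triangle_ineq2[of "of_real R * cis t" x] x R0 by (simp add: norm_mult)
    then have "(R - \<rho>)\<^sup>2 \<le> (norm (of_real R * cis t - x))\<^sup>2"
      using x by (intro power_mono) auto
    then have "R / (norm (of_real R * cis t - x))\<^sup>2 \<le> R / (R - \<rho>)\<^sup>2"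
      using x R0 by (intro divide_left_mono) (auto intro!: mult_pos_pos)
    then show "norm (of_real (Re (G (of_real R * cis t))) *
            (of_real R * cis t / (of_real R * cis t - x)\<^sup>2)) \<le>
        \<bar>Re (G (of_real R * cis t))\<bar> * (R / (R - \<rho>)\<^sup>2)"
      using R0 mult_left_mono[of "R / (norm (of_real R * cis t - x))\<^sup>2" "R / (R - \<rho>)\<^sup>2"
          "\<bar>Re (G (of_real R * cis t))\<bar>"]
      by (simp add: norm_mult norm_divide norm_power)
  qed (use has_integral_integrable[OF Schwarz_derivative_formula[OF G R0 R le_less_trans[OF x]]] in simp)
  then have "pi * norm (deriv G x) \<le> integral {0..2*pi} (\<lambda>t. \<bar>Re (G (of_real R * cis t))\<bar>) * (R / (R - \<rho>)\<^sup>2)"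
    by (simp add: norm_mult)
  then have "norm (deriv G x) \<le> integral {0..2*pi} (\<lambda>t. \<bar>Re (G (of_real R * cis t))\<bar>) * (R / (R - \<rho>)\<^sup>2) / pi"
    using pos_le_divide_eq[OF pi_gt_zero] by (metis mult.commute)
  also have "I * (b / c) / pi = b / (pi * c) * I" for I b c :: real
    by (simp add: mult_ac)
  finally show ?thesis .
qed

lemma Re_diff_bound_circle:
  assumes G: "G holomorphic_on ball 0 R'" and R: "R < R'" "\<rho> < R" and x: "norm x \<le> \<rho>" "norm w \<le> \<rho>"
  shows "\<bar>Re (G w) - Re (G x)\<bar> \<le> norm (w - x) * (R / (pi * (R - \<rho>)\<^sup>2) *
           integral {0..2*pi} (\<lambda>t. \<bar>Re (G (of_real R * cis t))\<bar>))"
proof -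
  have "norm (G w - G x) \<le> (R / (pi * (R - \<rho>)\<^sup>2) *
           integral {0..2*pi} (\<lambda>t. \<bar>Re (G (of_real R * cis t))\<bar>)) * norm (w - x)"
  proof (rule field_differentiable_bound[where S = "cball 0 \<rho>" and f' = "deriv G"])
    fix z :: complex assume "z \<in> cball 0 \<rho>"
    then show "norm (deriv G z) \<le> R / (pi * (R - \<rho>)\<^sup>2) *
           integral {0..2*pi} (\<lambda>t. \<bar>Re (G (of_real R * cis t))\<bar>)"
      by (intro Schwarz_derivative_bound[OF G R(1) _ R(2)]) auto
    show "(G has_field_derivative deriv G z) (at z within cball 0 \<rho>)"
      using \<open>z \<in> cball 0 \<rho>\<close> R
      by (intro has_field_derivative_at_within[OF holomorphic_derivI[OF G]]) auto
  qed (use x in auto)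
  with abs_Re_le_cmod[of "G w - G x"] show ?thesis by (simp add: mult.commute)
qed

text \<open>Applied to the logarithm of the zero-free factor, this is the analytic core of Jensen's
  formula.\<close>

lemma Re_mean_value_circle:
  assumes G: "G holomorphic_on ball 0 R'" and R: "0 < R" "R < R'"
  shows "((\<lambda>t. Re (G (of_real R * cis t))) has_integral (2 * pi * Re (G 0))) {0..2 * pi}"
proof -
  have hol: "G holomorphic_on cball 0 R"
    using G by (rule holomorphic_on_subset) (use R in auto)
  have "((\<lambda>u. G u / (u - 0)) has_contour_integral 2 * of_real pi * \<i> * G 0) (circlepath 0 R)"
    by (rule Cauchy_integral_circlepath_simple) (use hol R in auto)
  then have "((\<lambda>t. G (of_real R * cis t)) has_integral 2 * pi * G 0) {0..2 * pi}"
    using has_integral_circle_iff[OF R(1), of G "2 * pi * G 0"] by (simp add: mult_ac)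
  from has_integral_Re[OF this] show ?thesis by simp
qed

section \<open>Zeros, poles and counting functions\<close>

text \<open>The support of the divisor in a closed disc: zeros and poles are kept in one set, and
  the sign of \<open>zorder\<close> tells them apart.\<close>

definition div_supp :: "real \<Rightarrow> (complex \<Rightarrow> complex) \<Rightarrow> complex set" where
  "div_supp r f = {p. norm p \<le> r \<and> zorder f p \<noteq> 0}"

locale mero_nonzero =
  fixes f :: "complex \<Rightarrow> complex"
  assumes mero: "f nicely_meromorphic_on UNIV" and nonzero: "f \<noteq> (\<lambda>_. 0)"
begin

lemma meromorphic: "f meromorphic_on A"
  using mero by (auto simp: nicely_meromorphic_on_def intro: meromorphic_on_subset)

lemma eventually_nonzero: "eventually (\<lambda>z. f z \<noteq> 0) (at p)"
  using nicely_meromorphic_imp_constant_or_avoid[OF mero, of 0] nonzero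
  by (auto simp: eventually_cosparse_open_eq)

lemma frequently_nonzero: "frequently (\<lambda>z. f z \<noteq> 0) (at p)"
  using eventually_nonzero by (intro eventually_frequently) auto

lemma is_pole_iff_zorder: "is_pole f p \<longleftrightarrow> zorder f p < 0"
  using isolated_pole_imp_neg_zorder[of f p] zorder_neg_imp_is_pole[of f p] eventually_nonzero
    meromorphic[of "{p}"] by (auto simp: meromorphic_at_iff)

lemma isolated_zero_iff_zorder: "isolated_zero f p \<longleftrightarrow> zorder f p > 0"
  using zorder_isolated_zero_pos'[of f p] zorder_pos_imp_isolated_zero[of f p] eventually_nonzero
    meromorphic[of "{p}"] by (auto simp: meromorphic_at_iff)

lemma zorder_inverse: "zorder (\<lambda>z. inverse (f z)) p = - zorder f p"
  using zorder_power_int[OF meromorphic frequently_nonzero, where z = p and n = "-1"]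
  by (simp add: power_int_minus)

text \<open>A nicely meromorphic function has no removable singularities, so order 0 is a statement
  about the value itself and not only about a limit.\<close>

lemma analytic_nonzero_if_zorder_0:
  assumes "zorder f p = 0"
  shows "f analytic_on {p}" "f p \<noteq> 0"
proof -
  show an: "f analytic_on {p}"
    using assms by (intro nicely_meromorphic_on_imp_analytic_at[OF mero]) (auto simp: is_pole_iff_zorder)
  show "f p \<noteq> 0"
    using zorder_eq_0_iff[OF an frequently_nonzero] assms by simp
qed

lemma zorder_0_cosparse: "eventually (\<lambda>z. zorder f z = 0) (cosparse UNIV)"
  using meromorphic_on_imp_not_pole_cosparse[OF meromorphic]
    meromorphic_on_imp_not_zero_cosparse[OF meromorphic]
  by eventually_elim (auto simp: is_pole_iff_zorder isolated_zero_iff_zorder)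

lemma finite_div_supp [simp]: "finite (div_supp r f)"
proof -
  from zorder_0_cosparse have "{z. zorder f z \<noteq> 0} sparse_in cball 0 r"
    unfolding eventually_cosparse by (rule sparse_in_subset) auto
  then have "finite (cball 0 r \<inter> {z. zorder f z \<noteq> 0})"
    by (rule sparse_in_compact_finite) auto
  also have "cball 0 r \<inter> {z. zorder f z \<noteq> 0} = div_supp r f"
    by (auto simp: div_supp_def)
  finally show ?thesis .
qed

lemma mero_nonzero_inverse: "mero_nonzero (\<lambda>z. inverse (f z))"
proof
  show "(\<lambda>z. inverse (f z)) nicely_meromorphic_on UNIV"
    by (intro meromorphic_intros mero)
  show "(\<lambda>z. inverse (f z)) \<noteq> (\<lambda>_. 0)"
    using nonzero by (auto simp: fun_eq_iff)
qed

lemma div_supp_inverse: "div_supp r (\<lambda>z. inverse (f z)) = div_supp r f"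
  by (simp add: div_supp_def zorder_inverse)

text \<open>One index set for all t <= r moves the dependence on \<open>t\<close> into the summand,
  so that the integral over \<open>t\<close> can be taken term by term.\<close>

lemma pole_count_eq:
  assumes "t \<le> r"
  shows "pole_count t f = (\<Sum>p\<in>div_supp r f. if norm p \<le> t then nat (- zorder f p) else 0)"
proof -
  have "pole_count t f = (\<Sum>p\<in>{p. norm p \<le> t \<and> is_pole f p}. nat (- zorder f p))"
    by (simp add: pole_count_def)
  also have "\<dots> = (\<Sum>p\<in>{p\<in>div_supp r f. norm p \<le> t}. nat (- zorder f p))"
    using assms by (intro sum.mono_neutral_left) (auto simp: is_pole_iff_zorder div_supp_def
        intro: finite_subset[OF _ finite_div_supp[unfolded div_supp_def]])
  also have "\<dots> = (\<Sum>p\<in>div_supp r f. if norm p \<le> t then nat (- zorder f p) else 0)"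
    by (intro sum.inter_filter) auto
  finally show ?thesis .
qed

lemma zero_pole_count_eq:
  "real (zero_pole_count r f) = (\<Sum>p\<in>div_supp r f. \<bar>real_of_int (zorder f p)\<bar>)"
proof -
  interpret inv: mero_nonzero "\<lambda>z. inverse (f z)" by (rule mero_nonzero_inverse)
  have "zero_pole_count r f = (\<Sum>p\<in>div_supp r f. nat (- zorder f p) + nat (zorder f p))"
    by (simp add: zero_pole_count_def pole_count_eq[OF order_refl] inv.pole_count_eq[OF order_refl]
        div_supp_inverse zorder_inverse sum.distrib div_supp_def)
  also have "real \<dots> = (\<Sum>p\<in>div_supp r f. \<bar>real_of_int (zorder f p)\<bar>)"
    by (auto intro!: sum.cong)
  finally show ?thesis .
qed

section \<open>The integrated counting function as a sum over poles\<close>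

lemma pole_count_0: "pole_count 0 f = nat (- zorder f 0)"
proof -
  have "{p. norm p \<le> 0 \<and> is_pole f p} = (if is_pole f 0 then {0} else {})"
    by auto
  then show ?thesis
    by (simp add: pole_count_def is_pole_iff_zorder)
qed

text \<open>A pole p \<noteq> 0 is counted from t = |p| on and contributes the integral of 1/t over
  [|p|, r]. A pole at 0 is split off, since 1/t is not integrable there.\<close>

lemma integrated_count_eq:
  assumes r: "r > 0"
  shows "integrated_count r f = (\<Sum>p\<in>div_supp r f - {0}. real (nat (- zorder f p)) * ln (r / norm p))
            + real (nat (- zorder f 0)) * ln r"
proof -
  let ?S = "div_supp r f - {0}"
  have "((\<lambda>t. \<Sum>p\<in>?S. real (nat (- zorder f p)) * (if t \<in> {norm p..r} then 1 / t else 0)) has_integral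
     (\<Sum>p\<in>?S. real (nat (- zorder f p)) * ln (r / norm p))) {0..r}"
  proof (intro has_integral_sum has_integral_mult_right)
    fix p assume "p \<in> ?S"
    then have p: "norm p > 0" "norm p \<le> r" by (auto simp: div_supp_def)
    have "((\<lambda>t. 1 / t) has_integral (ln r - ln (norm p))) {norm p..r}"
    proof (intro fundamental_theorem_of_calculus)
      fix t assume "t \<in> {norm p..r}"
      then have "t > 0" using p(1) by (meson atLeastAtMost_iff less_le_trans)
      then show "(ln has_vector_derivative 1 / t) (at t within {norm p..r})"
        by (auto intro!: derivative_eq_intros simp flip: has_real_derivative_iff_has_vector_derivative)
    qed (use p in auto)
    then have "((\<lambda>t. if t \<in> {norm p..r} then 1 / t else 0) has_integral (ln r - ln (norm p))) {0..r}"
      by (subst has_integral_restrict) (auto intro: order_trans[OF norm_ge_zero])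
    then show "((\<lambda>t. if t \<in> {norm p..r} then 1 / t else 0) has_integral ln (r / norm p)) {0..r}"
      using p r by (simp add: ln_div)
  qed auto
  then have "((\<lambda>t. (real (pole_count t f) - real (pole_count 0 f)) / t) has_integral
     (\<Sum>p\<in>?S. real (nat (- zorder f p)) * ln (r / norm p))) {0..r}"
  proof (rule has_integral_eq[rotated])
    fix t assume t: "t \<in> {0..r}"
    have "real (pole_count t f) = (\<Sum>p\<in>div_supp r f. if norm p \<le> t then real (nat (- zorder f p)) else 0)"
      using t by (subst pole_count_eq[of t r]) (auto intro!: sum.cong)
    also have "\<dots> = (\<Sum>p\<in>?S. if norm p \<le> t then real (nat (- zorder f p)) else 0) + real (nat (- zorder f 0))"
      using t r by (cases "zorder f 0 = 0") (auto simp: div_supp_def sum.remove[of _ 0] finite_div_supp[unfolded div_supp_def])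
    finally have *: "real (pole_count t f) - real (pole_count 0 f) =
        (\<Sum>p\<in>?S. if norm p \<le> t then real (nat (- zorder f p)) else 0)"
      by (simp add: pole_count_0)
    \<comment> \<open>At t = 0 both sides are 0: the right one by division by zero, the left one
      because |p| > 0 for p in \<open>?S\<close>.\<close>
    show "(\<Sum>p\<in>?S. real (nat (- zorder f p)) * (if t \<in> {norm p..r} then 1 / t else 0)) =
        (real (pole_count t f) - real (pole_count 0 f)) / t"
      unfolding * using t by (auto simp: sum_divide_distrib intro!: sum.cong split: if_splits)
  qed
  from integral_unique[OF this] show ?thesis
    by (simp add: integrated_count_def pole_count_0)
qed

lemma integrated_count_nonneg:
  assumes "r \<ge> 1"
  shows "integrated_count r f \<ge> 0"
  using assms by (subst integrated_count_eq)
    (auto intro!: add_nonneg_nonneg sum_nonneg mult_nonneg_nonneg ln_ge_zero simp: div_supp_def)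

text \<open>A pole with |p| <= r contributes ln (s r / |p|) >= ln s to the right side. For a pole at
  the origin the contribution is ln (s r), which is at least ln s by r >= 1.\<close>

lemma pole_count_le_integrated_count:
  assumes "r \<ge> 1" "s > 1"
  shows "real (pole_count r f) * ln s \<le> integrated_count (s * r) f"
proof -
  have sr: "s * r \<ge> r" "s * r > 0" "s * r \<ge> s"
    using assms mult_right_mono[of 1 s r] mult_left_mono[of 1 r s] by auto
  let ?m = "\<lambda>p. real (nat (- zorder f p))"
  have "real (pole_count r f) = (\<Sum>p\<in>div_supp (s * r) f. if norm p \<le> r then ?m p else 0)"
    using sr by (subst pole_count_eq[of r "s * r"]) (auto intro!: sum.cong)
  also have "\<dots> = (\<Sum>p\<in>div_supp (s * r) f - {0}. if norm p \<le> r then ?m p else 0) + ?m 0"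
    using assms sr by (cases "zorder f 0 = 0") (auto simp: div_supp_def sum.remove[of _ 0] finite_div_supp[unfolded div_supp_def])
  finally have "real (pole_count r f) * ln s =
      (\<Sum>p\<in>div_supp (s * r) f - {0}. (if norm p \<le> r then ?m p else 0) * ln s) + ?m 0 * ln s"
    by (simp add: distrib_right sum_distrib_right)
  also have "\<dots> \<le> integrated_count (s * r) f"
    unfolding integrated_count_eq[OF sr(2)]
  proof (intro add_mono sum_mono)
    fix p assume p: "p \<in> div_supp (s * r) f - {0}"
    show "(if norm p \<le> r then ?m p else 0) * ln s \<le> ?m p * ln (s * r / norm p)"
    proof (cases "norm p \<le> r")
      case True
      have "s * norm p \<le> s * r" using True assms by simp
      then have "s \<le> s * r / norm p" using p by (simp add: field_simps)
      then show ?thesis using True assms p sr by (auto intro!: mult_left_mono)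
    next
      case False
      then show ?thesis using p by (auto intro!: mult_nonneg_nonneg ln_ge_zero simp: div_supp_def)
    qed
  next
    show "?m 0 * ln s \<le> ?m 0 * ln (s * r)"
      using assms sr by (intro mult_left_mono) auto
  qed
  finally show ?thesis .
qed

end

section \<open>Blaschke factorization\<close>

definition blaschke :: "real \<Rightarrow> complex \<Rightarrow> complex \<Rightarrow> complex" where
  "blaschke R p y = R * (y - p) / (R\<^sup>2 - cnj p * y)"

lemma blaschke_denom_bound:
  assumes "norm p \<le> R" "norm y \<le> \<rho>"
  shows "R * (R - \<rho>) \<le> norm (of_real (R\<^sup>2) - cnj p * y)"
proof -
  have "norm (cnj p * y) \<le> R * \<rho>"
    unfolding norm_mult using assms by (intro mult_mono) (auto intro: order_trans[OF norm_ge_zero])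
  moreover have "R\<^sup>2 - norm (cnj p * y) \<le> norm (of_real (R\<^sup>2) - cnj p * y)"
    using norm_triangle_ineq2[of "of_real (R\<^sup>2)" "cnj p * y"] by (simp del: of_real_power)
  ultimately show ?thesis by (simp add: algebra_simps power2_eq_square)
qed

lemma blaschke_eq_0_iff:
  assumes "norm p < R" "norm y \<le> R"
  shows "blaschke R p y = 0 \<longleftrightarrow> y = p"
  using reflected_denom_nonzero[OF assms] assms by (auto simp: blaschke_def)

lemma analytic_blaschke:
  assumes "norm p < R" "norm y \<le> R"
  shows "blaschke R p analytic_on {y}"
  unfolding blaschke_def[abs_def] using reflected_denom_nonzero[OF assms]
  by (intro analytic_intros) auto

lemma zorder_blaschke:
  assumes "norm p < R" "norm y \<le> R"
  shows "zorder (blaschke R p) y = (if y = p then 1 else 0)"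
proof (cases "y = p")
  case True
  have R: "R > 0" using assms by (auto intro: le_less_trans[OF norm_ge_zero])
  have "zorder (blaschke R p) p = 1"
  proof (rule zorder_eqI[where S = "ball 0 R" and g = "\<lambda>y. R / (R\<^sup>2 - cnj p * y)"])
    show "(\<lambda>y. complex_of_real R / (R\<^sup>2 - cnj p * y)) holomorphic_on ball 0 R"
      using reflected_denom_nonzero[OF assms(1)] by (intro holomorphic_intros) auto
  qed (use assms R reflected_denom_nonzero[OF assms(1), of p] in \<open>auto simp: blaschke_def\<close>)
  then show ?thesis using True by simp
next
  case False
  then show ?thesis
    using zorder_eq_0I[OF analytic_blaschke[OF assms]] blaschke_eq_0_iff[OF assms] by auto
qed

text \<open>On the circle R^2 = y * cnj y, so the denominator becomes y * cnj (y - p).\<close>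

lemma norm_blaschke_boundary:
  assumes "norm p < R" "norm y = R"
  shows "norm (blaschke R p y) = 1"
proof -
  have "(of_real R)\<^sup>2 - cnj p * y = y * cnj (y - p)"
    using complex_norm_square[of y] assms by (simp add: algebra_simps)
  moreover have "y \<noteq> p" using assms by auto
  moreover have "R > 0" using assms by (auto intro: le_less_trans[OF norm_ge_zero])
  ultimately show ?thesis
    using assms by (simp add: blaschke_def norm_divide norm_mult del: complex_cnj_diff)
qed

text \<open>Two uses of ln t <= t - 1. The symmetric factor 1/a + 1/b saves deciding which of the
  two numbers is smaller.\<close>

lemma abs_ln_diff_le:
  fixes a b :: real
  assumes "a > 0" "b > 0"
  shows "\<bar>ln a - ln b\<bar> \<le> \<bar>a - b\<bar> * (1 / a + 1 / b)"
proof -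
  have "ln a - ln b \<le> (a - b) / b" "ln b - ln a \<le> (b - a) / a"
    using ln_diff_le[of a b] ln_diff_le[of b a] assms by auto
  moreover have "(a - b) / b \<le> \<bar>a - b\<bar> * (1 / b)" "(b - a) / a \<le> \<bar>a - b\<bar> * (1 / a)"
    using assms by (auto intro!: divide_right_mono)
  moreover have "\<bar>a - b\<bar> * (1 / a) \<ge> 0" "\<bar>a - b\<bar> * (1 / b) \<ge> 0" using assms by auto
  ultimately show ?thesis unfolding distrib_left by linarith
qed

text \<open>ln |blaschke| splits into ln R + ln |y - p| - ln (D y). The middle term gives the
  reciprocal distances; the denominators are at least R (R - \<rho>) and give 2 / (R -
  \<rho>).\<close>

lemma ln_blaschke_diff:
  assumes p: "norm p < R" and x: "norm x \<le> \<rho>" "norm w \<le> \<rho>" and \<rho>: "\<rho> < R"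
    and ne: "x \<noteq> p" "w \<noteq> p"
  shows "\<bar>ln (norm (blaschke R p w)) - ln (norm (blaschke R p x))\<bar> \<le>
    norm (w - x) * (1 / norm (w - p) + 1 / norm (x - p) + 2 / (R - \<rho>))"
proof -
  have R: "R > 0" using assms by (auto intro: le_less_trans[OF norm_ge_zero])
  define D where "D = (\<lambda>y. norm (complex_of_real (R\<^sup>2) - cnj p * y))"
  have D: "R * (R - \<rho>) \<le> D x" "R * (R - \<rho>) \<le> D w"
    unfolding D_def using p x by (auto intro!: blaschke_denom_bound simp del: of_real_power)
  have pos: "R * (R - \<rho>) > 0" using R \<rho> by simp
  have Dpos: "D x > 0" "D w > 0" using D pos by linarith+
  have ln: "ln (norm (blaschke R p y)) = ln R + ln (norm (y - p)) - ln (D y)"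
    if "D y > 0" "y \<noteq> p" for y
    using that R by (simp add: blaschke_def D_def norm_divide norm_mult ln_div ln_mult)
  have 1: "\<bar>ln (norm (w - p)) - ln (norm (x - p))\<bar> \<le>
      norm (w - x) * (1 / norm (w - p) + 1 / norm (x - p))"
    by (rule order_trans[OF abs_ln_diff_le])
       (use ne norm_triangle_ineq3[of "w - p" "x - p"] in \<open>auto intro!: mult_right_mono\<close>)
  have "\<bar>D w - D x\<bar> \<le> norm ((complex_of_real (R\<^sup>2) - cnj p * w) - (complex_of_real (R\<^sup>2) - cnj p * x))"
    unfolding D_def by (rule norm_triangle_ineq3)
  also have "\<dots> = norm (cnj p * (x - w))" by (simp add: algebra_simps)
  also have "\<dots> \<le> R * norm (w - x)"
    using p by (auto simp: norm_mult norm_minus_commute intro!: mult_right_mono)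
  finally have d: "\<bar>D w - D x\<bar> \<le> R * norm (w - x)" .
  have "\<bar>ln (D w) - ln (D x)\<bar> \<le> \<bar>D w - D x\<bar> * (1 / D w + 1 / D x)"
    using Dpos by (intro abs_ln_diff_le)
  also have "\<dots> \<le> (R * norm (w - x)) * (1 / (R * (R - \<rho>)) + 1 / (R * (R - \<rho>)))"
    using d D pos Dpos R by (intro mult_mono add_mono divide_left_mono) auto
  also have "\<dots> = norm (w - x) * (2 / (R - \<rho>))"
    using R \<rho> by (simp add: field_simps)
  finally have 2: "\<bar>ln (D w) - ln (D x)\<bar> \<le> norm (w - x) * (2 / (R - \<rho>))" .
  have "ln (norm (blaschke R p w)) - ln (norm (blaschke R p x)) =
     (ln (norm (w - p)) - ln (norm (x - p))) - (ln (D w) - ln (D x))"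
    using ln Dpos ne by simp
  also have "\<bar>\<dots>\<bar> \<le> norm (w - x) * (1 / norm (w - p) + 1 / norm (x - p)) + norm (w - x) * (2 / (R - \<rho>))"
    using 1 2 by linarith
  finally show ?thesis by (simp add: distrib_left)
qed

context mero_nonzero
begin

text \<open>On such a circle ln |f| is continuous and every point of the divisor in the disc is
  interior, so all Blaschke factors are regular on the closed disc. Only countably many radii fail
  this; they end up in the exceptional set.\<close>

definition radius_ok :: "real \<Rightarrow> bool" where
  "radius_ok R \<longleftrightarrow> R > 0 \<and> (\<forall>p. norm p = R \<longrightarrow> zorder f p = 0)"

lemma div_supp_less:
  assumes "radius_ok R" "p \<in> div_supp R f"
  shows "norm p < R"
  using assms by (force simp: radius_ok_def div_supp_def)

text \<open>The product \<open>B\<close> has the same order as \<open>f\<close> at every point of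
  the closed disc, so the quotient extends to an analytic zero-free function there. By compactness
  it stays zero-free on a slightly larger disc, where a logarithm exists. The margin R < R' is what
  the circle formulas ask for.\<close>

lemma blaschke_factorization:
  assumes ok: "radius_ok R"
  obtains R' G where "R < R'" "G holomorphic_on ball 0 R'"
    "\<And>y. norm y \<le> R \<Longrightarrow> zorder f y = 0 \<Longrightarrow>
        f y = exp (G y) * (\<Prod>p\<in>div_supp R f. blaschke R p y powi zorder f p)"
proof -
  let ?S = "div_supp R f"
  define B where "B = (\<lambda>y. \<Prod>p\<in>?S. blaschke R p y powi zorder f p)"
  define h where "h = (\<lambda>y. f y / B y)"
  have lt: "norm p < R" if "p \<in> ?S" for p
    using div_supp_less[OF ok that] .
  have merB1: "(\<lambda>y. blaschke R p y powi n) meromorphic_on A" for p n A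
    unfolding blaschke_def[abs_def] by (intro meromorphic_intros)
  have merb: "blaschke R p meromorphic_on A" for p A
    unfolding blaschke_def[abs_def] by (intro meromorphic_intros)
  have merB: "B meromorphic_on A" for A
    unfolding B_def by (intro meromorphic_intros merb)
  have merh: "h meromorphic_on A" for A
    unfolding h_def by (intro meromorphic_intros meromorphic merB)
  have anB: "B analytic_on {q}" "B q \<noteq> 0" if q: "norm q \<le> R" "q \<notin> ?S" for q
    using q lt unfolding B_def
    by (auto intro!: analytic_intros analytic_blaschke simp: blaschke_eq_0_iff)
  have evb: "eventually (\<lambda>y. blaschke R p y \<noteq> 0) (at q)" if q: "norm q \<le> R" "p \<in> ?S" for p q
  proof (cases "q = p")
    case False
    then have "blaschke R p q \<noteq> 0"
      using q lt by (simp add: blaschke_eq_0_iff)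
    then show ?thesis
      using analytic_at_neq_imp_eventually_neq[OF analytic_blaschke[OF lt[OF q(2)] q(1)]] by auto
  next
    case True
    have "eventually (\<lambda>y. y \<in> ball 0 R - {p}) (at p)"
      by (intro eventually_at_in_open) (use lt[OF q(2)] in auto)
    then show ?thesis unfolding True
      by eventually_elim (use lt[OF q(2)] in \<open>auto simp: blaschke_eq_0_iff\<close>)
  qed
  have evB: "eventually (\<lambda>y. B y \<noteq> 0) (at q)" if q: "norm q \<le> R" for q
  proof -
    have "eventually (\<lambda>y. \<forall>p\<in>?S. blaschke R p y \<noteq> 0) (at q)"
      using evb q by (intro eventually_ball_finite) auto
    then show ?thesis by eventually_elim (auto simp: B_def)
  qed
  have zB: "zorder B q = zorder f q" if q: "norm q \<le> R" for q
  proof -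
    have "zorder B q = (\<Sum>p\<in>?S. zorder (\<lambda>y. blaschke R p y powi zorder f p) q)"
      unfolding B_def by (rule zorder_prod) (use merB1 evB[OF q] in \<open>auto simp: B_def\<close>)
    also have "\<dots> = (\<Sum>p\<in>?S. if q = p then zorder f p else 0)"
    proof (intro sum.cong refl)
      fix p assume p: "p \<in> ?S"
      have "zorder (\<lambda>y. blaschke R p y powi zorder f p) q = zorder f p * zorder (blaschke R p) q"
        by (rule zorder_power_int) (use evb[OF q p] merb in \<open>auto intro: eventually_frequently\<close>)
      then show "zorder (\<lambda>y. blaschke R p y powi zorder f p) q = (if q = p then zorder f p else 0)"
        using zorder_blaschke[OF lt[OF p] q] by simp
    qed
    also have "\<dots> = zorder f q"
      by (subst sum.delta'[OF finite_div_supp]) (use q in \<open>auto simp: div_supp_def\<close>)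
    finally show ?thesis .
  qed
  \<comment> \<open>At points of \<open>?S\<close> the function \<open>h\<close> takes the value 0
    only because of division by zero; \<open>remove_sings\<close> restores the limit, which is
    nonzero since the orders cancel.\<close>
  define g where "g = remove_sings h"
  have g: "g analytic_on {q} \<and> g q \<noteq> 0" if q: "norm q \<le> R" for q
  proof -
    have ev: "eventually (\<lambda>y. h y \<noteq> 0) (at q)"
      using evB[OF q] eventually_nonzero by eventually_elim (auto simp: h_def)
    have zh: "zorder h q = 0"
      unfolding h_def using zB[OF q]
      by (subst zorder_divide) (use evB[OF q] frequently_nonzero in \<open>auto intro: meromorphic merB eventually_frequently\<close>)
    have "\<not> is_pole h q"
      using isolated_pole_imp_neg_zorder[of h q] zh merh[of "{q}"] by (auto simp: meromorphic_at_iff)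
    then obtain c where c: "h \<midarrow>q\<rightarrow> c"
      using merh[of "{q}"] by (auto simp: meromorphic_at_iff not_essential_def)
    have an: "g analytic_on {q}"
      unfolding g_def using c merh[of "{q}"] by (intro remove_sings_analytic_at) (auto simp: meromorphic_at_iff)
    have "\<not> isolated_zero h q"
      using zorder_isolated_zero_pos'[of h q] zh merh[of "{q}"] by (auto simp: meromorphic_at_iff)
    then have "c \<noteq> 0"
      using c ev by (auto simp: isolated_zero_def)
    then show ?thesis using an remove_sings_eqI[OF c] by (simp add: g_def)
  qed
  then have "g analytic_on cball 0 R"
    by (subst analytic_on_analytic_at) auto
  then obtain U where U: "open U" "cball 0 R \<subseteq> U" "g holomorphic_on U"
    by (auto simp: analytic_on_holomorphic)
  define V where "V = U \<inter> g -` (- {0})"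
  have "open V"
    unfolding V_def using U by (intro continuous_open_preimage holomorphic_on_imp_continuous_on) auto
  moreover have "cball 0 R \<subseteq> V"
    using U g by (auto simp: V_def)
  ultimately obtain e where e: "e > 0" "(\<Union>x\<in>cball 0 R. ball x e) \<subseteq> V"
    using compact_subset_open_imp_ball_epsilon_subset[of "cball 0 R" V] by auto
  have R: "R > 0" using ok by (simp add: radius_ok_def)
  have sub: "ball 0 (R + e) \<subseteq> V"
  proof
    fix y :: complex assume y: "y \<in> ball 0 (R + e)"
    show "y \<in> V"
    proof (cases "norm y \<le> R")
      case True
      then show ?thesis using \<open>cball 0 R \<subseteq> V\<close> by auto
    next
      case False
      \<comment> \<open>The radial projection of \<open>y\<close> to the circle, at distance |y| - R
        < e.\<close>
      define y' where "y' = of_real (R / norm y) * y"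
      have y': "norm y' = R" using False R by (auto simp: y'_def norm_mult norm_divide)
      have "y' - y = of_real (R / norm y - 1) * y"
        by (simp add: y'_def algebra_simps)
      then have "norm (y' - y) = \<bar>R / norm y - 1\<bar> * norm y"
        by (simp only: norm_mult norm_of_real)
      also have "\<dots> = norm y - R"
        using False R by (auto simp: abs_if field_simps)
      finally have "dist y' y < e" using y by (simp add: dist_norm)
      moreover have "y' \<in> cball 0 R" using y' by simp
      ultimately show ?thesis using e(2) by (meson UN_subset_iff mem_ball subsetD)
    qed
  qed
  have "g holomorphic_on ball 0 (R + e)"
    using U(3) by (rule holomorphic_on_subset) (use sub in \<open>auto simp: V_def\<close>)
  then obtain G where G: "G holomorphic_on ball 0 (R + e)"
    "\<And>z. z \<in> ball 0 (R + e) \<Longrightarrow> g z = exp (G z)"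
    by (rule contractible_imp_holomorphic_log)
       (use sub in \<open>auto simp: V_def intro: convex_imp_contractible\<close>)
  show ?thesis
  proof (rule that[of "R + e" G])
    fix y assume y: "norm y \<le> R" "zorder f y = 0"
    then have B: "B analytic_on {y}" "B y \<noteq> 0"
      by (intro anB; simp add: div_supp_def)+
    have "h analytic_on {y}"
      unfolding h_def using B analytic_nonzero_if_zorder_0[OF y(2)] by (intro analytic_intros) auto
    then have "h y = g y" by (simp add: g_def)
    also have "\<dots> = exp (G y)" using G(2)[of y] y e by simp
    finally show "f y = exp (G y) * (\<Prod>p\<in>?S. blaschke R p y powi zorder f p)"
      using B by (simp add: h_def field_simps B_def)
  qed (use e G in auto)
qed

end

section \<open>Jensen and Poisson--Jensen formulas\<close>

lemma ln_powi: "x > 0 \<Longrightarrow> ln (x powi n) = of_int n * ln (x::real)"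
  using powr_real_of_int'[of x n] ln_powr[of x "of_int n"] by simp

lemma ln_plus_nonneg: "ln_plus t \<ge> 0"
  by (simp add: ln_plus_def)

lemma ln_plus_exp: "ln_plus (exp u) = max 0 u"
  by (auto simp: ln_plus_def max_def)

lemma proximity_fun_nonneg: "proximity_fun r f \<ge> 0"
proof -
  \<comment> \<open>If the integrand is not integrable, \<open>integral\<close> returns 0, so the
    claim holds for every \<open>f\<close>.\<close>
  have "integral {0..2 * pi} (\<lambda>\<theta>. ln_plus (norm (f (of_real r * cis \<theta>)))) \<ge> 0"
    by (cases "(\<lambda>\<theta>. ln_plus (norm (f (of_real r * cis \<theta>)))) integrable_on {0..2 * pi}")
       (auto intro: integral_nonneg simp: ln_plus_nonneg not_integrable_integral)
  then show ?thesis by (simp add: proximity_fun_def)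
qed

context mero_nonzero
begin

text \<open>The logarithm of the modulus of the leading Laurent coefficient of \<open>f\<close> at 0.\<close>

definition jensen_const :: real where
  "jensen_const = ln (norm (zor_poly f 0 0))"

text \<open>Both sides of the factorization have the same leading Laurent coefficient at 0. In its
  logarithm, |blaschke R p 0| = |p| / R produces the terms ln (R / |p|) of the integrated counting
  functions.\<close>

lemma Re_factor_at_0:
  assumes ok: "radius_ok R" and R': "R < R'" "G holomorphic_on ball 0 R'"
    and fG: "\<And>y. norm y \<le> R \<Longrightarrow> zorder f y = 0 \<Longrightarrow>
        f y = exp (G y) * (\<Prod>p\<in>div_supp R f. blaschke R p y powi zorder f p)"
  shows "Re (G 0) = jensen_const + integrated_count R (\<lambda>z. inverse (f z)) - integrated_count R f"
proof -
  interpret inv: mero_nonzero "\<lambda>z. inverse (f z)" by (rule mero_nonzero_inverse)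
  let ?S = "div_supp R f" and ?n = "zorder f 0" and ?c = "zor_poly f 0 0"
  have R: "R > 0" using ok by (simp add: radius_ok_def)
  obtain r where r: "?c \<noteq> 0" "r > 0" "zor_poly f 0 holomorphic_on cball 0 r"
    "\<And>w. w \<in> cball 0 r - {0} \<Longrightarrow> f w = zor_poly f 0 w * w powi ?n"
    using zorder_exist[of f 0] meromorphic[of "{0}"] frequently_nonzero[of 0]
    by (auto simp: meromorphic_at_iff)
  define B where "B = (\<lambda>y. \<Prod>p\<in>?S - {0}. blaschke R p y powi zorder f p)"
  have 0: "blaschke R p 0 \<noteq> 0" if "p \<in> ?S - {0}" for p
    using that div_supp_less[OF ok, of p] R by (subst blaschke_eq_0_iff) auto
  have anB: "B analytic_on {0}"
    unfolding B_def using 0 R div_supp_less[OF ok]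
    by (auto intro!: analytic_intros analytic_blaschke)
  have anG: "G analytic_on {0}"
    using R' R by (intro holomorphic_on_imp_analytic_at[OF R'(2)]) auto
  have anz: "zor_poly f 0 analytic_on {0}"
    using r by (intro holomorphic_on_imp_analytic_at[of _ "ball 0 r"])
      (auto intro: holomorphic_on_subset)
  have lim1: "zor_poly f 0 \<midarrow>0\<rightarrow> ?c"
    using analytic_at_imp_isCont[OF anz] by (simp add: isContD)
  \<comment> \<open>The factor for p = 0 is y / R: its power of y cancels the one in the Laurent
    expansion, and the power of 1 / R remains.\<close>
  have lim2: "(\<lambda>y. exp (G y) * B y * (1 / of_real R) powi ?n) \<midarrow>0\<rightarrow> exp (G 0) * B 0 * (1 / of_real R) powi ?n"
    using analytic_at_imp_isCont[OF anG] analytic_at_imp_isCont[OF anB]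
    by (intro tendsto_intros) (simp_all add: isContD)
  have ev: "eventually (\<lambda>y. zor_poly f 0 y = exp (G y) * B y * (1 / of_real R) powi ?n) (at 0)"
  proof -
    have "eventually (\<lambda>z. zorder f z = 0) (at 0)"
      using zorder_0_cosparse by (simp add: eventually_cosparse_open_eq)
    moreover have "eventually (\<lambda>z. z \<in> ball 0 (min r R) - {0}) (at 0)"
      using r R by (intro eventually_at_in_open) auto
    ultimately show ?thesis
    proof eventually_elim
      case (elim y)
      have "zor_poly f 0 y * y powi ?n = f y"
        using elim r(4)[of y] by auto
      also have "\<dots> = exp (G y) * (\<Prod>p\<in>?S. blaschke R p y powi zorder f p)"
        using elim by (intro fG) auto
      also have "(\<Prod>p\<in>?S. blaschke R p y powi zorder f p) = B y * (blaschke R 0 y powi ?n)"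
      proof (cases "0 \<in> ?S")
        case True
        then show ?thesis by (subst prod.remove[OF _ True]) (simp_all add: B_def mult.commute)
      next
        case False
        then have "?n = 0" using R by (auto simp: div_supp_def)
        then show ?thesis using False by (simp add: B_def)
      qed
      also have "blaschke R 0 y powi ?n = y powi ?n * (1 / of_real R) powi ?n"
        unfolding power_int_mult_distrib[symmetric] using R by (simp add: blaschke_def power2_eq_square)
      finally have "zor_poly f 0 y * y powi ?n = exp (G y) * B y * (1 / of_real R) powi ?n * y powi ?n"
        by (simp only: mult_ac)
      then show ?case using elim by simp
    qed
  qed
  have "?c = exp (G 0) * B 0 * (1 / of_real R) powi ?n"
    using LIM_unique[OF lim1] lim2 tendsto_cong[OF ev] by blast
  then have "norm ?c = exp (Re (G 0)) * (\<Prod>p\<in>?S - {0}. norm (blaschke R p 0) powi zorder f p) * (1 / R) powi ?n"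
    using R by (simp add: norm_mult norm_power_int prod_norm[symmetric] B_def norm_divide)
  then have "ln (norm ?c) = Re (G 0) + ln (\<Prod>p\<in>?S - {0}. norm (blaschke R p 0) powi zorder f p) + ln ((1 / R) powi ?n)"
    using R 0 by (simp add: ln_mult prod_pos)
  also have "ln (\<Prod>p\<in>?S - {0}. norm (blaschke R p 0) powi zorder f p) =
      (\<Sum>p\<in>?S - {0}. ln (norm (blaschke R p 0) powi zorder f p))"
    using 0 by (subst ln_prod) auto
  also have "\<dots> = (\<Sum>p\<in>?S - {0}. - of_int (zorder f p) * ln (R / norm p))"
  proof (intro sum.cong refl)
    fix p assume p: "p \<in> ?S - {0}"
    have "norm (blaschke R p 0) = norm p / R"
      using R by (simp add: blaschke_def norm_divide norm_mult power2_eq_square)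
    then show "ln (norm (blaschke R p 0) powi zorder f p) = - of_int (zorder f p) * ln (R / norm p)"
      using p R by (simp add: ln_powi ln_div algebra_simps)
  qed
  also have "ln ((1 / R) powi ?n) = - of_int ?n * ln R"
    using R by (simp add: ln_powi ln_div)
  finally have "Re (G 0) = ln (norm ?c) + (\<Sum>p\<in>?S - {0}. of_int (zorder f p) * ln (R / norm p)) + of_int ?n * ln R"
    by (simp add: sum_negf)
  \<comment> \<open>The signed order is zero multiplicity minus pole multiplicity, which separates
    the sum into the counts for 1/f and for f.\<close>
  moreover have "of_int m = real (nat m) - real (nat (- m))" for m :: int
    by (cases "m \<ge> 0") auto
  then have "(\<Sum>p\<in>?S - {0}. of_int (zorder f p) * ln (R / norm p)) + of_int ?n * ln R =
      integrated_count R (\<lambda>z. inverse (f z)) - integrated_count R f"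
    unfolding integrated_count_eq[OF R] inv.integrated_count_eq[OF R] div_supp_inverse zorder_inverse
    by (simp add: left_diff_distrib sum_subtractf)
  ultimately show ?thesis by (simp add: jensen_const_def)
qed

text \<open>Blaschke factors are unimodular on the circle, so ln |f| = \<open>Re G\<close> there.
  Its positive and negative parts are ln+ |f| and ln+ |1/f|: their sum gives the integral of |Re G|,
  and their difference gives the mean value \<open>Re (G 0)\<close>, hence Jensen's formula.\<close>

lemma Poisson_Jensen_factorization:
  assumes ok: "radius_ok R"
  obtains R' G where "R < R'" "G holomorphic_on ball 0 R'"
    "\<And>y. norm y \<le> R \<Longrightarrow> zorder f y = 0 \<Longrightarrow>
        f y = exp (G y) * (\<Prod>p\<in>div_supp R f. blaschke R p y powi zorder f p)"
    "integral {0..2*pi} (\<lambda>t. \<bar>Re (G (of_real R * cis t))\<bar>) =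
       2 * pi * (proximity_fun R f + proximity_fun R (\<lambda>z. inverse (f z)))"
    "nevanlinna_char R (\<lambda>z. inverse (f z)) = nevanlinna_char R f - jensen_const"
proof -
  have R: "R > 0" using ok by (simp add: radius_ok_def)
  obtain R' G where G: "R < R'" "G holomorphic_on ball 0 R'"
    "\<And>y. norm y \<le> R \<Longrightarrow> zorder f y = 0 \<Longrightarrow>
        f y = exp (G y) * (\<Prod>p\<in>div_supp R f. blaschke R p y powi zorder f p)"
    using blaschke_factorization[OF ok] by blast
  have norm_f: "norm (f (of_real R * cis t)) = exp (Re (G (of_real R * cis t)))" for t
  proof -
    have n: "norm (of_real R * cis t) = R" using R by (simp add: norm_mult)
    then have "zorder f (of_real R * cis t) = 0" using ok by (simp add: radius_ok_def)
    from G(3)[OF _ this] n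
    show ?thesis
      using div_supp_less[OF ok] norm_blaschke_boundary[of _ R "of_real R * cis t"]
      by (simp add: norm_mult norm_power_int flip: prod_norm)
  qed
  have cont: "continuous_on {0..2*pi} (\<lambda>t. Re (G (of_real R * cis t)))"
  proof (rule continuous_on_circle[of R "\<lambda>z. Re (G z)"])
    show "continuous_on (cball 0 R) (\<lambda>z. Re (G z))"
      using G(1) by (intro continuous_intros holomorphic_on_imp_continuous_on
        holomorphic_on_subset[OF G(2)]) auto
  qed (use R in auto)
  let ?u = "\<lambda>t. Re (G (of_real R * cis t))"
  have int: "(\<lambda>t. max 0 (?u t)) integrable_on {0..2*pi}" "(\<lambda>t. max 0 (- ?u t)) integrable_on {0..2*pi}"
    by (intro integrable_continuous_interval continuous_intros cont)+
  have prox: "proximity_fun R f = 1 / (2*pi) * integral {0..2*pi} (\<lambda>t. max 0 (?u t))"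
    by (simp add: proximity_fun_def norm_f ln_plus_exp)
  have prox': "proximity_fun R (\<lambda>z. inverse (f z)) = 1 / (2*pi) * integral {0..2*pi} (\<lambda>t. max 0 (- ?u t))"
    by (simp add: proximity_fun_def norm_inverse norm_f ln_plus_exp flip: exp_minus)
  have "integral {0..2*pi} (\<lambda>t. \<bar>?u t\<bar>) = integral {0..2*pi} (\<lambda>t. max 0 (?u t) + max 0 (- ?u t))"
    by (intro arg_cong[of _ _ "integral _"]) (auto simp: fun_eq_iff)
  also have "\<dots> = integral {0..2*pi} (\<lambda>t. max 0 (?u t)) + integral {0..2*pi} (\<lambda>t. max 0 (- ?u t))"
    by (rule integral_add) (rule int)+
  also have "\<dots> = 2 * pi * (proximity_fun R f + proximity_fun R (\<lambda>z. inverse (f z)))"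
    unfolding prox prox' by (simp add: field_simps)
  finally have 1: "integral {0..2*pi} (\<lambda>t. \<bar>?u t\<bar>) =
    2 * pi * (proximity_fun R f + proximity_fun R (\<lambda>z. inverse (f z)))" .
  have "2 * pi * Re (G 0) = integral {0..2*pi} ?u"
    using Re_mean_value_circle[OF G(2) R G(1)] by (simp add: integral_unique)
  also have "\<dots> = integral {0..2*pi} (\<lambda>t. max 0 (?u t) - max 0 (- ?u t))"
    by (intro arg_cong[of _ _ "integral _"]) (auto simp: fun_eq_iff)
  also have "\<dots> = integral {0..2*pi} (\<lambda>t. max 0 (?u t)) - integral {0..2*pi} (\<lambda>t. max 0 (- ?u t))"
    by (rule integral_diff) (rule int)+
  also have "\<dots> = 2 * pi * (proximity_fun R f - proximity_fun R (\<lambda>z. inverse (f z)))"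
    unfolding prox prox' by (simp add: field_simps)
  finally have "Re (G 0) = proximity_fun R f - proximity_fun R (\<lambda>z. inverse (f z))"
    by simp
  with Re_factor_at_0[OF ok G]
  have 2: "nevanlinna_char R (\<lambda>z. inverse (f z)) = nevanlinna_char R f - jensen_const"
    by (simp add: nevanlinna_char_def)
  show ?thesis using that[OF G 1 2] .
qed

lemma Jensen_formula:
  assumes "radius_ok R"
  shows "nevanlinna_char R (\<lambda>z. inverse (f z)) = nevanlinna_char R f - jensen_const"
  using Poisson_Jensen_factorization[OF assms] by metis

lemma nevanlinna_char_nonneg:
  assumes "r \<ge> 1"
  shows "nevanlinna_char r f \<ge> 0"
  unfolding nevanlinna_char_def using integrated_count_nonneg[OF assms] proximity_fun_nonneg[of r f] by simp

text \<open>One-sided because only growth in passing from x to w matters. The factor 2R / (R -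
  \<rho>)^2 is R / (pi (R - \<rho>)^2) times the 2 pi from the boundary integral.\<close>

theorem ln_norm_diff_le:
  assumes ok: "radius_ok R" "R \<ge> 1" and \<rho>: "\<rho> < R"
    and x: "norm x \<le> \<rho>" "norm w \<le> \<rho>" and z: "zorder f x = 0" "zorder f w = 0"
  shows "ln (norm (f w)) - ln (norm (f x)) \<le> norm (w - x) *
     (2 * R / (R - \<rho>)\<^sup>2 * (2 * nevanlinna_char R f + \<bar>jensen_const\<bar>) +
      2 / (R - \<rho>) * real (zero_pole_count R f) +
      (\<Sum>p\<in>div_supp R f. \<bar>real_of_int (zorder f p)\<bar> * (1 / norm (w - p) + 1 / norm (x - p))))"
proof -
  interpret inv: mero_nonzero "\<lambda>z. inverse (f z)" by (rule mero_nonzero_inverse)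
  let ?S = "div_supp R f"
  let ?b = "\<lambda>p y. ln (norm (blaschke R p y))"
  obtain R' G where G: "R < R'" "G holomorphic_on ball 0 R'"
    "\<And>y. norm y \<le> R \<Longrightarrow> zorder f y = 0 \<Longrightarrow>
        f y = exp (G y) * (\<Prod>p\<in>?S. blaschke R p y powi zorder f p)"
    "integral {0..2*pi} (\<lambda>t. \<bar>Re (G (of_real R * cis t))\<bar>) =
       2 * pi * (proximity_fun R f + proximity_fun R (\<lambda>z. inverse (f z)))"
    "nevanlinna_char R (\<lambda>z. inverse (f z)) = nevanlinna_char R f - jensen_const"
    using Poisson_Jensen_factorization[OF ok(1)] by blast
  have ln: "ln (norm (f y)) = Re (G y) + (\<Sum>p\<in>?S. of_int (zorder f p) * ?b p y)"
    if y: "norm y \<le> \<rho>" "zorder f y = 0" for y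
  proof -
    have nz: "blaschke R p y \<noteq> 0" if "p \<in> ?S" for p
      using that y \<rho> div_supp_less[OF ok(1) that] by (subst blaschke_eq_0_iff) (auto simp: div_supp_def)
    have "norm (f y) = exp (Re (G y)) * (\<Prod>p\<in>?S. norm (blaschke R p y) powi zorder f p)"
      using y \<rho> by (subst G(3)) (auto simp: norm_mult norm_power_int prod_norm[symmetric])
    then have "ln (norm (f y)) = Re (G y) + ln (\<Prod>p\<in>?S. norm (blaschke R p y) powi zorder f p)"
      using nz by (simp add: ln_mult prod_pos)
    also have "ln (\<Prod>p\<in>?S. norm (blaschke R p y) powi zorder f p) = (\<Sum>p\<in>?S. ln (norm (blaschke R p y) powi zorder f p))"
      using nz by (subst ln_prod) auto
    also have "\<dots> = (\<Sum>p\<in>?S. of_int (zorder f p) * ?b p y)"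
      using nz by (intro sum.cong) (auto simp: ln_powi)
    finally show ?thesis .
  qed
  \<comment> \<open>Each proximity function is at most the corresponding characteristic, since R >=
    1 makes the counting parts nonnegative; Jensen's formula expresses T(R, 1/f) through T(R,
    f).\<close>
  have m: "proximity_fun R f + proximity_fun R (\<lambda>z. inverse (f z)) \<le> 2 * nevanlinna_char R f + \<bar>jensen_const\<bar>"
    using integrated_count_nonneg[OF ok(2)] inv.integrated_count_nonneg[OF ok(2)] G(5)
      proximity_fun_nonneg[of R f] abs_ge_minus_self[of jensen_const]
    unfolding nevanlinna_char_def by simp
  have "Re (G w) - Re (G x) \<le> \<bar>Re (G w) - Re (G x)\<bar>" by simp
  also have "\<dots> \<le> norm (w - x) * (R / (pi * (R - \<rho>)\<^sup>2) *
           integral {0..2*pi} (\<lambda>t. \<bar>Re (G (of_real R * cis t))\<bar>))"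
    by (rule Re_diff_bound_circle[OF G(2,1) \<rho> x])
  also have "\<dots> = norm (w - x) * (2 * R / (R - \<rho>)\<^sup>2 * (proximity_fun R f + proximity_fun R (\<lambda>z. inverse (f z))))"
    unfolding G(4) by simp
  also have "\<dots> \<le> norm (w - x) * (2 * R / (R - \<rho>)\<^sup>2 * (2 * nevanlinna_char R f + \<bar>jensen_const\<bar>))"
    using m ok(2) by (intro mult_left_mono) auto
  finally have 1: "Re (G w) - Re (G x) \<le> \<dots>" .
  have "(\<Sum>p\<in>?S. of_int (zorder f p) * ?b p w) - (\<Sum>p\<in>?S. of_int (zorder f p) * ?b p x) =
      (\<Sum>p\<in>?S. of_int (zorder f p) * (?b p w - ?b p x))"
    by (simp add: right_diff_distrib sum_subtractf)
  also have "\<dots> \<le> (\<Sum>p\<in>?S. \<bar>real_of_int (zorder f p)\<bar> * (norm (w - x) * (1 / norm (w - p) + 1 / norm (x - p) + 2 / (R - \<rho>))))"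
  proof (intro sum_mono)
    fix p assume p: "p \<in> ?S"
    have "x \<noteq> p" "w \<noteq> p" using p z by (auto simp: div_supp_def)
    from ln_blaschke_diff[OF div_supp_less[OF ok(1) p] x \<rho> this]
    have "\<bar>of_int (zorder f p) * (?b p w - ?b p x)\<bar> \<le>
       \<bar>real_of_int (zorder f p)\<bar> * (norm (w - x) * (1 / norm (w - p) + 1 / norm (x - p) + 2 / (R - \<rho>)))"
      unfolding abs_mult by (intro mult_left_mono) auto
    then show "of_int (zorder f p) * (?b p w - ?b p x) \<le>
       \<bar>real_of_int (zorder f p)\<bar> * (norm (w - x) * (1 / norm (w - p) + 1 / norm (x - p) + 2 / (R - \<rho>)))"
      by linarith
  qed
  also have "\<dots> = norm (w - x) * (2 / (R - \<rho>) * real (zero_pole_count R f) +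
      (\<Sum>p\<in>?S. \<bar>real_of_int (zorder f p)\<bar> * (1 / norm (w - p) + 1 / norm (x - p))))"
    unfolding zero_pole_count_eq sum_distrib_left sum.distrib[symmetric]
    by (intro sum.cong refl) (simp add: algebra_simps)
  finally have 2: "(\<Sum>p\<in>?S. of_int (zorder f p) * ?b p w) - (\<Sum>p\<in>?S. of_int (zorder f p) * ?b p x) \<le> \<dots>" .
  have "ln (norm (f w)) - ln (norm (f x)) =
     (Re (G w) - Re (G x)) + ((\<Sum>p\<in>?S. of_int (zorder f p) * ?b p w) - (\<Sum>p\<in>?S. of_int (zorder f p) * ?b p x))"
    using ln x z by simp
  also note add_mono[OF 1 2]
  finally show ?thesis by (simp add: distrib_left add.assoc)
qed

end

section \<open>Exceptional sets\<close>

lemma has_integral_shifted_abs_kernel: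
  fixes a b u \<delta> :: real
  assumes "\<delta> > 0" "a \<le> b"
  shows "((\<lambda>t. 1 / (\<delta> + \<bar>t - u\<bar>)) has_integral
           (ln (1 + max 0 (b - u) / \<delta>) - ln (1 + max 0 (u - b) / \<delta>)) -
           (ln (1 + max 0 (a - u) / \<delta>) - ln (1 + max 0 (u - a) / \<delta>))) {a..b}"
proof (rule fundamental_theorem_of_calculus_strong[where S = "{u}"])
  \<comment> \<open>The two truncations join the antiderivatives to the left and right of
    \<open>u\<close> into one continuous function.\<close>
  let ?F = "\<lambda>t. ln (1 + max 0 (t - u) / \<delta>) - ln (1 + max 0 (u - t) / \<delta>)"
  show "continuous_on {a..b} ?F"
  proof (intro continuous_intros ballI)
    fix x
    have "0 \<le> max 0 (x - u) / \<delta>" "0 \<le> max 0 (u - x) / \<delta>" using assms by auto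
    then show "1 + max 0 (x - u) / \<delta> \<noteq> 0" "1 + max 0 (u - x) / \<delta> \<noteq> 0" by linarith+
  qed (use assms in auto)
  fix t assume "t \<in> {a..b} - {u}"
  then consider "t < u" | "u < t" by fastforce
  then have "(?F has_real_derivative 1 / (\<delta> + \<bar>t - u\<bar>)) (at t)"
  proof cases
    case 1
    have "((\<lambda>t. - ln (1 + (u - t) / \<delta>)) has_real_derivative 1 / (\<delta> + \<bar>t - u\<bar>)) (at t)"
      using assms 1 by (auto intro!: derivative_eq_intros simp: field_simps add_pos_pos)
    then show ?thesis
      by (rule has_field_derivative_transform_within_open[where S = "{..<u}"]) (use 1 in auto)
  next
    case 2
    have "((\<lambda>t. ln (1 + (t - u) / \<delta>)) has_real_derivative 1 / (\<delta> + \<bar>t - u\<bar>)) (at t)"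
      using assms 2 by (auto intro!: derivative_eq_intros simp: field_simps add_pos_pos)
    then show ?thesis
      by (rule has_field_derivative_transform_within_open[where S = "{u<..}"]) (use 2 in auto)
  qed
  then show "(?F has_vector_derivative 1 / (\<delta> + \<bar>t - u\<bar>)) (at t)"
    by (simp add: has_real_derivative_iff_has_vector_derivative)
qed (use assms in auto)

text \<open>After the cutoff, the singularity costs only a logarithm of D / \<delta>, once for each
  side of \<open>u\<close>.\<close>

lemma integral_shifted_abs_kernel_le:
  fixes a b u \<delta> :: real
  assumes "\<delta> > 0" "a \<le> b" "\<bar>a - u\<bar> \<le> D" "\<bar>b - u\<bar> \<le> D"
  shows "integral {a..b} (\<lambda>t. 1 / (\<delta> + \<bar>t - u\<bar>)) \<le> 2 * ln (1 + D / \<delta>)"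
proof -
  have *: "0 \<le> ln (1 + max 0 x / \<delta>)" for x
    using assms by (intro ln_ge_zero) simp
  have **: "ln (1 + max 0 x / \<delta>) \<le> ln (1 + D / \<delta>)" if "x \<le> D" for x
  proof -
    have "1 + max 0 x / \<delta> \<le> 1 + D / \<delta>"
      using that assms by (intro add_mono divide_right_mono) auto
    moreover have "1 + max 0 x / \<delta> > 0" using assms by (intro add_pos_nonneg) auto
    ultimately show ?thesis by simp
  qed
  have le: "b - u \<le> D" "u - a \<le> D" using assms by auto
  show ?thesis
    unfolding integral_unique[OF has_integral_shifted_abs_kernel[OF assms(1,2)]]
    using **[OF le(1)] **[OF le(2)] *[of "u - b"] *[of "a - u"] by linarith
qed

text \<open>Markov's inequality needs an integrable kernel, hence the cutoff \<delta> in the sum.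
  Excluding the \<delta>-neighbourhoods of the points as well makes the truncated kernel comparable
  to the true one on what remains. The two terms of the bound belong to these two
  exclusions.\<close>

lemma emeasure_bad_set_le:
  fixes u w :: "'a \<Rightarrow> real"
  assumes J: "finite J" "\<And>i. i \<in> J \<Longrightarrow> 1 \<le> w i"
    and D: "\<And>i. i \<in> J \<Longrightarrow> \<bar>a - u i\<bar> \<le> D" "\<And>i. i \<in> J \<Longrightarrow> \<bar>b - u i\<bar> \<le> D"
    and ab: "a \<le> b" and pos: "\<delta> > 0" "\<kappa> > 0"
  defines "Bad \<equiv> {t\<in>{a..b}. (\<exists>i\<in>J. \<bar>t - u i\<bar> < \<delta>) \<or> \<kappa> < (\<Sum>i\<in>J. w i / (\<delta> + \<bar>t - u i\<bar>))}"
  shows "Bad \<in> sets lborel"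
    "emeasure lborel Bad \<le> ennreal (2 * \<delta> * sum w J + 2 * ln (1 + D / \<delta>) * sum w J / \<kappa>)"
proof -
  let ?S = "\<lambda>t. \<Sum>i\<in>J. w i / (\<delta> + \<bar>t - u i\<bar>)"
  have w: "w i \<ge> 0" if "i \<in> J" for i using J(2)[OF that] by simp
  have cont: "continuous_on A ?S" for A
    using pos by (intro continuous_intros) (auto simp: add_pos_nonneg[THEN less_imp_neq[THEN not_sym]])
  then have [measurable]: "?S \<in> borel_measurable borel"
    by (intro borel_measurable_continuous_onI)
  have "Bad = ({a..b} \<inter> (\<Union>i\<in>J. {u i - \<delta><..<u i + \<delta>})) \<union> ({a..b} \<inter> {t. \<kappa> < ?S t})"
    unfolding Bad_def by (auto simp: abs_less_iff algebra_simps)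
  moreover have "{t. \<kappa> < ?S t} \<in> sets borel" by measurable
  ultimately show "Bad \<in> sets lborel"
    using J(1) by auto
  have S_nonneg: "?S t \<ge> 0" for t
    using w pos by (auto intro!: sum_nonneg divide_nonneg_nonneg)
  have int: "integral {a..b} ?S \<le> 2 * ln (1 + D / \<delta>) * sum w J"
  proof -
    have "integral {a..b} ?S = (\<Sum>i\<in>J. integral {a..b} (\<lambda>t. w i * (1 / (\<delta> + \<bar>t - u i\<bar>))))"
      using integral_sum[OF J(1), of "\<lambda>i t. w i * (1 / (\<delta> + \<bar>t - u i\<bar>))" "{a..b}"]
        integrable_on_mult_right[OF has_integral_integrable[OF has_integral_shifted_abs_kernel[OF pos(1) ab]]]
      by simp
    also have "\<dots> = (\<Sum>i\<in>J. w i * integral {a..b} (\<lambda>t. 1 / (\<delta> + \<bar>t - u i\<bar>)))"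
      by (simp only: integral_mult_right)
    also have "\<dots> \<le> (\<Sum>i\<in>J. w i * (2 * ln (1 + D / \<delta>)))"
      using w D by (intro sum_mono mult_left_mono integral_shifted_abs_kernel_le pos ab) auto
    finally show ?thesis by (simp add: sum_distrib_left sum_distrib_right mult.commute)
  qed
  have setint: "set_integrable lborel {a..b} ?S"
    by (intro borel_integrable_atLeastAtMost' cont)
  let ?u = "\<lambda>t. indicator {a..b} t * ?S t"
  have "emeasure lborel {t\<in>space lborel. ?u t \<ge> \<kappa>} \<le> ennreal ((1 / \<kappa>) * (LINT t|lborel. ?u t))"
    using setint S_nonneg pos
    by (intro integral_Markov_inequality) (auto simp: set_integrable_def intro!: mult_nonneg_nonneg)
  also have "(LINT t|lborel. ?u t) = integral {a..b} ?S"
    using set_borel_integral_eq_integral(2)[OF setint] by (simp add: set_lebesgue_integral_def)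
  also have "ennreal ((1 / \<kappa>) * integral {a..b} ?S) \<le> ennreal ((1 / \<kappa>) * (2 * ln (1 + D / \<delta>) * sum w J))"
    using int pos by (intro ennreal_leI mult_left_mono) auto
  finally have 1: "emeasure lborel {t. \<kappa> \<le> ?u t} \<le> ennreal ((1 / \<kappa>) * (2 * ln (1 + D / \<delta>) * sum w J))"
    by simp
  have "emeasure lborel (\<Union>i\<in>J. {u i - \<delta>..u i + \<delta>}) \<le> (\<Sum>i\<in>J. emeasure lborel {u i - \<delta>..u i + \<delta>})"
    using J(1) by (intro emeasure_subadditive_finite) auto
  also have "\<dots> = (\<Sum>i\<in>J. ennreal (2 * \<delta>))"
    using pos by (intro sum.cong) auto
  also have "\<dots> = ennreal (\<Sum>i\<in>J. 2 * \<delta>)"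
    using pos by (intro sum_ennreal) auto
  \<comment> \<open>Weights of at least 1 allow the number of points to be replaced by the total
    weight.\<close>
  also have "(\<Sum>i\<in>J. 2 * \<delta>) \<le> (\<Sum>i\<in>J. 2 * \<delta> * w i)"
    using pos J(2) by (intro sum_mono) auto
  then have "ennreal (\<Sum>i\<in>J. 2 * \<delta>) \<le> ennreal (2 * \<delta> * sum w J)"
    by (intro ennreal_leI) (simp add: sum_distrib_left)
  finally have 2: "emeasure lborel (\<Union>i\<in>J. {u i - \<delta>..u i + \<delta>}) \<le> ennreal (2 * \<delta> * sum w J)" .
  have "Bad \<subseteq> (\<Union>i\<in>J. {u i - \<delta>..u i + \<delta>}) \<union> {t. \<kappa> \<le> ?u t}"
    by (force simp: Bad_def)
  moreover have [measurable]: "{t. \<kappa> \<le> ?u t} \<in> sets borel" by measurable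
  moreover have [measurable]: "(\<Union>i\<in>J. {u i - \<delta>..u i + \<delta>}) \<in> sets borel" using J(1) by auto
  ultimately have "emeasure lborel Bad \<le> emeasure lborel ((\<Union>i\<in>J. {u i - \<delta>..u i + \<delta>}) \<union> {t. \<kappa> \<le> ?u t})"
    by (intro emeasure_mono) (simp_all only: sets_lborel sets.Un)
  also have "\<dots> \<le> emeasure lborel (\<Union>i\<in>J. {u i - \<delta>..u i + \<delta>}) + emeasure lborel {t. \<kappa> \<le> ?u t}"
    by (intro emeasure_subadditive) simp_all
  also have "\<dots> \<le> ennreal (2 * \<delta> * sum w J) + ennreal ((1 / \<kappa>) * (2 * ln (1 + D / \<delta>) * sum w J))"
    by (intro add_mono 1 2)
  also have "\<dots> = ennreal (2 * \<delta> * sum w J + 2 * ln (1 + D / \<delta>) * sum w J / \<kappa>)"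
  proof (subst ennreal_plus[symmetric])
    show "0 \<le> 1 / \<kappa> * (2 * ln (1 + D / \<delta>) * sum w J)"
    \<comment> \<open>For empty \<open>J\<close> nothing forces D >= 0 and the logarithm may be
      negative, but then the sum vanishes.\<close>
    proof (cases "J = {}")
      case False
      then obtain i where "i \<in> J" by auto
      then have "D \<ge> 0" using D(1) by (meson abs_ge_zero order_trans)
      then have "ln (1 + D / \<delta>) \<ge> 0" using pos by (intro ln_ge_zero) simp
      then show ?thesis using pos w by (intro mult_nonneg_nonneg sum_nonneg) auto
    qed simp
  qed (use pos w in \<open>auto intro!: mult_nonneg_nonneg sum_nonneg\<close>)
  finally show "emeasure lborel Bad \<le> ennreal (2 * \<delta> * sum w J + 2 * ln (1 + D / \<delta>) * sum w J / \<kappa>)" .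
qed

section \<open>Sets of finite logarithmic measure\<close>

lemma finite_log_measure_UN:
  fixes a c :: "nat \<Rightarrow> real"
  assumes B: "\<And>j. B j \<in> sets lborel" "\<And>j r. r \<in> B j \<Longrightarrow> a j \<le> r" "\<And>j. a j > 0"
    and m: "\<And>j. emeasure lborel (B j) \<le> ennreal (a j * c j)" and c: "summable c" "\<And>j. c j \<ge> 0"
  shows "finite_log_measure (\<Union>j. B j)"
  unfolding finite_log_measure_def
proof
  have Bl: "B j \<in> sets lebesgue" for j using B(1)[of j] by auto
  then show "(\<Union>j. B j) \<in> sets lebesgue" by auto
  have "(\<integral>\<^sup>+r\<in>(\<Union>j. B j). ennreal (1 / r) \<partial>lebesgue) \<le> (\<integral>\<^sup>+r. (\<Sum>j. ennreal (1 / a j) * indicator (B j) r) \<partial>lebesgue)"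
  proof (rule nn_integral_mono)
    fix r :: real
    show "ennreal (1 / r) * indicator (\<Union>j. B j) r \<le> (\<Sum>j. ennreal (1 / a j) * indicator (B j) r)"
    proof (cases "r \<in> (\<Union>j. B j)")
      case True
      then obtain j where j: "r \<in> B j" by auto
      \<comment> \<open>The density is at most 1 / \<open>a j\<close> on \<open>B j\<close>, so the
        logarithmic measure of this piece is at most \<open>c j\<close>.\<close>
      have "ennreal (1 / r) \<le> ennreal (1 / a j)"
        using B(2)[OF j] B(3)[of j] by (intro ennreal_leI divide_left_mono) auto
      also have "\<dots> = (\<Sum>i\<in>{j}. ennreal (1 / a i) * indicator (B i) r)" using j by simp
      also have "\<dots> \<le> (\<Sum>i. ennreal (1 / a i) * indicator (B i) r)"
        by (intro sum_le_suminf) auto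
      finally show ?thesis using True by simp
    qed simp
  qed
  also have "\<dots> = (\<Sum>j. \<integral>\<^sup>+r. ennreal (1 / a j) * indicator (B j) r \<partial>lebesgue)"
    using Bl by (intro nn_integral_suminf) auto
  also have "\<dots> = (\<Sum>j. ennreal (1 / a j) * emeasure lebesgue (B j))"
    using Bl by (intro suminf_cong nn_integral_cmult_indicator) auto
  also have "\<dots> \<le> (\<Sum>j. ennreal (c j))"
  proof (intro suminf_le)
    fix j
    have "ennreal (1 / a j) * emeasure lebesgue (B j) \<le> ennreal (1 / a j) * ennreal (a j * c j)"
      using m[of j] B(1)[of j] by (intro mult_left_mono) auto
    also have "\<dots> = ennreal (c j)"
      using B(3)[of j] c(2)[of j] by (subst ennreal_mult[symmetric]) auto
    finally show "ennreal (1 / a j) * emeasure lebesgue (B j) \<le> ennreal (c j)" .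
  qed auto
  also have "\<dots> < \<infinity>"
    using ennreal_suminf_neq_top[OF c] by (simp add: less_top)
  finally show "(\<integral>\<^sup>+r\<in>(\<Union>j. B j). ennreal (1 / r) \<partial>lebesgue) < \<infinity>" .
qed

lemma finite_log_measure_Un:
  assumes "finite_log_measure A" "finite_log_measure B"
  shows "finite_log_measure (A \<union> B)"
  unfolding finite_log_measure_def
proof
  show "A \<union> B \<in> sets lebesgue" using assms by (auto simp: finite_log_measure_def)
  have [measurable]: "A \<in> sets lebesgue" "B \<in> sets lebesgue"
    using assms by (auto simp: finite_log_measure_def)
  have [measurable]: "(\<lambda>r::real. ennreal (1 / r)) \<in> borel_measurable lebesgue"
    by (intro measurable_completion) measurable
  have "(\<integral>\<^sup>+r\<in>A \<union> B. ennreal (1 / r) \<partial>lebesgue) \<le>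
     (\<integral>\<^sup>+r. ennreal (1 / r) * indicator A r + ennreal (1 / r) * indicator B r \<partial>lebesgue)"
    by (intro nn_integral_mono) (auto simp: indicator_def)
  also have "\<dots> = (\<integral>\<^sup>+r\<in>A. ennreal (1 / r) \<partial>lebesgue) + (\<integral>\<^sup>+r\<in>B. ennreal (1 / r) \<partial>lebesgue)"
    by (intro nn_integral_add) measurable
  also have "\<dots> < \<infinity>"
    using assms by (simp add: finite_log_measure_def)
  finally show "(\<integral>\<^sup>+r\<in>A \<union> B. ennreal (1 / r) \<partial>lebesgue) < \<infinity>" .
qed

lemma finite_log_measure_empty [simp]: "finite_log_measure {}"
  by (simp add: finite_log_measure_def)

lemma finite_log_measure_Union:
  assumes "finite I" "\<And>i. i \<in> I \<Longrightarrow> finite_log_measure (A i)"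
  shows "finite_log_measure (\<Union>i\<in>I. A i)"
  using assms by (induction I rule: finite_induct) (auto intro: finite_log_measure_Un)

text \<open>Any bounded range of radii can be discarded, so later inequalities have to hold for
  large r only.\<close>

lemma finite_log_measure_bounded: "finite_log_measure {1<..R}"
proof -
  have "finite_log_measure (\<Union>j::nat. if j = 0 then {1<..R} else {})"
    by (rule finite_log_measure_UN[where a = "\<lambda>_. 1" and c = "\<lambda>j. if j = 0 then \<bar>R\<bar> else 0"])
      (cases "1 \<le> R"; auto intro!: summable_finite[of "{0}"] ennreal_leI split: if_splits)+
  also have "(\<Union>j::nat. if j = 0 then {1<..R} else {}) = {1<..R}"
    by (auto split: if_splits)
  finally show ?thesis .
qed

text \<open>Serves to discard the radii whose dilated circles meet a zero or pole.\<close>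

lemma finite_log_measure_countable:
  assumes "countable C"
  shows "finite_log_measure C"
  unfolding finite_log_measure_def
proof
  have "C \<in> null_sets lborel" using assms by (rule countable_imp_null_set_lborel)
  then have C: "C \<in> null_sets lebesgue" by (rule null_sets_completionI)
  then show "C \<in> sets lebesgue" by auto
  have "(\<integral>\<^sup>+r\<in>C. ennreal (1 / r) \<partial>lebesgue) = 0"
    using C by (rule nn_integral_null_set)
  then show "(\<integral>\<^sup>+r\<in>C. ennreal (1 / r) \<partial>lebesgue) < \<infinity>" by simp
qed

text \<open>Markov's inequality on each block \<open>[q\<^sup>j, q\<^sup>j\<^sup>+\<^sup>1]\<close> replaces the Boutroux--Cartan covering lemma.\<close>

lemma exceptional_set:
  fixes u w :: "'a \<Rightarrow> real" and J :: "nat \<Rightarrow> 'a set"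
  assumes q: "q > 1" and \<eta>: "\<eta> > 1" and D: "D \<ge> q"
    and J: "\<And>j. finite (J j)" "\<And>j i. i \<in> J j \<Longrightarrow> 1 \<le> w i" "\<And>j i. i \<in> J j \<Longrightarrow> \<bar>u i\<bar> \<le> D * q ^ j"
  defines "M \<equiv> \<lambda>j. 1 + sum w (J j)"
  shows "\<exists>E. E \<subseteq> {1<..} \<and> finite_log_measure E \<and>
    (\<forall>j r. j > 0 \<and> q ^ j \<le> r \<and> r \<le> q ^ Suc j \<and> r \<notin> E \<longrightarrow> (\<forall>i\<in>J j. r \<noteq> u i) \<and>
       (\<Sum>i\<in>J j. w i / \<bar>r - u i\<bar>) \<le> 2 * (M j * ln (1 + 2 * D * (real j powr \<eta> * M j)) * real j powr \<eta> / q ^ j))"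
proof -
  \<comment> \<open>Chosen so that the neighbourhoods and the Markov part of block j each have
    measure at most 2 q^j / j^\<eta>. The 1 in \<open>M\<close> keeps \<delta> and \<kappa>
    meaningful when \<open>J j\<close> is empty.\<close>
  define \<delta> where "\<delta> = (\<lambda>j. q ^ j / (real j powr \<eta> * M j))"
  define \<kappa> where "\<kappa> = (\<lambda>j. M j * ln (1 + 2 * D * (real j powr \<eta> * M j)) * real j powr \<eta> / q ^ j)"
  define Bad where "Bad = (\<lambda>j. {t\<in>{q ^ j..q ^ Suc j}. (\<exists>i\<in>J j. \<bar>t - u i\<bar> < \<delta> j) \<or>
      \<kappa> j < (\<Sum>i\<in>J j. w i / (\<delta> j + \<bar>t - u i\<bar>))})"
  \<comment> \<open>Block 0 is left out: 0 powr \<eta> = 0 would make \<delta> and \<kappa>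
    degenerate.\<close>
  define E where "E = (\<Union>j. Bad (Suc j))"
  have W: "sum w (J j) \<ge> 0" for j
    using J(2) by (intro sum_nonneg) (meson order_trans zero_le_one)
  have M: "M j \<ge> 1" "sum w (J j) \<le> M j" for j using W[of j] by (auto simp: M_def)
  have pos: "\<delta> j > 0" "\<kappa> j > 0" if "j > 0" for j
  proof -
    have "M j > 0" using M(1)[of j] by linarith
    then show "\<delta> j > 0" "\<kappa> j > 0"
      using that q D by (auto simp: \<delta>_def \<kappa>_def intro!: divide_pos_pos mult_pos_pos ln_gt_zero)
  qed
  have D2: "\<bar>t - u i\<bar> \<le> 2 * D * q ^ j" if "i \<in> J j" "0 \<le> t" "t \<le> q ^ Suc j" for i j t
  proof -
    have "t \<le> D * q ^ j" using that D q by (auto intro: order_trans[OF _ mult_right_mono])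
    then show ?thesis using J(3)[OF that(1)] that(2) by linarith
  qed
  have le: "q ^ j \<le> q ^ Suc j" for j using q by (intro power_increasing) auto
  have Bad: "Bad j \<in> sets lborel" "emeasure lborel (Bad j) \<le> ennreal (q ^ j * (4 * (1 / real j powr \<eta>)))"
    if j: "j > 0" for j
  proof -
    have *: "\<bar>q ^ j - u i\<bar> \<le> 2 * D * q ^ j" "\<bar>q ^ Suc j - u i\<bar> \<le> 2 * D * q ^ j" if "i \<in> J j" for i
      using D2[OF that, of "q ^ j"] D2[OF that, of "q ^ Suc j"] q le by auto
    note bad = emeasure_bad_set_le[where J = "J j" and w = w and u = u, OF J(1) J(2) * le pos[OF j]]
    show "Bad j \<in> sets lborel" using bad(1) unfolding Bad_def by simp
    let ?W = "sum w (J j)" and ?p = "real j powr \<eta>"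
    have p: "?p > 0" and Mp: "M j > 0" using j M(1)[of j] by auto
    have L: "2 * D * q ^ j / \<delta> j = 2 * D * (?p * M j)"
      using q by (simp add: \<delta>_def)
    have "2 * \<delta> j * ?W \<le> 2 * \<delta> j * M j"
      using M(2)[of j] pos(1)[OF j] by (intro mult_left_mono) auto
    also have "\<dots> = 2 * q ^ j / ?p"
      using Mp by (simp add: \<delta>_def)
    finally have 1: "2 * \<delta> j * ?W \<le> 2 * q ^ j / ?p" .
    define L where "L = ln (1 + 2 * D * (?p * M j))"
    have "L > 0" using Mp p D q unfolding L_def by (intro ln_gt_zero) (auto intro!: mult_pos_pos)
    have "2 * L * ?W / \<kappa> j \<le> 2 * L * M j / \<kappa> j"
      using M(2)[of j] pos(2)[OF j] \<open>L > 0\<close> by (intro divide_right_mono mult_left_mono) auto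
    also have "\<dots> = 2 * q ^ j / ?p"
      using \<open>L > 0\<close> Mp p q by (simp add: \<kappa>_def flip: L_def)
    finally have 2: "2 * L * ?W / \<kappa> j \<le> 2 * q ^ j / ?p" .
    have "2 * \<delta> j * ?W + 2 * ln (1 + 2 * D * q ^ j / \<delta> j) * ?W / \<kappa> j \<le> q ^ j * (4 * (1 / ?p))"
    proof -
      have "q ^ j * (4 * (1 / ?p)) = 2 * q ^ j / ?p + 2 * q ^ j / ?p" by simp
      with 1 2 show ?thesis
        unfolding L L_def by linarith
    qed
    then show "emeasure lborel (Bad j) \<le> ennreal (q ^ j * (4 * (1 / ?p)))"
      using bad(2) ennreal_leI unfolding Bad_def by (meson order_trans)
  qed
  have summ: "summable (\<lambda>j. 4 * (1 / real (Suc j) powr \<eta>))"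
  proof -
    have "summable (\<lambda>n. real n powr (- \<eta>))"
      using \<eta> by (subst summable_real_powr_iff) auto
    then have "summable (\<lambda>n. real (Suc n) powr (- \<eta>))"
      by (subst summable_Suc_iff)
    then show ?thesis by (intro summable_mult) (simp add: powr_minus_divide)
  qed
  show ?thesis
  proof (intro exI[of _ E] conjI allI impI ballI)
    have "1 < t" if "q ^ Suc j \<le> t" for t j
      using one_less_power[OF q, of "Suc j"] that by linarith
    then show "E \<subseteq> {1<..}" by (force simp: E_def Bad_def)
    show "finite_log_measure E"
      unfolding E_def
    proof (rule finite_log_measure_UN)
      show "Bad (Suc j) \<in> sets lborel" for j by (rule Bad(1)) simp
      show "emeasure lborel (Bad (Suc j)) \<le> ennreal (q ^ Suc j * (4 * (1 / real (Suc j) powr \<eta>)))" for j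
        by (rule Bad(2)) simp
      show "q ^ Suc j \<le> r" if "r \<in> Bad (Suc j)" for j r
        using that by (simp add: Bad_def)
      show "q ^ Suc j > 0" for j using q by simp
      show "summable (\<lambda>j. 4 * (1 / real (Suc j) powr \<eta>))" by (rule summ)
    qed simp
    fix j r assume "j > 0 \<and> q ^ j \<le> r \<and> r \<le> q ^ Suc j \<and> r \<notin> E"
    then have j: "j > 0" "q ^ j \<le> r" "r \<le> q ^ Suc j" "r \<notin> E" by auto
    then have "r \<notin> Bad j" by (auto simp: E_def gr0_conv_Suc)
    with j have far: "\<And>i. i \<in> J j \<Longrightarrow> \<delta> j \<le> \<bar>r - u i\<bar>"
      and sum: "(\<Sum>i\<in>J j. w i / (\<delta> j + \<bar>r - u i\<bar>)) \<le> \<kappa> j"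
      by (auto simp: Bad_def not_less)
    show "r \<noteq> u i" if "i \<in> J j" for i
      using far[OF that] pos(1)[OF j(1)] by auto
    \<comment> \<open>Since |r - u i| >= \<delta>, the truncated denominator is at most 2 |r - u i|;
      this is the factor 2 in the conclusion.\<close>
    have "(\<Sum>i\<in>J j. w i / \<bar>r - u i\<bar>) \<le> (\<Sum>i\<in>J j. 2 * (w i / (\<delta> j + \<bar>r - u i\<bar>)))"
    proof (intro sum_mono)
      fix i assume i: "i \<in> J j"
      have "w i / \<bar>r - u i\<bar> = 2 * w i / (2 * \<bar>r - u i\<bar>)" by simp
      also have "\<dots> \<le> 2 * w i / (\<delta> j + \<bar>r - u i\<bar>)"
        using far[OF i] pos(1)[OF j(1)] J(2)[OF i] by (intro divide_left_mono) auto
      finally show "w i / \<bar>r - u i\<bar> \<le> 2 * (w i / (\<delta> j + \<bar>r - u i\<bar>))" by simp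
    qed
    also have "\<dots> \<le> 2 * \<kappa> j" unfolding sum_distrib_left[symmetric] using sum by simp
    finally show "(\<Sum>i\<in>J j. w i / \<bar>r - u i\<bar>) \<le>
        2 * (M j * ln (1 + 2 * D * (real j powr \<eta> * M j)) * real j powr \<eta> / q ^ j)"
      by (simp add: \<kappa>_def)
  qed
qed

section \<open>The shift estimate\<close>

text \<open>Of the two factors of (z + i \<beta>)^2 - p, the larger has size at least |z| / 2 and
  only the smaller can be dangerous. Which one is smaller is unknown, so both reciprocals appear in
  the bound.\<close>

lemma square_distance_lower_bound:
  fixes z p :: complex and \<beta> \<gamma> :: real
  defines "s \<equiv> csqrt p"
  defines "u1 \<equiv> (norm (s + \<i> * \<beta>))\<^sup>2" and "u2 \<equiv> (norm (s - \<i> * \<beta>))\<^sup>2"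
  assumes z: "2 * \<bar>\<beta>\<bar> \<le> norm z" "norm z > 0" and p: "norm p \<le> \<gamma> * (norm z)\<^sup>2" and \<gamma>: "\<gamma> > 1"
    and ne: "(norm z)\<^sup>2 \<noteq> u1" "(norm z)\<^sup>2 \<noteq> u2"
  shows "1 / norm ((z + \<i> * \<beta>)\<^sup>2 - p) \<le>
           2 * (2 + \<gamma>) * (1 / \<bar>(norm z)\<^sup>2 - u1\<bar> + 1 / \<bar>(norm z)\<^sup>2 - u2\<bar>)"
proof -
  \<comment> \<open>The factors add up to 2 (z + i \<beta>), so the larger, \<open>a\<close>, has
    |a| >= |z + i \<beta>| >= |z| / 2. The smaller is z + c, so |b| is at least the difference of
    |z| and |c|; multiplication by |z| + |c| <= (2 + \<gamma>) |z| turns this into a difference of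
    squares, which depends on z through r = |z|^2 only.\<close>
  have key: "1 / (norm a * norm b) \<le> 2 * (2 + \<gamma>) * (1 / \<bar>(norm z)\<^sup>2 - (norm c)\<^sup>2\<bar>)"
    if "a + b = 2 * (z + \<i> * \<beta>)" "norm b \<le> norm a" "b = z + c" "norm c \<le> (1 + \<gamma>) * norm z"
      "(norm z)\<^sup>2 \<noteq> (norm c)\<^sup>2" for a b c
  proof -
    have "2 * norm (z + \<i> * \<beta>) = norm (a + b)" by (simp only: that(1) norm_mult norm_numeral)
    also have "\<dots> \<le> 2 * norm a" using norm_triangle_ineq[of a b] that(2) by simp
    finally have "norm (z + \<i> * \<beta>) \<le> norm a" by simp
    moreover have "norm z - \<bar>\<beta>\<bar> \<le> norm (z + \<i> * \<beta>)"
      using norm_diff_ineq[of z "\<i> * \<beta>"] by (simp add: norm_mult)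
    ultimately have a: "norm z / 2 \<le> norm a" using z by linarith
    have b: "\<bar>norm z - norm c\<bar> \<le> norm b"
      using norm_triangle_ineq3[of z "- c"] that(3) by simp
    have sq: "\<bar>(norm z)\<^sup>2 - (norm c)\<^sup>2\<bar> = \<bar>norm z - norm c\<bar> * (norm z + norm c)"
      by (simp add: power2_eq_square square_diff_square_factored abs_mult abs_of_nonneg)
    have c: "norm z + norm c \<le> (2 + \<gamma>) * norm z" using that(4) by (simp add: algebra_simps)
    have pos: "\<bar>(norm z)\<^sup>2 - (norm c)\<^sup>2\<bar> > 0" using that(5) by simp
    have "\<bar>(norm z)\<^sup>2 - (norm c)\<^sup>2\<bar> \<le> norm b * ((2 + \<gamma>) * norm z)"
      unfolding sq by (intro mult_mono b c) auto
    also have "\<dots> = 2 * (2 + \<gamma>) * (norm z / 2 * norm b)" by simp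
    also have "\<dots> \<le> 2 * (2 + \<gamma>) * (norm a * norm b)"
      using a \<gamma> by (intro mult_left_mono mult_right_mono) auto
    finally have *: "\<bar>(norm z)\<^sup>2 - (norm c)\<^sup>2\<bar> \<le> 2 * (2 + \<gamma>) * (norm a * norm b)" .
    then have "norm a * norm b > 0"
      using pos \<gamma> by (smt (verit) zero_less_mult_iff mult_nonneg_nonneg norm_ge_zero)
    then show ?thesis using * pos by (simp add: field_simps)
  qed
  have s: "norm s \<le> \<gamma> * norm z"
  proof -
    have "(norm s)\<^sup>2 = norm p" by (simp add: s_def flip: norm_power)
    also have "\<dots> \<le> (\<gamma> * norm z)\<^sup>2"
      using p \<gamma> mult_right_mono[of \<gamma> "\<gamma>\<^sup>2" "(norm z)\<^sup>2"]
      by (simp add: power_mult_distrib self_le_power)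
    finally show ?thesis using \<gamma> by (simp add: power2_le_iff_abs_le)
  qed
  have "\<bar>\<beta>\<bar> \<le> norm z" using z by linarith
  then have c: "norm (s + \<i> * \<beta>) \<le> (1 + \<gamma>) * norm z" "norm (s - \<i> * \<beta>) \<le> (1 + \<gamma>) * norm z"
    using s norm_triangle_ineq[of s "\<i> * \<beta>"] norm_triangle_ineq4[of s "\<i> * \<beta>"]
    by (simp_all add: norm_mult algebra_simps)
  have "(z + \<i> * \<beta>)\<^sup>2 - p = (z + \<i> * \<beta> + s) * (z + \<i> * \<beta> - s)"
    unfolding square_diff_square_factored[symmetric] by (simp add: s_def flip: power2_eq_square)
  then have prod: "norm ((z + \<i> * \<beta>)\<^sup>2 - p) = norm (z + \<i> * \<beta> + s) * norm (z + \<i> * \<beta> - s)"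
    by (simp only: norm_mult)
  have nn: "1 / \<bar>(norm z)\<^sup>2 - u1\<bar> \<ge> 0" "1 / \<bar>(norm z)\<^sup>2 - u2\<bar> \<ge> 0" by auto
  show ?thesis
  proof (cases "norm (z + \<i> * \<beta> - s) \<le> norm (z + \<i> * \<beta> + s)")
    case True
    have "1 / norm ((z + \<i> * \<beta>)\<^sup>2 - p) \<le> 2 * (2 + \<gamma>) * (1 / \<bar>(norm z)\<^sup>2 - u2\<bar>)"
      unfolding prod u2_def norm_minus_commute[of s] using True c ne
      by (intro key) (auto simp: u2_def norm_minus_commute)
    also have "\<dots> \<le> 2 * (2 + \<gamma>) * (1 / \<bar>(norm z)\<^sup>2 - u1\<bar> + 1 / \<bar>(norm z)\<^sup>2 - u2\<bar>)"
      using nn \<gamma> by (intro mult_left_mono) auto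
    finally show ?thesis .
  next
    case False
    have "1 / norm ((z + \<i> * \<beta>)\<^sup>2 - p) \<le> 2 * (2 + \<gamma>) * (1 / \<bar>(norm z)\<^sup>2 - u1\<bar>)"
      unfolding prod mult.commute[of "norm (z + \<i> * \<beta> + s)"] u1_def using False c ne
      by (intro key) (auto simp: u1_def add_ac)
    also have "\<dots> \<le> 2 * (2 + \<gamma>) * (1 / \<bar>(norm z)\<^sup>2 - u1\<bar> + 1 / \<bar>(norm z)\<^sup>2 - u2\<bar>)"
      using nn \<gamma> by (intro mult_left_mono) auto
    finally show ?thesis .
  qed
qed

lemma ln_half_le: "1 / 2 \<le> ln (2::real)"
  using ln2_ge_two_thirds by simp

text \<open>The gap \<open>\<eta> < \<gamma>\<close> absorbs the factor \<open>ln j\<close> lost in using Markov's inequality.\<close>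

lemma block_log_bound:
  fixes D \<eta> \<gamma> M :: real and j n :: nat
  assumes D: "D > 0" and \<eta>: "0 < \<eta>" "\<eta> < \<gamma>" and j: "j > 0" and M: "1 \<le> M" "M \<le> 1 + 3 * real n"
  defines "B \<equiv> ln (1 + 2 * D) + \<eta> / (\<gamma> - \<eta>)"
  shows "M * ln (1 + 2 * D * (real j powr \<eta> * M)) * real j powr \<eta> \<le>
    4 * (2 * (B + ln 4) + 1) * real j powr \<gamma> * (real n * ln_plus (real n) + 1)"
proof -
  have B: "B > 0" unfolding B_def using D \<eta> by (intro add_pos_pos ln_gt_zero) auto
  have j1: "real j \<ge> 1" using j by simp
  then have jp: "real j powr \<eta> \<ge> 1" using \<eta> by (simp add: ge_one_powr_ge_zero)
  have "1 * 1 \<le> real j powr \<eta> * M"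
    using jp M by (intro mult_mono) auto
  then have jM: "real j powr \<eta> * M \<ge> 1" by simp
  have "1 + 2 * D * (real j powr \<eta> * M) \<le> (1 + 2 * D) * (real j powr \<eta> * M)"
    using jM by (simp add: algebra_simps)
  then have "ln (1 + 2 * D * (real j powr \<eta> * M)) \<le> ln ((1 + 2 * D) * (real j powr \<eta> * M))"
    using jM D j M by (subst ln_le_cancel_iff) (auto intro!: add_pos_pos mult_pos_pos)
  also have "\<dots> = ln (1 + 2 * D) + \<eta> * ln (real j) + ln M"
    using D j M by (simp add: ln_mult ln_powr)
  finally have 1: "ln (1 + 2 * D * (real j powr \<eta> * M)) \<le> ln (1 + 2 * D) + \<eta> * ln (real j) + ln M" .
  have lnj: "\<eta> * ln (real j) \<le> \<eta> / (\<gamma> - \<eta>) * real j powr (\<gamma> - \<eta>)"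
    using ln_powr_bound[OF j1, of "\<gamma> - \<eta>"] \<eta> mult_left_mono[of _ _ \<eta>] by fastforce
  have jd: "real j powr (\<gamma> - \<eta>) \<ge> 1" using \<eta> j1 by (simp add: ge_one_powr_ge_zero)
  have nonneg: "ln (1 + 2 * D) \<ge> 0" "ln M \<ge> 0" using D M by auto
  have "ln (1 + 2 * D) + \<eta> * ln (real j) + ln M \<le> (B + ln M) * real j powr (\<gamma> - \<eta>)"
    using lnj mult_left_mono[OF jd nonneg(1)] mult_left_mono[OF jd nonneg(2)]
    by (simp add: B_def distrib_right)
  with 1 have "ln (1 + 2 * D * (real j powr \<eta> * M)) \<le> (B + ln M) * real j powr (\<gamma> - \<eta>)"
    by linarith
  then have "M * ln (1 + 2 * D * (real j powr \<eta> * M)) * real j powr \<eta> \<le>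
      M * ((B + ln M) * real j powr (\<gamma> - \<eta>)) * real j powr \<eta>"
    using M by (intro mult_right_mono mult_left_mono) auto
  also have "\<dots> = M * (B + ln M) * (real j powr (\<gamma> - \<eta>) * real j powr \<eta>)" by simp
  also have "real j powr (\<gamma> - \<eta>) * real j powr \<eta> = real j powr \<gamma>"
    by (simp flip: powr_add)
  also have "M * (B + ln M) * real j powr \<gamma> \<le>
      (4 * (2 * (B + ln 4) + 1) * (real n * ln_plus (real n) + 1)) * real j powr \<gamma>"
  proof (intro mult_right_mono)
    show "M * (B + ln M) \<le> 4 * (2 * (B + ln 4) + 1) * (real n * ln_plus (real n) + 1)"
    \<comment> \<open>For n >= 2, ln n >= 1/2 swallows all constants. For n <= 1,
      \<open>ln_plus\<close> vanishes and the summand 1 on the right carries the bound.\<close>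
    proof (cases "n \<ge> 2")
      case True
      have lnn: "ln (real n) \<ge> 1 / 2" using True ln_half_le ln_le_cancel_iff[of 2 "real n"] by linarith
      have M4: "M \<le> 4 * real n" using M True by simp
      then have "ln M \<le> ln (4 * real n)"
        using M True by (subst ln_le_cancel_iff) auto
      then have "ln M \<le> ln 4 + ln (real n)"
        using True by (simp add: ln_mult)
      then have "M * (B + ln M) \<le> 4 * real n * (B + ln 4 + ln (real n))"
        using M4 M B by (intro mult_mono) auto
      also have "\<dots> \<le> 4 * real n * ((2 * (B + ln 4) + 1) * ln (real n))"
        using mult_left_mono[OF lnn, of "2 * (B + ln 4)"] B by (intro mult_left_mono) (auto simp: distrib_right)
      also have "\<dots> \<le> 4 * (2 * (B + ln 4) + 1) * (real n * ln_plus (real n) + 1)"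
        using True B by (simp add: ln_plus_def max_def algebra_simps)
      finally show ?thesis .
    next
      case False
      then have "M \<le> 4" using M by auto
      then have "M * (B + ln M) \<le> 4 * (B + ln 4)"
        using M B by (intro mult_mono) auto
      also have "\<dots> \<le> 4 * (2 * (B + ln 4) + 1)" using B by simp
      also have "\<dots> \<le> 4 * (2 * (B + ln 4) + 1) * (real n * ln_plus (real n) + 1)"
        using B mult_left_mono[of 1 "real n * ln_plus (real n) + 1" "4 * (2 * (B + ln 4) + 1)"]
          ln_plus_nonneg[of "real n"] by simp
      finally show ?thesis .
    qed
  qed auto
  finally show ?thesis by (simp add: mult_ac)
qed

text \<open>Absorbs terms linear in n, with the 1 covering n <= 1, where \<open>ln_plus\<close>
  vanishes.\<close>

lemma nat_le_ln_plus: "real n \<le> 2 * (real n * ln_plus (real n) + 1)"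
proof (cases "n \<ge> 2")
  case True
  have "ln (real n) \<ge> 1 / 2" using True ln_half_le ln_le_cancel_iff[of 2 "real n"] by linarith
  moreover have "ln_plus (real n) = ln (real n)" using True by (simp add: ln_plus_def max_def)
  ultimately show ?thesis using mult_left_mono[of "1 / 2" "ln (real n)" "real n"] by simp
next
  case False
  then have "real n \<le> 2" by simp
  moreover have "0 \<le> real n * ln_plus (real n)" by (simp add: ln_plus_nonneg)
  ultimately show ?thesis unfolding distrib_left by linarith
qed

text \<open>The last property is what later converts j^\<gamma> into (ln r)^\<gamma>; r >= q ensures
  j > 0.\<close>

lemma log_block_exists:
  fixes q r :: real
  assumes "q > 1" "r \<ge> q"
  obtains j :: nat where "j > 0" "q ^ j \<le> r" "r \<le> q ^ Suc j" "real j \<le> ln r / ln q"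
proof -
  define j where "j = nat \<lfloor>log q r\<rfloor>"
  have "log q r \<ge> 1" using assms by (simp add: le_log_iff)
  then have j: "real j \<le> log q r" "log q r \<le> real (Suc j)" "j > 0"
    unfolding j_def by (linarith, linarith, auto)
  show ?thesis
  proof (rule that[of j])
    show "q ^ j \<le> r" using j(1) assms by (simp add: le_log_iff powr_realpow)
    show "r \<le> q ^ Suc j" using j(2) assms by (subst (asm) log_le_iff) (auto simp: powr_realpow simp del: of_nat_Suc power_Suc)
  qed (use j in \<open>auto simp: log_def\<close>)
qed

text \<open>Here a and b will collect what may not enter the constant of the theorem: the Jensen
  constant of \<open>f\<close> and the extra 1 beside n ln+ n.\<close>

lemma eventually_slack:
  fixes a b \<gamma> :: real
  assumes "\<gamma> > 0"
  shows "eventually (\<lambda>r. (a + b * ln r powr \<gamma>) / sqrt r \<le> 1 / 4 * ln r) at_top"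
proof -
  have "((\<lambda>r. ln r powr \<gamma> / sqrt r) \<longlongrightarrow> 0) at_top" using assms by real_asymp
  moreover have "((\<lambda>r. 1 / sqrt r) \<longlongrightarrow> 0) at_top" by real_asymp
  ultimately have "((\<lambda>r. a * (1 / sqrt r) + b * (ln r powr \<gamma> / sqrt r)) \<longlongrightarrow> a * 0 + b * 0) at_top"
    by (intro tendsto_intros)
  then have "eventually (\<lambda>r. a * (1 / sqrt r) + b * (ln r powr \<gamma> / sqrt r) < 1 / 4) at_top"
    by (rule order_tendstoD) simp
  moreover have "eventually (\<lambda>r::real. ln r \<ge> 1) at_top" by real_asymp
  ultimately show ?thesis
  proof eventually_elim
    case (elim r)
    have "(a + b * ln r powr \<gamma>) / sqrt r = a * (1 / sqrt r) + b * (ln r powr \<gamma> / sqrt r)"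
      by (simp add: add_divide_distrib)
    then show ?case using elim by linarith
  qed
qed

text \<open>
  For \<open>i = (p, j)\<close> with \<open>j \<in> {0, 1, 2}\<close>: the values of \<open>(norm z)\<^sup>2\<close> for which \<open>z\<^sup>2\<close> or \<open>(z + \<i>\<beta>)\<^sup>2\<close> can
  meet the point \<open>p\<close>.
\<close>

definition shift_pt :: "real \<Rightarrow> complex \<times> nat \<Rightarrow> real" where
  "shift_pt \<beta> i = (if snd i = 0 then norm (fst i)
     else if snd i = 1 then (norm (csqrt (fst i) + \<i> * \<beta>))\<^sup>2 else (norm (csqrt (fst i) - \<i> * \<beta>))\<^sup>2)"

lemma shift_pt_bound:
  "\<bar>shift_pt \<beta> i\<bar> \<le> 2 * norm (fst i) + 2 * \<beta>\<^sup>2"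
proof -
  have *: "(norm (s + t))\<^sup>2 \<le> 2 * (norm s)\<^sup>2 + 2 * (norm t)\<^sup>2" for s t :: complex
  proof -
    have "(norm (s + t))\<^sup>2 \<le> (norm s + norm t)\<^sup>2"
      by (intro power_mono norm_triangle_ineq) auto
    also have "\<dots> \<le> 2 * (norm s)\<^sup>2 + 2 * (norm t)\<^sup>2"
      using zero_le_power2[of "norm s - norm t"] unfolding power2_sum power2_diff by simp
    finally show ?thesis .
  qed
  have "(norm (csqrt p))\<^sup>2 = norm p" for p by (simp flip: norm_power)
  then show ?thesis
    using *[of "csqrt (fst i)" "\<i> * \<beta>"] *[of "csqrt (fst i)" "- (\<i> * \<beta>)"]
    by (auto simp: shift_pt_def norm_mult)
qed

context mero_nonzero
begin

text \<open>\<open>ln_norm_diff_le\<close> with R = \<gamma> r and \<rho> = q r. Points of the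
  divisor with |p| <= q^(j+2) are near and are controlled by \<open>S\<close>; the others have
  distance at least (q - 1) r / 2 from x and w. Taking out 1/r and using |w - x| <= K |z| leaves K /
  |z|.\<close>

lemma shift_estimate:
  fixes z :: complex and \<beta> \<gamma> q S :: real and j :: nat
  defines "r \<equiv> (norm z)\<^sup>2" and "K \<equiv> 2 * \<bar>\<beta>\<bar> + \<beta>\<^sup>2" and "n \<equiv> real (zero_pole_count (\<gamma> * (norm z)\<^sup>2) f)"
    and "J \<equiv> div_supp (q ^ (j + 2)) f \<times> {0, 1, 2::nat}"
  assumes \<gamma>: "\<gamma> > 1" and q: "q = sqrt \<gamma>" and ok: "radius_ok (\<gamma> * r)"
    and j: "q ^ j \<le> r" "r \<le> q ^ Suc j"
    and z: "norm z \<ge> 1" "2 * \<bar>\<beta>\<bar> \<le> norm z" "K \<le> (q - 1) / 2 * norm z"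
    and ne: "\<And>i. i \<in> J \<Longrightarrow> r \<noteq> shift_pt \<beta> i"
    and S: "(\<Sum>i\<in>J. \<bar>real_of_int (zorder f (fst i))\<bar> / \<bar>r - shift_pt \<beta> i\<bar>) \<le> S"
  shows "zorder f (z\<^sup>2) = 0" "zorder f ((z + \<i> * \<beta>)\<^sup>2) = 0"
    "ln (norm (f ((z + \<i> * \<beta>)\<^sup>2))) - ln (norm (f (z\<^sup>2))) \<le> K / norm z *
       (2 * \<gamma> / (\<gamma> - q)\<^sup>2 * (2 * nevanlinna_char (\<gamma> * r) f + \<bar>jensen_const\<bar>) +
        (2 / (\<gamma> - q) + 4 / (q - 1)) * n + r * (2 * (2 + \<gamma>) * S))"
proof -
  define x where "x = z\<^sup>2"
  define w where "w = (z + \<i> * \<beta>)\<^sup>2"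
  have q0: "q > 1" "q * q = \<gamma>" using \<gamma> q by auto
  then have q1: "q > 1" "q * q = \<gamma>" "q < \<gamma>"
    using mult_strict_left_mono[of 1 q q] by auto
  have r1: "r \<ge> 1" using z(1) by (simp add: r_def)
  have x: "norm x = r" by (simp add: x_def r_def norm_power)
  have h: "norm (w - x) \<le> K * norm z"
  proof -
    have "w - x = 2 * (\<i> * \<beta>) * z + (\<i> * \<beta>)\<^sup>2"
      unfolding w_def x_def by (simp add: power2_eq_square algebra_simps)
    also have "norm \<dots> \<le> 2 * \<bar>\<beta>\<bar> * norm z + \<beta>\<^sup>2"
      by (rule order_trans[OF norm_triangle_ineq]) (simp add: norm_mult norm_power)
    also have "\<beta>\<^sup>2 \<le> \<beta>\<^sup>2 * norm z" using z(1) by (simp add: mult_le_cancel_left1)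
    finally show ?thesis by (simp add: K_def algebra_simps)
  qed
  have "K * norm z \<le> (q - 1) / 2 * norm z * norm z"
    using z by (intro mult_right_mono) auto
  then have h': "norm (w - x) \<le> (q - 1) / 2 * r" using h by (simp add: r_def power2_eq_square)
  have w: "norm w \<le> (q + 1) / 2 * r"
    using norm_triangle_ineq[of "w - x" x] h' x by (simp add: field_simps)
  \<comment> \<open>The near radius q^(j+2) depends on the block only. It is at least q r, which
    keeps the remaining points far from x and w, and at most \<gamma> r, which keeps the near points
    inside the disc of the factorization.\<close>
  have qr: "q * r \<le> q ^ (j + 2)"
    using mult_left_mono[OF j(2), of q] q1 by simp
  have q2r: "q ^ (j + 2) \<le> \<gamma> * r"
    unfolding q0(2)[symmetric] using mult_left_mono[OF j(1), of "q * q"] q1(1) by (simp add: mult_ac)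
  have rle: "r \<le> q * r" "(q + 1) / 2 * r \<le> q * r"
    using q1 r1 by (auto intro!: mult_right_mono simp: mult_le_cancel_right1)
  have J: "(p, k) \<in> J" if "norm p \<le> q ^ (j + 2)" "zorder f p \<noteq> 0" "k \<le> 2" for p k
    using that by (auto simp: J_def div_supp_def)
  show zx: "zorder f (z\<^sup>2) = 0"
  proof (rule ccontr)
    assume "zorder f (z\<^sup>2) \<noteq> 0"
    then have "(x, 0) \<in> J" using x rle qr by (intro J) (auto simp: x_def)
    from ne[OF this] show False by (simp add: shift_pt_def x)
  qed
  show zw: "zorder f ((z + \<i> * \<beta>)\<^sup>2) = 0"
  proof (rule ccontr)
    assume "zorder f ((z + \<i> * \<beta>)\<^sup>2) \<noteq> 0"
    then have "(w, 1) \<in> J" "(w, 2) \<in> J" using w rle qr by (auto intro!: J simp: w_def)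
    from ne[OF this(1)] ne[OF this(2)]
    have *: "norm z \<noteq> norm (csqrt w + \<i> * \<beta>)" "norm z \<noteq> norm (csqrt w - \<i> * \<beta>)"
      by (auto simp: shift_pt_def r_def)
    have "(csqrt w)\<^sup>2 = (z + \<i> * \<beta>)\<^sup>2" by (simp add: w_def)
    then have "csqrt w = z + \<i> * \<beta> \<or> csqrt w = - (z + \<i> * \<beta>)"
      by (simp only: power2_eq_iff)
    \<comment> \<open>Either square root of w leads back to z or -z after undoing the shift, so one
      of the two shift points over w would equal r.\<close>
    moreover have "a - c = z \<or> a + c = - z" if "a = z + c \<or> a = - (z + c)" for a c :: complex
      using that by auto
    ultimately have "csqrt w - \<i> * \<beta> = z \<or> csqrt w + \<i> * \<beta> = - z" by blast
    then show False using * by (metis norm_minus_cancel)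
  qed
  have near: "1 / norm (w - p) + 1 / norm (x - p) \<le>
      2 * (2 + \<gamma>) * (\<Sum>k\<in>{0,1,2}. 1 / \<bar>r - shift_pt \<beta> (p, k)\<bar>)" if p: "p \<in> div_supp (q ^ (j + 2)) f" for p
  proof -
    have pJ: "(p, k) \<in> J" if "k \<le> 2" for k using p that by (auto intro: J simp: div_supp_def)
    have p': "norm p \<le> \<gamma> * (norm z)\<^sup>2" using p q2r by (simp add: div_supp_def r_def)
    have "z \<noteq> 0" using z(1) by auto
    then have "1 / norm (w - p) \<le> 2 * (2 + \<gamma>) * (1 / \<bar>r - shift_pt \<beta> (p, 1)\<bar> + 1 / \<bar>r - shift_pt \<beta> (p, 2)\<bar>)"
      using square_distance_lower_bound[of \<beta> z p \<gamma>] z p' \<gamma> ne[OF pJ[of 1]] ne[OF pJ[of 2]]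
      by (simp add: w_def r_def shift_pt_def)
    moreover have "1 / norm (x - p) \<le> 2 * (2 + \<gamma>) * (1 / \<bar>r - shift_pt \<beta> (p, 0)\<bar>)"
    proof -
      have "\<bar>r - norm p\<bar> \<le> norm (x - p)" using norm_triangle_ineq3[of x p] x by simp
      moreover have "\<bar>r - norm p\<bar> > 0" using ne[OF pJ[of 0]] by (simp add: shift_pt_def)
      ultimately have "1 / norm (x - p) \<le> 1 / \<bar>r - norm p\<bar>" by (intro divide_left_mono mult_pos_pos) auto
      also have "\<dots> \<le> 2 * (2 + \<gamma>) * (1 / \<bar>r - norm p\<bar>)"
        using mult_right_mono[of 1 "2 * (2 + \<gamma>)" "1 / \<bar>r - norm p\<bar>"] \<gamma> by simp
      finally show ?thesis by (simp add: shift_pt_def)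
    qed
    ultimately show ?thesis by (simp add: distrib_left)
  qed
  have far: "1 / norm (w - p) + 1 / norm (x - p) \<le> 4 / ((q - 1) * r)" if p: "norm p > q ^ (j + 2)" for p
  proof -
    have "norm p \<ge> q * r" using p qr by linarith
    then have "(q - 1) / 2 * r \<le> norm (w - p)" "(q - 1) / 2 * r \<le> norm (x - p)"
      using norm_triangle_ineq2[of p w] norm_triangle_ineq2[of p x] w x rle
      by (simp_all add: norm_minus_commute field_simps)
    moreover have "(q - 1) / 2 * r > 0" using q1 r1 by simp
    ultimately have "1 / norm (w - p) \<le> 1 / ((q - 1) / 2 * r)" "1 / norm (x - p) \<le> 1 / ((q - 1) / 2 * r)"
      by (auto intro: frac_le simp del: times_divide_eq_left)
    then show ?thesis by simp
  qed
  let ?m = "\<lambda>p. \<bar>real_of_int (zorder f p)\<bar>"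
  let ?N = "div_supp (q ^ (j + 2)) f" and ?D = "div_supp (\<gamma> * r) f"
  have sub: "?N \<subseteq> ?D" using q2r by (auto simp: div_supp_def)
  have "(\<Sum>p\<in>?D. ?m p * (1 / norm (w - p) + 1 / norm (x - p))) \<le>
     (\<Sum>p\<in>?D - ?N. ?m p * (4 / ((q - 1) * r))) +
     (\<Sum>p\<in>?N. ?m p * (2 * (2 + \<gamma>) * (\<Sum>k\<in>{0,1,2}. 1 / \<bar>r - shift_pt \<beta> (p, k)\<bar>)))"
    unfolding sum.subset_diff[OF sub finite_div_supp]
    by (intro add_mono sum_mono mult_left_mono near far) (auto simp: div_supp_def)
  also have "(\<Sum>p\<in>?D - ?N. ?m p * (4 / ((q - 1) * r))) \<le> (\<Sum>p\<in>?D. ?m p * (4 / ((q - 1) * r)))"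
    using q1 r1 by (intro sum_mono2) auto
  also have "\<dots> = 4 / ((q - 1) * r) * n"
    unfolding n_def r_def[symmetric] zero_pole_count_eq by (simp add: sum_distrib_left mult.commute)
  also have "(\<Sum>p\<in>?N. ?m p * (2 * (2 + \<gamma>) * (\<Sum>k\<in>{0,1,2}. 1 / \<bar>r - shift_pt \<beta> (p, k)\<bar>))) =
      2 * (2 + \<gamma>) * (\<Sum>p\<in>?N. \<Sum>k\<in>{0,1,2}. ?m p / \<bar>r - shift_pt \<beta> (p, k)\<bar>)"
    by (simp add: sum_distrib_left algebra_simps)
  also have "(\<Sum>p\<in>?N. \<Sum>k\<in>{0,1,2}. ?m p / \<bar>r - shift_pt \<beta> (p, k)\<bar>) =
      (\<Sum>i\<in>J. ?m (fst i) / \<bar>r - shift_pt \<beta> i\<bar>)"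
    unfolding J_def sum.cartesian_product by (intro sum.cong) auto
  also have "2 * (2 + \<gamma>) * (\<Sum>i\<in>J. ?m (fst i) / \<bar>r - shift_pt \<beta> i\<bar>) \<le> 2 * (2 + \<gamma>) * S"
    using S \<gamma> by (intro mult_left_mono) auto
  finally have sum: "(\<Sum>p\<in>?D. ?m p * (1 / norm (w - p) + 1 / norm (x - p))) \<le>
      4 / ((q - 1) * r) * n + 2 * (2 + \<gamma>) * S"
    by simp
  define B where "B = 2 * (\<gamma> * r) / (\<gamma> * r - q * r)\<^sup>2 * (2 * nevanlinna_char (\<gamma> * r) f + \<bar>jensen_const\<bar>) +
      2 / (\<gamma> * r - q * r) * n + (4 / ((q - 1) * r) * n + 2 * (2 + \<gamma>) * S)"
  have gr1: "\<gamma> * r \<ge> 1" using \<gamma> r1 mult_mono[of 1 \<gamma> 1 r] by simp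
  \<comment> \<open>\<open>S\<close> has no sign assumption; nonnegativity of \<open>B\<close> is
    inherited from the sum bounded here. It is required for replacing |w - x| by K |z|.\<close>
  have nonneg: "(\<Sum>p\<in>?D. ?m p * (1 / norm (w - p) + 1 / norm (x - p))) \<ge> 0"
    by (intro sum_nonneg mult_nonneg_nonneg add_nonneg_nonneg) auto
  have gq: "\<gamma> * r - q * r > 0" using q1 r1 by simp
  have "0 \<le> 4 / ((q - 1) * r) * n + 2 * (2 + \<gamma>) * S"
    using nonneg sum by linarith
  moreover
  have "0 \<le> 2 * (\<gamma> * r) / (\<gamma> * r - q * r)\<^sup>2 * (2 * nevanlinna_char (\<gamma> * r) f + \<bar>jensen_const\<bar>)"
      using nevanlinna_char_nonneg[OF gr1] \<gamma> r1
      by (intro mult_nonneg_nonneg divide_nonneg_nonneg add_nonneg_nonneg) auto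
  moreover have "0 \<le> 2 / (\<gamma> * r - q * r) * n"
      using gq by (intro mult_nonneg_nonneg divide_nonneg_nonneg) (auto simp: n_def)
  ultimately have B: "B \<ge> 0" unfolding B_def by linarith
  have "ln (norm (f w)) - ln (norm (f x)) \<le> norm (w - x) * (2 * (\<gamma> * r) / (\<gamma> * r - q * r)\<^sup>2 *
        (2 * nevanlinna_char (\<gamma> * r) f + \<bar>jensen_const\<bar>) +
        2 / (\<gamma> * r - q * r) * real (zero_pole_count (\<gamma> * r) f) +
        (\<Sum>p\<in>?D. ?m p * (1 / norm (w - p) + 1 / norm (x - p))))"
    by (rule ln_norm_diff_le[OF ok gr1])
       (use gq x order_trans[OF w rle(2)] rle(1) zx zw in \<open>simp_all add: x_def w_def\<close>)
  also have "\<dots> \<le> norm (w - x) * B"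
    unfolding B_def n_def r_def[symmetric] using sum
    by (intro mult_left_mono add_left_mono) (auto simp: n_def r_def)
  also have "\<dots> \<le> K * norm z * B"
    using h B by (intro mult_right_mono)
  also have "B = (2 * \<gamma> / (\<gamma> - q)\<^sup>2 * (2 * nevanlinna_char (\<gamma> * r) f + \<bar>jensen_const\<bar>) +
        (2 / (\<gamma> - q) + 4 / (q - 1)) * n + r * (2 * (2 + \<gamma>) * S)) / r"
  proof -
    have 1: "2 * (\<gamma> * r) / (\<gamma> * r - q * r)\<^sup>2 = 2 * \<gamma> / (\<gamma> - q)\<^sup>2 / r"
      using r1 q1 by (simp add: power2_eq_square flip: left_diff_distrib)
    have 2: "2 / (\<gamma> * r - q * r) = 2 / (\<gamma> - q) / r" "4 / ((q - 1) * r) = 4 / (q - 1) / r"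
      using r1 q1 by (simp_all flip: left_diff_distrib)
    have "a / r * X + b / r * n + (c / r * n + Y) = (a * X + (b + c) * n + r * Y) / r" for a b c X Y
      using r1 by (simp add: field_simps)
    then show ?thesis unfolding B_def 1 2 .
  qed
  also have "K * norm z * (X / r) = K / norm z * X" for X
    using z by (simp add: r_def power2_eq_square)
  finally show "ln (norm (f ((z + \<i> * \<beta>)\<^sup>2))) - ln (norm (f (z\<^sup>2))) \<le> K / norm z *
       (2 * \<gamma> / (\<gamma> - q)\<^sup>2 * (2 * nevanlinna_char (\<gamma> * r) f + \<bar>jensen_const\<bar>) +
        (2 / (\<gamma> - q) + 4 / (q - 1)) * n + r * (2 * (2 + \<gamma>) * S))"
    by (simp only: x_def w_def)
qed

end

section \<open>From one block of radii to all radii outside an exceptional set\<close>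

definition growth :: "real \<Rightarrow> (complex \<Rightarrow> complex) \<Rightarrow> real \<Rightarrow> real" where
  "growth \<gamma> f r = nevanlinna_char (\<gamma> * r) f / sqrt r
     + real (zero_pole_count (\<gamma> * r) f) / sqrt r * ln r powr \<gamma>
         * ln_plus (real (zero_pole_count (\<gamma> * r) f))"

lemma (in mero_nonzero) growth_nonneg:
  assumes "\<gamma> \<ge> 1" "r \<ge> 1"
  shows "growth \<gamma> f r \<ge> 0"
proof -
  have "\<gamma> * r \<ge> 1" using mult_mono[of 1 \<gamma> 1 r] assms by simp
  then show ?thesis
    unfolding growth_def using assms
    by (intro add_nonneg_nonneg mult_nonneg_nonneg divide_nonneg_nonneg nevanlinna_char_nonneg)
       (auto simp: ln_plus_nonneg)
qed

lemma (in mero_nonzero) zero_pole_count_mono: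
  assumes "r \<le> s"
  shows "zero_pole_count r f \<le> zero_pole_count s f"
proof -
  have "real (zero_pole_count r f) \<le> real (zero_pole_count s f)"
    unfolding zero_pole_count_eq using assms by (intro sum_mono2 finite_div_supp) (auto simp: div_supp_def)
  then show ?thesis by simp
qed

lemma (in mero_nonzero) countable_bad_radii:
  assumes "c > 0"
  shows "countable {r. r > 1 \<and> \<not> radius_ok (c * r)}"
proof (rule countable_subset)
  show "{r. r > 1 \<and> \<not> radius_ok (c * r)} \<subseteq> (\<lambda>p. norm p / c) ` (\<Union>n::nat. div_supp (real n) f)"
  proof
    fix r assume "r \<in> {r. r > 1 \<and> \<not> radius_ok (c * r)}"
    then have r: "r > 1" "\<not> radius_ok (c * r)" by auto
    then obtain p where p: "norm p = c * r" "zorder f p \<noteq> 0"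
      using assms by (auto simp: radius_ok_def)
    obtain n :: nat where "norm p \<le> real n" using real_arch_simple by blast
    then have "p \<in> (\<Union>n::nat. div_supp (real n) f)" using p by (auto simp: div_supp_def)
    moreover have "r = norm p / c" using p assms by simp
    ultimately show "r \<in> (\<lambda>p. norm p / c) ` (\<Union>n::nat. div_supp (real n) f)" by blast
  qed
  show "countable ((\<lambda>p. norm p / c) ` (\<Union>n::nat. div_supp (real n) f))"
    by (intro countable_image countable_UN) (auto intro: countable_finite)
qed

text \<open>The order conditions make \<open>f\<close> analytic and nonzero at both points, so the
  logarithms can be exponentiated. The allowance 1/4 ln |z|^2 amounts to a factor |z|^(1/2), less
  than the |z| gained by a Wilson quotient.\<close>

definition shift_controlled :: "real \<Rightarrow> real \<Rightarrow> real \<Rightarrow> (complex \<Rightarrow> complex) \<Rightarrow> complex \<Rightarrow> bool" where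
  "shift_controlled \<gamma> A \<beta> f z \<longleftrightarrow> zorder f (z\<^sup>2) = 0 \<and> zorder f ((z + \<i> * \<beta>)\<^sup>2) = 0 \<and>
     ln (norm (f ((z + \<i> * \<beta>)\<^sup>2))) - ln (norm (f (z\<^sup>2))) \<le>
       1 / 4 * ln ((norm z)\<^sup>2) + A * growth \<gamma> f ((norm z)\<^sup>2)"

text \<open>The order of quantifiers is the point: the constant is fixed before \<open>f\<close>,
  whereas the exceptional set may depend on \<open>f\<close>.\<close>

lemma shift_bound:
  fixes \<gamma> \<beta> :: real
  assumes \<gamma>: "\<gamma> > 1"
  shows "\<exists>A\<ge>0. \<forall>f. mero_nonzero f \<longrightarrow> (\<exists>E. E \<subseteq> {1<..} \<and> finite_log_measure E \<and>
    (\<forall>z. 1 < (norm z)\<^sup>2 \<and> (norm z)\<^sup>2 \<notin> E \<longrightarrow> shift_controlled \<gamma> A \<beta> f z))"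
proof -
  define q where "q = sqrt \<gamma>"
  \<comment> \<open>Any value strictly between 1 and \<gamma> serves: above 1 for summability over
    the blocks, below \<gamma> to absorb ln j.\<close>
  define \<eta> where "\<eta> = (1 + \<gamma>) / 2"
  \<comment> \<open>From \<open>shift_pt_bound\<close> with |p| <= q^(j+2) = \<gamma> q^j.\<close>
  define D where "D = 2 * \<gamma> + 2 * \<beta>\<^sup>2"
  define K where "K = 2 * \<bar>\<beta>\<bar> + \<beta>\<^sup>2"
  define CT where "CT = 2 * \<gamma> / (\<gamma> - q)\<^sup>2"
  define C1 where "C1 = 2 / (\<gamma> - q) + 4 / (q - 1)"
  define C2 where "C2 = 4 * (2 * ((ln (1 + 2 * D) + \<eta> / (\<gamma> - \<eta>)) + ln 4) + 1)"
  \<comment> \<open>The first summand comes from \<open>nat_le_ln_plus\<close>. The second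
    multiplies 2 (2 + \<gamma>) by the 2 in \<open>S\<close>, by r / q^j <= q, by \<open>C2\<close>
    from \<open>block_log_bound\<close>, and by 1 / (ln q)^\<gamma> from j <= ln r / ln q.\<close>
  define C5 where "C5 = 2 * C1 + 4 * (2 + \<gamma>) * (q * C2 / ln q powr \<gamma>)"
  define A where "A = K * (2 * CT + C5)"
  have q0: "q > 1" "q * q = \<gamma>" using \<gamma> by (auto simp: q_def)
  then have q: "q < \<gamma>" using mult_strict_left_mono[of 1 q q] by auto
  have D: "D \<ge> q" "D > 0" using q \<gamma> zero_le_power2[of \<beta>] by (auto simp: D_def add_pos_nonneg intro: add_increasing2)
  have \<eta>: "\<eta> > 1" "\<eta> < \<gamma>" using \<gamma> by (auto simp: \<eta>_def)
  have K: "K \<ge> 0" by (simp add: K_def)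
  have CT: "CT \<ge> 0" using \<gamma> by (simp add: CT_def)
  have C1: "C1 \<ge> 0" using q q0 by (simp add: C1_def)
  have C2: "C2 \<ge> 0"
    unfolding C2_def using D \<eta> by (intro mult_nonneg_nonneg add_nonneg_nonneg ln_ge_zero divide_nonneg_nonneg) auto
  have C5: "C5 \<ge> 0"
    unfolding C5_def using C1 C2 q0 \<gamma> by (intro add_nonneg_nonneg mult_nonneg_nonneg divide_nonneg_nonneg) auto
  have A: "A \<ge> 0" unfolding A_def using K CT C5 by (intro mult_nonneg_nonneg add_nonneg_nonneg) auto
  have "\<exists>E. E \<subseteq> {1<..} \<and> finite_log_measure E \<and>
    (\<forall>z. 1 < (norm z)\<^sup>2 \<and> (norm z)\<^sup>2 \<notin> E \<longrightarrow> shift_controlled \<gamma> A \<beta> f z)" if "mero_nonzero f" for f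
  proof -
    interpret mero_nonzero f by fact
    define J where "J = (\<lambda>j. div_supp (q ^ (j + 2)) f \<times> {0, 1, 2::nat})"
    define w where "w = (\<lambda>i::complex \<times> nat. \<bar>real_of_int (zorder f (fst i))\<bar>)"
    have sumw: "sum w (J j) = 3 * real (zero_pole_count (q ^ (j + 2)) f)" for j
      unfolding J_def w_def zero_pole_count_eq
      unfolding sum.cartesian_product' by (simp add: sum_distrib_left)
    have J1: "finite (J j)" for j by (simp add: J_def)
    have J2: "1 \<le> w i" if "i \<in> J j" for i j
      using that by (auto simp: J_def w_def div_supp_def)
    have J3: "\<bar>shift_pt \<beta> i\<bar> \<le> D * q ^ j" if "i \<in> J j" for i j
    proof -
      have "norm (fst i) \<le> q ^ (j + 2)" using that by (auto simp: J_def div_supp_def)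
      also have "q ^ (j + 2) = \<gamma> * q ^ j" using q0(2) by (simp add: mult_ac flip: q0(2))
      finally have "2 * norm (fst i) + 2 * \<beta>\<^sup>2 \<le> 2 * (\<gamma> * q ^ j) + 2 * \<beta>\<^sup>2 * q ^ j"
        using q0 mult_left_mono[of 1 "q ^ j" "2 * \<beta>\<^sup>2"] one_le_power[of q j] by simp
      then show ?thesis using shift_pt_bound[of \<beta> i] by (simp add: D_def algebra_simps)
    qed
    have "\<exists>E. E \<subseteq> {1<..} \<and> finite_log_measure E \<and>
      (\<forall>j r. j > 0 \<and> q ^ j \<le> r \<and> r \<le> q ^ Suc j \<and> r \<notin> E \<longrightarrow> (\<forall>i\<in>J j. r \<noteq> shift_pt \<beta> i) \<and>
         (\<Sum>i\<in>J j. w i / \<bar>r - shift_pt \<beta> i\<bar>) \<le>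
           2 * ((1 + sum w (J j)) * ln (1 + 2 * D * (real j powr \<eta> * (1 + sum w (J j)))) * real j powr \<eta> / q ^ j))"
      (is "\<exists>E. ?P E")
      by (rule exceptional_set[OF q0(1) \<eta>(1) D(1) J1]) (fact J2 J3)+
    then obtain E0 where "?P E0" ..
    note E0 = this[THEN conjunct1] this[THEN conjunct2, THEN conjunct1]
      this[THEN conjunct2, THEN conjunct2]
    have "eventually (\<lambda>r. (K * (CT * \<bar>jensen_const\<bar>) + K * C5 * ln r powr \<gamma>) / sqrt r \<le> 1 / 4 * ln r) at_top"
      using \<gamma> by (intro eventually_slack) auto
    moreover have "eventually (\<lambda>r::real. ln r \<ge> 1) at_top" by real_asymp
    moreover have "eventually (\<lambda>r::real. r \<ge> q) at_top" by (rule eventually_ge_at_top)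
    moreover have "eventually (\<lambda>r::real. sqrt r \<ge> 2 * \<bar>\<beta>\<bar>) at_top"
      using sqrt_at_top by (simp add: filterlim_at_top)
    moreover have "eventually (\<lambda>r::real. sqrt r \<ge> K / ((q - 1) / 2)) at_top"
      using sqrt_at_top by (simp add: filterlim_at_top)
    ultimately have "eventually (\<lambda>r. (K * (CT * \<bar>jensen_const\<bar>) + K * C5 * ln r powr \<gamma>) / sqrt r \<le> 1 / 4 * ln r
       \<and> ln r \<ge> 1 \<and> r \<ge> q \<and> sqrt r \<ge> 2 * \<bar>\<beta>\<bar> \<and> sqrt r \<ge> K / ((q - 1) / 2)) at_top"
      by eventually_elim blast
    then obtain R0 where R0: "\<And>r. r \<ge> R0 \<Longrightarrow>
       (K * (CT * \<bar>jensen_const\<bar>) + K * C5 * ln r powr \<gamma>) / sqrt r \<le> 1 / 4 * ln r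
       \<and> ln r \<ge> 1 \<and> r \<ge> q \<and> sqrt r \<ge> 2 * \<bar>\<beta>\<bar> \<and> sqrt r \<ge> K / ((q - 1) / 2)"
      by (auto simp: eventually_at_top_linorder)
    \<comment> \<open>\<open>R0\<close> depends on \<open>f\<close> through
      \<open>jensen_const\<close>, which is harmless because it affects only the exceptional set and
      not \<open>A\<close>.\<close>
    define E where "E = E0 \<union> {1<..R0} \<union> {r. r > 1 \<and> \<not> radius_ok (\<gamma> * r)}"
    show ?thesis
    proof (intro exI[of _ E] conjI allI impI)
      show "E \<subseteq> {1<..}" using E0(1) by (auto simp: E_def)
      show "finite_log_measure E"
        unfolding E_def using \<gamma>
        by (intro finite_log_measure_Un E0 finite_log_measure_bounded finite_log_measure_countable
            countable_bad_radii) auto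
      fix z :: complex assume z: "1 < (norm z)\<^sup>2 \<and> (norm z)\<^sup>2 \<notin> E"
      define r where "r = (norm z)\<^sup>2"
      have r: "r > 1" "r \<notin> E0" "r > R0" "radius_ok (\<gamma> * r)"
        using z by (auto simp: r_def E_def)
      have sqr: "sqrt r = norm z" by (simp add: r_def)
      note R = R0[OF less_imp_le[OF r(3)]]
      have slack: "(K * (CT * \<bar>jensen_const\<bar>) + K * C5 * ln r powr \<gamma>) / norm z \<le> 1 / 4 * ln r"
        and lnr: "ln r \<ge> 1" and rq: "r \<ge> q" and z1: "2 * \<bar>\<beta>\<bar> \<le> norm z" and z2: "K / ((q - 1) / 2) \<le> norm z"
        using R unfolding sqr by auto
      have z2': "K \<le> (q - 1) / 2 * norm z" using z2 q0 by (simp add: field_simps)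
      have z0: "norm z \<ge> 1"
        using r(1) power_le_one[of "norm z" 2] unfolding r_def by (meson linear norm_ge_zero not_le)
      obtain j :: nat where j: "j > 0" "q ^ j \<le> r" "r \<le> q ^ Suc j" "real j \<le> ln r / ln q"
        using log_block_exists[OF q0(1) rq] by blast
      define n where "n = zero_pole_count (\<gamma> * r) f"
      define L where "L = real n * ln_plus (real n) + 1"
      have L: "L \<ge> 1" by (simp add: L_def ln_plus_nonneg)
      have "q ^ (j + 2) \<le> \<gamma> * r"
        unfolding q0(2)[symmetric] using mult_left_mono[OF j(2), of "q * q"] q0(1) by (simp add: mult_ac)
      then have M: "1 \<le> 1 + sum w (J j)" "1 + sum w (J j) \<le> 1 + 3 * real n"
        using zero_pole_count_mono by (auto simp: sumw n_def)
      define M where "M = 1 + sum w (J j)"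
      define S where "S = 2 * (M * ln (1 + 2 * D * (real j powr \<eta> * M)) * real j powr \<eta> / q ^ j)"
      have jl: "real j powr \<gamma> \<le> ln r powr \<gamma> / ln q powr \<gamma>"
      proof -
        have "real j powr \<gamma> \<le> (ln r / ln q) powr \<gamma>" using j \<gamma> by (intro powr_mono2) auto
        then show ?thesis using lnr q0 by (simp add: powr_divide)
      qed
      have MB: "M * ln (1 + 2 * D * (real j powr \<eta> * M)) * real j powr \<eta> \<le> C2 * real j powr \<gamma> * L"
        unfolding C2_def L_def M_def using block_log_bound[OF D(2) _ \<eta>(2) j(1) M] \<eta> by simp
      have "r * S \<le> q * (2 * (C2 * real j powr \<gamma> * L))"
      proof -
        have "r * S = (r / q ^ j) * (2 * (M * ln (1 + 2 * D * (real j powr \<eta> * M)) * real j powr \<eta>))"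
          by (simp add: S_def)
        also have "\<dots> \<le> (r / q ^ j) * (2 * (C2 * real j powr \<gamma> * L))"
          using MB r q0 by (intro mult_left_mono) auto
        also have "\<dots> \<le> q * (2 * (C2 * real j powr \<gamma> * L))"
          using j(3) q0 C2 L by (intro mult_right_mono) (auto simp: divide_le_eq)
        finally show ?thesis .
      qed
      also have "\<dots> \<le> q * (2 * (C2 * (ln r powr \<gamma> / ln q powr \<gamma>) * L))"
        using jl q0 C2 L by (intro mult_left_mono mult_right_mono) auto
      finally have "2 * (2 + \<gamma>) * (r * S) \<le> 2 * (2 + \<gamma>) * (q * (2 * (C2 * (ln r powr \<gamma> / ln q powr \<gamma>) * L)))"
        using \<gamma> by (intro mult_left_mono) auto
      also have "\<dots> = 4 * (2 + \<gamma>) * (q * C2 / ln q powr \<gamma>) * (ln r powr \<gamma> * L)"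
        by simp
      finally have rS: "r * (2 * (2 + \<gamma>) * S) \<le> 4 * (2 + \<gamma>) * (q * C2 / ln q powr \<gamma>) * (ln r powr \<gamma> * L)"
        by (simp only: mult_ac)
      have lp: "ln r powr \<gamma> \<ge> 1" using lnr \<gamma> by (simp add: ge_one_powr_ge_zero)
      have "C1 * real n \<le> C1 * (2 * L)"
        using nat_le_ln_plus[of n] C1 by (intro mult_left_mono) (auto simp: L_def)
      also have "\<dots> \<le> 2 * C1 * (ln r powr \<gamma> * L)"
        using mult_left_mono[of L "ln r powr \<gamma> * L" "2 * C1"] mult_right_mono[OF lp, of L] L C1 by (simp add: mult_ac)
      finally have C1n: "C1 * real n \<le> 2 * C1 * (ln r powr \<gamma> * L)" .
      have sumS: "(\<Sum>i\<in>J j. w i / \<bar>r - shift_pt \<beta> i\<bar>) \<le> S"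
        unfolding S_def M_def using E0(3) j(1-3) r(2) by blast
      note est = shift_estimate[OF \<gamma> q_def, of z j \<beta> S, folded r_def K_def, folded n_def CT_def C1_def,
        OF r(4) j(2,3) z0 z1 z2']
      have *: "r \<noteq> shift_pt \<beta> i" if "i \<in> div_supp (q ^ (j + 2)) f \<times> {0, 1, 2}" for i
        using E0(3) j(1-3) r(2) that unfolding J_def by blast
      have **: "(\<Sum>i\<in>div_supp (q ^ (j + 2)) f \<times> {0, 1, 2}. \<bar>real_of_int (zorder f (fst i))\<bar> / \<bar>r - shift_pt \<beta> i\<bar>) \<le> S"
        using sumS by (simp add: J_def w_def)
      note est = est[OF * **]
      have gr: "growth \<gamma> f r = (nevanlinna_char (\<gamma> * r) f + ln r powr \<gamma> * (real n * ln_plus (real n))) / norm z"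
        by (simp add: growth_def sqr n_def add_divide_distrib mult_ac)
      have T0: "nevanlinna_char (\<gamma> * r) f \<ge> 0"
        using \<gamma> r mult_mono[of 1 \<gamma> 1 r] by (intro nevanlinna_char_nonneg) simp
      have "ln (norm (f ((z + \<i> * \<beta>)\<^sup>2))) - ln (norm (f (z\<^sup>2))) \<le> K / norm z *
         (CT * (2 * nevanlinna_char (\<gamma> * r) f + \<bar>jensen_const\<bar>) + C1 * real n + r * (2 * (2 + \<gamma>) * S))"
        by (rule est(3))
      also have "\<dots> \<le> K / norm z *
         (CT * (2 * nevanlinna_char (\<gamma> * r) f + \<bar>jensen_const\<bar>) + C5 * (ln r powr \<gamma> * L))"
        using rS C1n K unfolding C5_def distrib_right
        by (intro mult_left_mono) (auto simp: add.assoc intro!: add_mono)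
      \<comment> \<open>Regrouping: the Jensen constant and the 1 inside \<open>L\<close> form the
        first fraction, paid for by \<open>slack\<close>; the second is a multiple of the two terms
        of \<open>growth\<close>.\<close>
      also have "\<dots> = (K * (CT * \<bar>jensen_const\<bar>) + K * C5 * ln r powr \<gamma>) / norm z +
         (K * (2 * CT) * nevanlinna_char (\<gamma> * r) f + K * C5 * (ln r powr \<gamma> * (real n * ln_plus (real n)))) / norm z"
        by (simp add: L_def algebra_simps add_divide_distrib)
      also have "\<dots> \<le> 1 / 4 * ln r + A * growth \<gamma> f r"
      proof (intro add_mono slack)
        have "K * (2 * CT) * nevanlinna_char (\<gamma> * r) f + K * C5 * (ln r powr \<gamma> * (real n * ln_plus (real n)))
           \<le> A * nevanlinna_char (\<gamma> * r) f + A * (ln r powr \<gamma> * (real n * ln_plus (real n)))"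
          using K CT C5 T0
          by (intro add_mono mult_right_mono) (auto simp: A_def distrib_left ln_plus_nonneg)
        then have "(K * (2 * CT) * nevanlinna_char (\<gamma> * r) f + K * C5 * (ln r powr \<gamma> * (real n * ln_plus (real n)))) / norm z
           \<le> (A * nevanlinna_char (\<gamma> * r) f + A * (ln r powr \<gamma> * (real n * ln_plus (real n)))) / norm z"
          by (intro divide_right_mono) auto
        also have "\<dots> = A * growth \<gamma> f r"
          unfolding gr by (simp add: distrib_left)
        finally show "(K * (2 * CT) * nevanlinna_char (\<gamma> * r) f + K * C5 * (ln r powr \<gamma> * (real n * ln_plus (real n)))) / norm z
          \<le> A * growth \<gamma> f r" .
      qed
      finally show "shift_controlled \<gamma> A \<beta> f z"
        using est(1,2) unfolding shift_controlled_def r_def[symmetric] by simp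
    qed
  qed
  then show ?thesis using A by blast
qed

section \<open>The Wilson operator and its iterates\<close>

text \<open>Induction with z arbitrary: half-shifts compose, and |z + i/2| - k/2 and |z - i/2| - k/2
  are both at least |z| - (k + 1)/2, so the induction hypothesis applies at both neighbours with the
  same M.\<close>

lemma wilson_iter_bound:
  fixes f :: "complex \<Rightarrow> complex" and M :: real
  assumes "norm z > real k / 2"
    and "\<And>m::int. \<bar>m\<bar> \<le> int k \<Longrightarrow> f analytic_on {(z + \<i> * of_real (of_int m / 2))\<^sup>2}"
    and "\<And>m::int. \<bar>m\<bar> \<le> int k \<Longrightarrow> norm (f ((z + \<i> * of_real (of_int m / 2))\<^sup>2)) \<le> M"
  shows "(wilson_op ^^ k) f analytic_on {z\<^sup>2} \<and> norm ((wilson_op ^^ k) f (z\<^sup>2)) \<le> M / (norm z - real k / 2) ^ k"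
  using assms
proof (induction k arbitrary: z)
  case 0
  have e: "(z + \<i> * of_real (of_int 0 / 2))\<^sup>2 = z\<^sup>2" by simp
  have "f analytic_on {z\<^sup>2}" "norm (f (z\<^sup>2)) \<le> M"
    using "0.prems"(2)[of 0] "0.prems"(3)[of 0] unfolding e by simp_all
  then show ?case by simp
next
  case (Suc k)
  let ?g = "(wilson_op ^^ k) f"
  have M: "M \<ge> 0" by (rule order_trans[OF norm_ge_zero Suc.prems(3)[of 0]]) simp
  have step: "?g analytic_on {(z + \<i> * of_real (s / 2))\<^sup>2} \<and>
      norm (?g ((z + \<i> * of_real (s / 2))\<^sup>2)) \<le> M / (norm z - real (Suc k) / 2) ^ k"
    if s: "s = of_int e" "\<bar>e\<bar> = 1" for s e
  proof -
    let ?z = "z + \<i> * of_real (s / 2)"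
    have "norm (\<i> * complex_of_real (s / 2)) = 1 / 2"
      using s by (auto simp: norm_mult abs_if split: if_splits)
    then have nz: "norm z - 1 / 2 \<le> norm ?z"
      using norm_diff_ineq[of z "\<i> * of_real (s / 2)"] by simp
    then have k: "norm ?z > real k / 2" using Suc.prems(1) by simp
    have shift: "?z + \<i> * of_real (of_int m / 2) = z + \<i> * of_real (of_int (m + e) / 2)" for m
      using s by (simp add: algebra_simps add_divide_distrib)
    have IH: "?g analytic_on {?z\<^sup>2} \<and> norm (?g (?z\<^sup>2)) \<le> M / (norm ?z - real k / 2) ^ k"
    proof (rule Suc.IH[OF k]; unfold shift)
      fix m :: int assume "\<bar>m\<bar> \<le> int k"
      then have "\<bar>m + e\<bar> \<le> int (Suc k)" using s by auto
      then show "f analytic_on {(z + \<i> * of_real (of_int (m + e) / 2))\<^sup>2}"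
        "norm (f ((z + \<i> * of_real (of_int (m + e) / 2))\<^sup>2)) \<le> M"
        using Suc.prems(2,3) by blast+
    qed
    have "M / (norm ?z - real k / 2) ^ k \<le> M / (norm z - real (Suc k) / 2) ^ k"
      using nz Suc.prems(1) M
      by (intro divide_left_mono power_mono mult_pos_pos zero_less_power) (auto simp: field_simps)
    with IH show ?thesis by linarith
  qed
  have plus: "?g analytic_on {(z + \<i> / 2)\<^sup>2}" "norm (?g ((z + \<i> / 2)\<^sup>2)) \<le> M / (norm z - real (Suc k) / 2) ^ k"
    using step[of 1 1] by simp_all
  have minus: "?g analytic_on {(z - \<i> / 2)\<^sup>2}" "norm (?g ((z - \<i> / 2)\<^sup>2)) \<le> M / (norm z - real (Suc k) / 2) ^ k"
    using step[of "- 1" "- 1"] by simp_all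
  have z: "z \<noteq> 0" using Suc.prems(1) by auto
  have an: "?g analytic_on {(z + \<i> / 2)\<^sup>2, (z - \<i> / 2)\<^sup>2}"
    using plus(1) minus(1) analytic_on_analytic_at[of ?g "{(z + \<i> / 2)\<^sup>2, (z - \<i> / 2)\<^sup>2}"] by auto
  have "wilson_quotient ?g analytic_on {z\<^sup>2}"
    using z by (intro wilson_quotient_analytic[OF _ refl an]) simp
  then have 1: "wilson_op ?g analytic_on {z\<^sup>2}"
    unfolding wilson_op_def by (rule remove_sings_analytic_on)
  have pos: "norm z - real (Suc k) / 2 > 0" using Suc.prems(1) by simp
  have "norm (wilson_op ?g (z\<^sup>2)) = norm (?g ((z + \<i> / 2)\<^sup>2) - ?g ((z - \<i> / 2)\<^sup>2)) / (2 * norm z)"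
    using wilson_op_eq[OF _ refl an] z by (simp add: norm_divide norm_mult)
  \<comment> \<open>The two function values cost a factor 2, cancelled by the 2 in 2iz, so no power
    of 2 accumulates.\<close>
  also have "\<dots> \<le> (2 * (M / (norm z - real (Suc k) / 2) ^ k)) / (2 * norm z)"
    using norm_triangle_ineq4[of "?g ((z + \<i> / 2)\<^sup>2)" "?g ((z - \<i> / 2)\<^sup>2)"] plus(2) minus(2)
    by (intro divide_right_mono) (linarith, simp)
  also have "\<dots> = M / (norm z - real (Suc k) / 2) ^ k / norm z"
    by simp
  also have "\<dots> \<le> M / (norm z - real (Suc k) / 2) ^ k / (norm z - real (Suc k) / 2)"
    using M pos z by (intro divide_left_mono divide_nonneg_nonneg mult_pos_pos) auto
  also have "\<dots> = M / (norm z - real (Suc k) / 2) ^ Suc k"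
    by (simp add: mult.commute)
  finally show ?case using 1 by simp
qed

lemma shift_bound_uniform:
  fixes \<gamma> :: real and k :: nat
  assumes \<gamma>: "\<gamma> > 1"
  shows "\<exists>A\<ge>0. \<forall>f. mero_nonzero f \<longrightarrow> (\<exists>E. E \<subseteq> {1<..} \<and> finite_log_measure E \<and>
    (\<forall>z. 1 < (norm z)\<^sup>2 \<and> (norm z)\<^sup>2 \<notin> E \<longrightarrow>
      (\<forall>m::int. \<bar>m\<bar> \<le> int k \<longrightarrow> shift_controlled \<gamma> A (of_int m / 2) f z)))"
proof -
  obtain A where A: "\<And>m::int. A m \<ge> 0" "\<And>m f. mero_nonzero f \<Longrightarrow> (\<exists>E. E \<subseteq> {1<..} \<and> finite_log_measure E \<and>
    (\<forall>z. 1 < (norm z)\<^sup>2 \<and> (norm z)\<^sup>2 \<notin> E \<longrightarrow> shift_controlled \<gamma> (A m) (of_int m / 2) f z))"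
    using shift_bound[OF \<gamma>, of "of_int _ / 2"] by metis
  let ?I = "{- int k..int k}"
  show ?thesis
  \<comment> \<open>As \<open>growth\<close> is nonnegative, the sum of the finitely many constants
    works for every m, and it is still independent of \<open>f\<close>.\<close>
  proof (intro exI[of _ "sum A ?I"] conjI allI impI)
    show "sum A ?I \<ge> 0" using A(1) by (intro sum_nonneg) auto
    fix f assume f: "mero_nonzero f"
    then interpret mero_nonzero f .
    obtain E where E: "\<And>m::int. E m \<subseteq> {1<..}" "\<And>m. finite_log_measure (E m)"
      "\<And>m z. 1 < (norm z)\<^sup>2 \<Longrightarrow> (norm z)\<^sup>2 \<notin> E m \<Longrightarrow> shift_controlled \<gamma> (A m) (of_int m / 2) f z"
      using A(2)[OF f] by metis
    show "\<exists>E. E \<subseteq> {1<..} \<and> finite_log_measure E \<and>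
      (\<forall>z. 1 < (norm z)\<^sup>2 \<and> (norm z)\<^sup>2 \<notin> E \<longrightarrow>
        (\<forall>m::int. \<bar>m\<bar> \<le> int k \<longrightarrow> shift_controlled \<gamma> (sum A ?I) (of_int m / 2) f z))"
    proof (intro exI[of _ "\<Union>m\<in>?I. E m"] conjI allI impI)
      show "(\<Union>m\<in>?I. E m) \<subseteq> {1<..}" using E(1) by blast
      show "finite_log_measure (\<Union>m\<in>?I. E m)" using E(2) by (intro finite_log_measure_Union) auto
      fix z :: complex and m :: int
      assume z: "1 < (norm z)\<^sup>2 \<and> (norm z)\<^sup>2 \<notin> (\<Union>m\<in>?I. E m)" and m: "\<bar>m\<bar> \<le> int k"
      have mI: "m \<in> ?I" using m by auto
      then have "shift_controlled \<gamma> (A m) (of_int m / 2) f z" using z by (intro E(3)) auto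
      moreover have "A m * growth \<gamma> f ((norm z)\<^sup>2) \<le> sum A ?I * growth \<gamma> f ((norm z)\<^sup>2)"
        using z \<gamma> A(1) mI by (intro mult_right_mono growth_nonneg member_le_sum) auto
      ultimately show "shift_controlled \<gamma> (sum A ?I) (of_int m / 2) f z"
        unfolding shift_controlled_def by linarith
    qed
  qed
qed

context mero_nonzero
begin

text \<open>The case m = 0 of the control says that x is neither zero nor pole of \<open>f\<close>.
  Hence the quotient is analytic at x, \<open>remove_sings\<close> leaves its value alone, and |f x|
  cancels from the bound.\<close>

lemma wilson_iter_quotient_bound:
  assumes x: "norm x > 1" "sqrt (norm x) > real k / 2"
    and ctrl: "\<And>m::int. \<bar>m\<bar> \<le> int k \<Longrightarrow> shift_controlled \<gamma> A (of_int m / 2) f (csqrt x)"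
  shows "\<not> is_pole (mero_quotient ((wilson_op ^^ k) f) f) x"
    "norm (mero_quotient ((wilson_op ^^ k) f) f x) \<le>
       exp (1 / 4 * ln (norm x) + A * growth \<gamma> f (norm x)) / (sqrt (norm x) - real k / 2) ^ k"
proof -
  define z where "z = csqrt x"
  define X where "X = exp (1 / 4 * ln (norm x) + A * growth \<gamma> f (norm x))"
  have z: "z\<^sup>2 = x" "norm z = sqrt (norm x)" "(norm z)\<^sup>2 = norm x"
    by (simp_all add: z_def)
  have x0: "zorder f x = 0" using ctrl[of 0] z by (simp add: shift_controlled_def z_def)
  note fx = analytic_nonzero_if_zorder_0[OF x0]
  have *: "f analytic_on {(z + \<i> * of_real (of_int m / 2))\<^sup>2}"
    "norm (f ((z + \<i> * of_real (of_int m / 2))\<^sup>2)) \<le> norm (f x) * X" if m: "\<bar>m\<bar> \<le> int k" for m :: int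
  proof -
    let ?w = "(z + \<i> * of_real (of_int m / 2))\<^sup>2"
    have c: "zorder f ?w = 0" "ln (norm (f ?w)) - ln (norm (f x)) \<le> 1 / 4 * ln (norm x) + A * growth \<gamma> f (norm x)"
      using ctrl[OF m] z unfolding shift_controlled_def z_def[symmetric] z(1,3) by auto
    note fw = analytic_nonzero_if_zorder_0[OF c(1)]
    show "f analytic_on {?w}" by (rule fw(1))
    have "norm (f ?w) = exp (ln (norm (f ?w)))" using fw(2) by simp
    also have "\<dots> \<le> exp (ln (norm (f x)) + (1 / 4 * ln (norm x) + A * growth \<gamma> f (norm x)))"
      using c(2) by simp
    also have "\<dots> = norm (f x) * X"
      unfolding exp_add[of "ln (norm (f x))"] X_def using fx(2) by simp
    finally show "norm (f ?w) \<le> norm (f x) * X" .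
  qed
  have kz: "norm z > real k / 2" using x z by simp
  from wilson_iter_bound[OF kz *]
  have g: "(wilson_op ^^ k) f analytic_on {x}"
    "norm ((wilson_op ^^ k) f x) \<le> norm (f x) * X / (norm z - real k / 2) ^ k"
    using z by auto
  let ?h = "\<lambda>x. (wilson_op ^^ k) f x / f x"
  have h: "?h analytic_on {x}" using g(1) fx by (intro analytic_intros) auto
  then have "remove_sings ?h analytic_on {x}" by (rule remove_sings_analytic_on)
  then show "\<not> is_pole (mero_quotient ((wilson_op ^^ k) f) f) x"
    unfolding mero_quotient_def using analytic_at_imp_no_pole by blast
  have "mero_quotient ((wilson_op ^^ k) f) f x = ?h x"
    unfolding mero_quotient_def using h by simp
  then have "norm (mero_quotient ((wilson_op ^^ k) f) f x) = norm ((wilson_op ^^ k) f x) / norm (f x)"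
    by (simp add: norm_divide)
  also have "\<dots> \<le> norm (f x) * X / (norm z - real k / 2) ^ k / norm (f x)"
    using g(2) by (intro divide_right_mono) auto
  also have "\<dots> = X / (norm z - real k / 2) ^ k"
    using fx(2) by simp
  finally show "norm (mero_quotient ((wilson_op ^^ k) f) f x) \<le>
       exp (1 / 4 * ln (norm x) + A * growth \<gamma> f (norm x)) / (sqrt (norm x) - real k / 2) ^ k"
    by (simp add: X_def z)
qed

section \<open>Counting function and exponent for functions of finite order\<close>

lemma zero_pole_count_le_char:
  assumes r: "r \<ge> 1" and ok: "radius_ok (2 * r)"
  shows "real (zero_pole_count r f) \<le> 2 * (2 * nevanlinna_char (2 * r) f + \<bar>jensen_const\<bar>)"
proof -
  interpret inv: mero_nonzero "\<lambda>z. inverse (f z)" by (rule mero_nonzero_inverse)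
  \<comment> \<open>Doubling the radius gives ln 2 per pole. Zeros are treated as poles of 1/f, and
    Jensen's formula then returns to T(2r, f), whence \<open>radius_ok (2 * r)\<close>.\<close>
  have "real (pole_count r f) * ln 2 \<le> nevanlinna_char (2 * r) f"
    using pole_count_le_integrated_count[OF r, of 2] proximity_fun_nonneg[of "2 * r" f]
    by (simp add: nevanlinna_char_def)
  moreover have "real (pole_count r (\<lambda>z. inverse (f z))) * ln 2 \<le> nevanlinna_char (2 * r) (\<lambda>z. inverse (f z))"
    using inv.pole_count_le_integrated_count[OF r, of 2] proximity_fun_nonneg[of "2 * r" "\<lambda>z. inverse (f z)"]
    by (simp add: nevanlinna_char_def)
  ultimately have "real (zero_pole_count r f) * ln 2 \<le> 2 * nevanlinna_char (2 * r) f + \<bar>jensen_const\<bar>"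
    unfolding Jensen_formula[OF ok] zero_pole_count_def of_nat_add distrib_right by linarith
  moreover have "real (zero_pole_count r f) * (1 / 2) \<le> real (zero_pole_count r f) * ln 2"
    using ln_half_le by (intro mult_left_mono) auto
  ultimately show ?thesis by simp
qed

lemma eventually_char_le_powr:
  assumes ord: "nevanlinna_order f = ereal \<sigma>" and s: "\<sigma> < s"
  shows "s > 0" "eventually (\<lambda>r. nevanlinna_char r f \<le> r powr s) at_top"
proof -
  have "Limsup at_top (\<lambda>r::real. ereal (ln_plus (nevanlinna_char r f) / ln r)) < ereal s"
    using ord s by (simp add: nevanlinna_order_def)
  then have "eventually (\<lambda>r. ereal (ln_plus (nevanlinna_char r f) / ln r) < ereal s) at_top"
    by (rule Limsup_lessD)
  then have ev: "eventually (\<lambda>r. ln_plus (nevanlinna_char r f) < s * ln r \<and> r > 1) at_top"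
    using eventually_gt_at_top[of 1] by eventually_elim (auto simp: divide_less_eq)
  \<comment> \<open>One radius beyond 1 settles the sign of \<open>s\<close>, because
    \<open>ln_plus\<close> is nonnegative.\<close>
  then obtain r :: real where r: "ln_plus (nevanlinna_char r f) < s * ln r" "r > 1"
    by (metis (mono_tags, lifting) eventually_happens' trivial_limit_at_top_linorder)
  then have "0 < s * ln r" using ln_plus_nonneg[of "nevanlinna_char r f"] by linarith
  then show "s > 0" using r(2) by (simp add: zero_less_mult_iff)
  from ev show "eventually (\<lambda>r. nevanlinna_char r f \<le> r powr s) at_top"
  proof eventually_elim
    case (elim r)
    have "nevanlinna_char r f \<le> max 1 (nevanlinna_char r f)" by simp
    also have "\<dots> = exp (ln_plus (nevanlinna_char r f))" by (simp add: ln_plus_def)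
    also have "\<dots> \<le> r powr s" using elim by (simp add: powr_def)
    finally show ?case .
  qed
qed

text \<open>Half of \<epsilon> pays for passing from the limsup to T(r) <= r^s, the other half for
  the logarithms and all constants. The radius 4r appears because n(2r) is bounded through
  T(4r).\<close>

lemma growth_le_powr:
  assumes ord: "nevanlinna_order f = ereal \<sigma>" and \<epsilon>: "\<epsilon> > 0" and A: "A \<ge> 0"
  shows "eventually (\<lambda>r. radius_ok (4 * r) \<longrightarrow> A * growth 2 f r \<le> r powr (\<sigma> - 1 / 2 + \<epsilon>)) at_top"
proof -
  define s where "s = \<sigma> + \<epsilon> / 2"
  have s: "\<sigma> < s" using \<epsilon> by (simp add: s_def)
  note T = eventually_char_le_powr[OF ord s]
  \<comment> \<open>Collects the coefficients of r^s in the bound for n(2r). The added 1 makes C r^s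
    >= 1, so its logarithm also dominates \<open>ln_plus\<close>.\<close>
  define C where "C = 4 * 4 powr s + 2 * \<bar>jensen_const\<bar> + 1"
  define C' where "C' = ln C + s"
  have C: "C \<ge> 1" by (simp add: C_def)
  have "filterlim (\<lambda>r::real. 2 * r) at_top at_top" "filterlim (\<lambda>r::real. 4 * r) at_top at_top" by real_asymp+
  note T2 = eventually_compose_filterlim[OF T(2) this(1)] eventually_compose_filterlim[OF T(2) this(2)]
  have "((\<lambda>r::real. 1 / r powr (\<epsilon> / 2)) \<longlongrightarrow> 0) at_top" "((\<lambda>r::real. ln r ^ 3 / r powr (\<epsilon> / 2)) \<longlongrightarrow> 0) at_top"
    using \<epsilon> by real_asymp+
  then have "((\<lambda>r. A * (2 powr s) * (1 / r powr (\<epsilon> / 2)) + A * (C * C') * (ln r ^ 3 / r powr (\<epsilon> / 2))) \<longlongrightarrow>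
      A * (2 powr s) * 0 + A * (C * C') * 0) at_top"
    by (intro tendsto_intros)
  then have "eventually (\<lambda>r. A * (2 powr s) * (1 / r powr (\<epsilon> / 2)) + A * (C * C') * (ln r ^ 3 / r powr (\<epsilon> / 2)) < 1) at_top"
    by (rule order_tendstoD) simp
  moreover have "eventually (\<lambda>r::real. ln r \<ge> 1) at_top" by real_asymp
  ultimately show ?thesis using T2 eventually_ge_at_top[of 1]
  proof eventually_elim
    case (elim r)
    show ?case
    proof
      assume ok: "radius_ok (4 * r)"
      define n where "n = real (zero_pole_count (2 * r) f)"
      have rs: "r powr s \<ge> 1" using elim T(1) by (simp add: ge_one_powr_ge_zero)
      have "n \<le> 2 * (2 * nevanlinna_char (4 * r) f + \<bar>jensen_const\<bar>)"
        using zero_pole_count_le_char[of "2 * r"] ok elim by (simp add: n_def)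
      also have "\<dots> \<le> 2 * (2 * (4 * r) powr s + \<bar>jensen_const\<bar> * r powr s) + r powr s"
        using elim rs mult_left_mono[OF rs, of "\<bar>jensen_const\<bar>"] by simp
      also have "\<dots> = C * r powr s"
        using elim by (simp add: C_def powr_mult algebra_simps)
      finally have n: "n \<le> C * r powr s" .
      have "C * r powr s \<ge> 1" using mult_mono[OF C rs] C by simp
      then have "ln_plus n \<le> ln (C * r powr s)"
        unfolding ln_plus_def using n by (subst ln_le_cancel_iff) auto
      also have "\<dots> = ln C + s * ln r" using C elim by (simp add: ln_mult ln_powr)
      also have "\<dots> \<le> C' * ln r"
        using mult_left_mono[of 1 "ln r" "ln C"] C elim by (simp add: C'_def distrib_right)
      finally have lnn: "ln_plus n \<le> C' * ln r" .
      have n0: "n \<ge> 0" by (simp add: n_def)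
      have C'0: "C' \<ge> 0" using C T(1) by (simp add: C'_def)
      have nn: "n * ln_plus n \<le> C * r powr s * (C' * ln r)"
        using n lnn n0 C ln_plus_nonneg C'0 elim by (intro mult_mono) auto
      \<comment> \<open>The parameter 2 gives the square of ln r here; the bound for
        \<open>ln_plus n\<close> adds the third power.\<close>
      have "growth 2 f r = (nevanlinna_char (2 * r) f + ln r ^ 2 * (n * ln_plus n)) / sqrt r"
        using elim by (simp add: growth_def n_def add_divide_distrib mult_ac)
      also have "\<dots> \<le> ((2 * r) powr s + ln r ^ 2 * (C * r powr s * (C' * ln r))) / sqrt r"
        using elim nn by (intro divide_right_mono add_mono mult_left_mono) auto
      also have "\<dots> = r powr s / sqrt r * (2 powr s + C * C' * ln r ^ 3)"
        using elim by (simp add: powr_mult field_simps power2_eq_square power3_eq_cube)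
      also have "r powr s / sqrt r = r powr (s - 1 / 2)"
        using elim by (simp add: powr_diff powr_half_sqrt)
      finally have "A * growth 2 f r \<le> A * (r powr (s - 1 / 2) * (2 powr s + C * C' * ln r ^ 3))"
        using A by (intro mult_left_mono)
      also have "\<dots> = r powr (s - 1 / 2) * r powr (\<epsilon> / 2) *
          (A * (2 powr s) * (1 / r powr (\<epsilon> / 2)) + A * (C * C') * (ln r ^ 3 / r powr (\<epsilon> / 2)))"
        using elim by (simp add: field_simps)
      also have "\<dots> \<le> r powr (s - 1 / 2) * r powr (\<epsilon> / 2) * 1"
        using elim by (intro mult_left_mono) auto
      also have "\<dots> = r powr (\<sigma> - 1 / 2 + \<epsilon>)"
      proof -
        have e: "\<sigma> - 1 / 2 + \<epsilon> = (s - 1 / 2) + \<epsilon> / 2" by (simp add: s_def)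
        show ?thesis unfolding e powr_add by simp
      qed
      finally show "A * growth 2 f r \<le> r powr (\<sigma> - 1 / 2 + \<epsilon>)" .
    qed
  qed
qed

text \<open>The first estimate with \<gamma> = 2 is accurate enough. Shifts of \<open>f\<close>
  alone are used, so k enters only through the number of shifts and the power of the
  denominator.\<close>

lemma wilson_iter_quotient_finite_order:
  assumes ord: "nevanlinna_order f = ereal \<sigma>" and k: "k > 0" and \<epsilon>: "\<epsilon> > 0"
  shows "\<exists>E. E \<subseteq> {1<..} \<and> finite_log_measure E \<and>
    (\<forall>x r. r = norm x \<and> r \<notin> E \<union> {0..1} \<longrightarrow>
      \<not> is_pole (mero_quotient ((wilson_op ^^ k) f) f) x \<and>
      norm (mero_quotient ((wilson_op ^^ k) f) f x) \<le> exp (real k * r powr (\<sigma> - 1 / 2 + \<epsilon>)))"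
proof -
  define \<tau> where "\<tau> = \<sigma> - 1 / 2 + \<epsilon> / 2"
  obtain A E0 where A: "A \<ge> 0" and E0: "E0 \<subseteq> {1<..}" "finite_log_measure E0"
    and ctrl: "\<And>z m. 1 < (norm z)\<^sup>2 \<Longrightarrow> (norm z)\<^sup>2 \<notin> E0 \<Longrightarrow> \<bar>m::int\<bar> \<le> int k \<Longrightarrow>
       shift_controlled 2 A (of_int m / 2) f z"
    using shift_bound_uniform[of 2 k] mero_nonzero_axioms by auto
  have "eventually (\<lambda>r. radius_ok (4 * r) \<longrightarrow> A * growth 2 f r \<le> r powr \<tau>) at_top"
    unfolding \<tau>_def using \<epsilon> by (intro growth_le_powr[OF ord _ A]) auto
  moreover have "eventually (\<lambda>r::real. sqrt r \<ge> real k) at_top" "eventually (\<lambda>r::real. sqrt r \<ge> 2) at_top"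
    using sqrt_at_top by (simp_all add: filterlim_at_top)
  \<comment> \<open>The factor exp (-1) matters when \<tau> <= 0: the target may then be arbitrarily
    close to 1, and r^\<tau> - 1 <= 0 brings the bound down to at most 1.\<close>
  moreover have "eventually (\<lambda>r::real. exp (1 / 4 * ln r) / (sqrt r / 2) \<le> exp (- 1)) at_top"
    by real_asymp
  ultimately have "eventually (\<lambda>r. (radius_ok (4 * r) \<longrightarrow> A * growth 2 f r \<le> r powr \<tau>) \<and>
      sqrt r \<ge> real k \<and> sqrt r \<ge> 2 \<and> exp (1 / 4 * ln r) / (sqrt r / 2) \<le> exp (- 1)) at_top"
    by eventually_elim blast
  then obtain R0 where R0: "\<And>r. r \<ge> R0 \<Longrightarrow> (radius_ok (4 * r) \<longrightarrow> A * growth 2 f r \<le> r powr \<tau>) \<and>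
      sqrt r \<ge> real k \<and> sqrt r \<ge> 2 \<and> exp (1 / 4 * ln r) / (sqrt r / 2) \<le> exp (- 1)"
    by (auto simp: eventually_at_top_linorder)
  define E where "E = E0 \<union> {1<..R0} \<union> {r. r > 1 \<and> \<not> radius_ok (4 * r)}"
  show ?thesis
  proof (intro exI[of _ E] conjI allI impI)
    show "E \<subseteq> {1<..}" using E0(1) by (auto simp: E_def)
    show "finite_log_measure E"
      unfolding E_def
      by (intro finite_log_measure_Un E0 finite_log_measure_bounded finite_log_measure_countable
          countable_bad_radii) auto
    fix x :: complex and r :: real assume "r = norm x \<and> r \<notin> E \<union> {0..1}"
    then have r: "r = norm x" "r > 1" "r \<notin> E0" "r > R0" "radius_ok (4 * r)"
      using norm_ge_zero[of x] by (auto simp: E_def not_le)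
    note R = R0[OF less_imp_le[OF r(4)]]
    have sq: "(norm (csqrt x))\<^sup>2 = r" using r(1) by simp
    have x: "norm x > 1" "sqrt (norm x) > real k / 2"
      using r R by auto
    have c: "1 < (norm (csqrt x))\<^sup>2" "(norm (csqrt x))\<^sup>2 \<notin> E0" using r sq by auto
    note Q = wilson_iter_quotient_bound[OF x ctrl[OF c], folded r(1)]
    show "\<not> is_pole (mero_quotient ((wilson_op ^^ k) f) f) x" by (rule Q(1))
    \<comment> \<open>By sqrt r >= k and sqrt r >= 2. Since k > 0, one factor sqrt r / 2 can be kept
      from the k-th power, and it already outgrows r^(1/4).\<close>
    have "sqrt r / 2 \<le> sqrt r - real k / 2" "1 \<le> sqrt r / 2" using R by auto
    moreover have "sqrt r / 2 \<le> (sqrt r / 2) ^ k"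
      using \<open>1 \<le> sqrt r / 2\<close> k by (intro self_le_power) auto
    ultimately have pow: "sqrt r / 2 \<le> (sqrt r - real k / 2) ^ k"
      using power_mono[of "sqrt r / 2" "sqrt r - real k / 2" k] by linarith
    have "norm (mero_quotient ((wilson_op ^^ k) f) f x) \<le>
       exp (1 / 4 * ln r + A * growth 2 f r) / (sqrt r - real k / 2) ^ k" by (rule Q(2))
    also have "\<dots> \<le> exp (1 / 4 * ln r + A * growth 2 f r) / (sqrt r / 2)"
      using pow r(2) order_less_le_trans[of 0 "sqrt r / 2", OF _ pow] by (intro divide_left_mono mult_pos_pos) auto
    also have "\<dots> = exp (1 / 4 * ln r) / (sqrt r / 2) * exp (A * growth 2 f r)"
      by (simp add: exp_add)
    also have "\<dots> \<le> exp (- 1) * exp (r powr \<tau>)"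
      using R r(5) by (intro mult_mono) auto
    also have "\<dots> = exp (r powr \<tau> - 1)" by (simp flip: exp_add)
    also have "\<dots> \<le> exp (real k * r powr (\<sigma> - 1 / 2 + \<epsilon>))"
    proof (cases "\<tau> \<le> 0")
      case True
      then have "r powr \<tau> \<le> r powr 0" using r by (intro powr_mono) auto
      then have "r powr \<tau> - 1 \<le> 0" using r(2) by simp
      also have "0 \<le> real k * r powr (\<sigma> - 1 / 2 + \<epsilon>)" by simp
      finally show ?thesis by simp
    next
      case False
      have "r powr \<tau> \<le> r powr (\<sigma> - 1 / 2 + \<epsilon>)" using r \<epsilon> by (intro powr_mono) (auto simp: \<tau>_def)
      also have "\<dots> \<le> real k * r powr (\<sigma> - 1 / 2 + \<epsilon>)"
        using k by (simp add: mult_le_cancel_right1)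
      finally show ?thesis by simp
    qed
    finally show "norm (mero_quotient ((wilson_op ^^ k) f) f x) \<le> exp (real k * r powr (\<sigma> - 1 / 2 + \<epsilon>))" .
  qed
qed

end

section \<open>The estimate for one Wilson step, with a constant depending on \<gamma> only\<close>

theorem wilson_quotient_estimate:
  fixes \<gamma> :: real
  assumes \<gamma>: "\<gamma> > 1"
  shows "\<exists>A. \<forall>f. mero_nonzero f \<longrightarrow> (\<exists>E. E \<subseteq> {1<..} \<and> finite_log_measure E \<and>
    (\<forall>x r. r = norm x \<and> r \<notin> E \<union> {0..1} \<longrightarrow>
      \<not> is_pole (mero_quotient (wilson_op f) f) x \<and>
      norm (mero_quotient (wilson_op f) f x) \<le> 2 * exp (A * growth \<gamma> f r)))"
proof -
  obtain A where A: "\<And>f. mero_nonzero f \<Longrightarrow> (\<exists>E. E \<subseteq> {1<..} \<and> finite_log_measure E \<and>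
    (\<forall>z. 1 < (norm z)\<^sup>2 \<and> (norm z)\<^sup>2 \<notin> E \<longrightarrow>
      (\<forall>m::int. \<bar>m\<bar> \<le> int 1 \<longrightarrow> shift_controlled \<gamma> A (of_int m / 2) f z)))"
    using shift_bound_uniform[OF \<gamma>, of 1] by blast
  show ?thesis
  proof (intro exI[of _ A] allI impI)
    fix f assume f: "mero_nonzero f"
    then interpret mero_nonzero f .
    obtain E where E: "E \<subseteq> {1<..}" "finite_log_measure E"
      and ctrl: "\<And>z m. 1 < (norm z)\<^sup>2 \<Longrightarrow> (norm z)\<^sup>2 \<notin> E \<Longrightarrow> \<bar>m::int\<bar> \<le> int 1 \<Longrightarrow>
       shift_controlled \<gamma> A (of_int m / 2) f z"
      using A[OF f] by auto
    show "\<exists>E. E \<subseteq> {1<..} \<and> finite_log_measure E \<and>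
      (\<forall>x r. r = norm x \<and> r \<notin> E \<union> {0..1} \<longrightarrow>
        \<not> is_pole (mero_quotient (wilson_op f) f) x \<and>
        norm (mero_quotient (wilson_op f) f x) \<le> 2 * exp (A * growth \<gamma> f r))"
    proof (intro exI[of _ E] conjI allI impI E)
      fix x :: complex and r :: real assume "r = norm x \<and> r \<notin> E \<union> {0..1}"
      then have r: "r = norm x" "r > 1" "r \<notin> E" using norm_ge_zero[of x] by (auto simp: not_le)
      have s1: "sqrt r > 1" using r by simp
      then have "sqrt r > 1 / 2" by linarith
      then have x: "norm x > 1" "sqrt (norm x) > real 1 / 2" using r by auto
      have c: "1 < (norm (csqrt x))\<^sup>2" "(norm (csqrt x))\<^sup>2 \<notin> E" using r by auto
      note Q = wilson_iter_quotient_bound[OF x ctrl[OF c], folded r(1), simplified]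
      show "\<not> is_pole (mero_quotient (wilson_op f) f) x" by (rule Q(1))
      have "norm (mero_quotient (wilson_op f) f x) \<le> exp (ln r / 4 + A * growth \<gamma> f r) / (sqrt r - 1 / 2)"
        by (rule Q(2))
      also have "\<dots> = exp (ln r / 4) / (sqrt r - 1 / 2) * exp (A * growth \<gamma> f r)"
        by (simp add: exp_add)
      \<comment> \<open>The origin of the 2: for all r > 1, r^(1/4) <= sqrt r <= 2 (sqrt r -
        1/2).\<close>
      also have "exp (ln r / 4) / (sqrt r - 1 / 2) \<le> 2"
      proof -
        have "exp (ln r / 4) \<le> exp (ln r / 2)" using r by simp
        also have "\<dots> = sqrt r" using r(2) by (simp flip: ln_sqrt)
        also have "\<dots> \<le> 2 * (sqrt r - 1 / 2)" using s1 by simp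
        finally show ?thesis using s1 by (subst pos_divide_le_eq) linarith+
      qed
      finally show "norm (mero_quotient (wilson_op f) f x) \<le> 2 * exp (A * growth \<gamma> f r)" by simp
    qed
  qed
qed

text \<open>The value at a pole is 0 by convention, so excluding poles explicitly prevents the
  inequality from holding there for a spurious reason.\<close>

theorem theorem7p4:
  shows "(\<forall>\<gamma>::real. \<gamma> > 1 \<longrightarrow> (\<exists>A::real. \<forall>f::complex \<Rightarrow> complex.
            f nicely_meromorphic_on UNIV \<and> f \<noteq> (\<lambda>_. 0) \<longrightarrow>
            (\<exists>E\<^sub>1. E\<^sub>1 \<subseteq> {1<..} \<and> finite_log_measure E\<^sub>1 \<and>
              (\<forall>x r. r = norm x \<and> r \<notin> E\<^sub>1 \<union> {0..1} \<longrightarrow>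
                \<not> is_pole (mero_quotient (wilson_op f) f) x \<and>
                norm (mero_quotient (wilson_op f) f x) \<le>
                  2 * exp (A * (nevanlinna_char (\<gamma> * r) f / sqrt r
                    + real (zero_pole_count (\<gamma> * r) f) / sqrt r * ln r powr \<gamma>
                        * ln_plus (real (zero_pole_count (\<gamma> * r) f))))))))
       \<and>
       (\<forall>(f::complex \<Rightarrow> complex) (\<sigma>::real).
            f nicely_meromorphic_on UNIV \<and> f \<noteq> (\<lambda>_. 0) \<and> nevanlinna_order f = ereal \<sigma> \<longrightarrow>
            (\<forall>(k::nat) (\<epsilon>::real). k > 0 \<and> \<epsilon> > 0 \<longrightarrow>
              (\<exists>E. E \<subseteq> {1<..} \<and> finite_log_measure E \<and>
                (\<forall>x r. r = norm x \<and> r \<notin> E \<union> {0..1} \<longrightarrow>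
                  \<not> is_pole (mero_quotient ((wilson_op ^^ k) f) f) x \<and>
                  norm (mero_quotient ((wilson_op ^^ k) f) f x) \<le>
                    exp (real k * r powr (\<sigma> - 1 / 2 + \<epsilon>))))))"
proof (rule conjI)
  show "\<forall>\<gamma>::real. \<gamma> > 1 \<longrightarrow> (\<exists>A::real. \<forall>f::complex \<Rightarrow> complex.
            f nicely_meromorphic_on UNIV \<and> f \<noteq> (\<lambda>_. 0) \<longrightarrow>
            (\<exists>E\<^sub>1. E\<^sub>1 \<subseteq> {1<..} \<and> finite_log_measure E\<^sub>1 \<and>
              (\<forall>x r. r = norm x \<and> r \<notin> E\<^sub>1 \<union> {0..1} \<longrightarrow>
                \<not> is_pole (mero_quotient (wilson_op f) f) x \<and>
                norm (mero_quotient (wilson_op f) f x) \<le>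
                  2 * exp (A * (nevanlinna_char (\<gamma> * r) f / sqrt r
                    + real (zero_pole_count (\<gamma> * r) f) / sqrt r * ln r powr \<gamma>
                        * ln_plus (real (zero_pole_count (\<gamma> * r) f)))))))"
    using wilson_quotient_estimate unfolding mero_nonzero_def growth_def by blast
qed (blast intro: mero_nonzero.wilson_iter_quotient_finite_order mero_nonzero.intro)

end
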